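(* Let $D\subset\mathbb{R}^d$ be a bounded domain of class $C^{3+\alpha}$, and suppose that $f$ satisfies one of the following two conditions: (i) $f:D\to\mathbb{R}$ is bounded and measurable and $\operatorname{dist}(\operatorname{supp} f,\partial D)\ge2\varepsilon$ for some $\varepsilon>0$; or (ii) $f\in C^{2+\alpha}(\overline D)$ and $f(z)=Gf(z)=0$ for all $z\in\partial D$. Let $t>0$, $x\in D$, $\delta<-1$, and set $h_N:=N^{\delta}$. Let $Z=f(X_{L_t})\mathbf 1_{\{L_t<T_D\}}$, assume $\sigma(t,x)^2:=\operatorname{Var}_xZ>0$, and put $$S_N:=\frac{\sqrt N\,\big(u_N^{h_N}(t)-u(t,x)\big)}{\sigma(t,x)} .$$ Then for every bounded continuous function $\psi:\mathbb{R}\to\mathbb{R}$, $$\mathbb{E}_x\,\psi(S_N)\longrightarrow\int_{\mathbb{R}}\psi(w)\,\frac{e^{-w^2/2}}{\sqrt{2\pi}}\,dw\qquad\text{as }N\to\infty .$$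
   Context: Setting. $d\ge 1$, $\mu\in\mathbb{R}^d$, $\Sigma=(\Sigma_{ij})\in\mathbb{R}^{d\times d}$ is positive definite and $\sigma\in\mathbb{R}^{d\times d}$ is a fixed matrix with $\Sigma=\sigma\sigma^T$ (not to be confused with the number $\sigma(t,x)$). $W$ is a standard $d$-dimensional Brownian motion and, under $\mathbb{P}_x$ (expectation $\mathbb{E}_x$, variance $\operatorname{Var}_x$), $X_t=x+\mu t+\sigma W_t$, $t\ge0$; its generator is $Gu=\sum_i\mu_i\partial_{x_i}u+\frac12\sum_{i,j}\Sigma_{ij}\partial^2_{x_ix_j}u$. $T_D=\inf\{t>0:X_t\notin D\}$. Subordinator. $S=(S_t)_{t\ge0}$ is a subordinator (non-decreasing Lévy process, $S_0=0$; not to be confused with the statistic $S_N$), independent of $W$, with Laplace exponent $\phi(\lambda)=b\lambda+\int_0^\infty(1-e^{-\lambda s})\nu(ds)$, i.e. $\mathbb{E}e^{-\lambda S_t}=e^{-t\phi(\lambda)}$, where $b\ge0$ and $\int_0^\infty(1\wedge s)\nu(ds)<\infty$. It is always assumed that $b>0$ or $\nu(0,\infty)=+\infty$, so the subordinator is strictly increasing. Its inverse is $L_t=\inf\{s>0:S_s>t\}$. Target. $u(t,x)=\mathbb{E}_x[Z]=\mathbb{E}_x\big[f(X_{L_t})\mathbf 1_{\{L_t<T_D\}}\big]$. Discretely killed scheme. For $h>0$ and a horizon $q>0$, use the time grid $0,h,2h,\dots,\lfloor q/h\rfloor h,q$. The Euler scheme on this grid is $Y_0=x$, $Y_{t_i}=Y_{t_{i-1}}+\mu(t_i-t_{i-1})+\sigma(W_{t_i}-W_{t_{i-1}})$,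 interpolated between grid points by $Y_t=Y_{t_{i-1}}+\mu(t-t_{i-1})+\sigma(W_t-W_{t_{i-1}})$. The endpoint-augmented discrete exit time is $$\widehat T_D^{\,h,q}=\inf\{s\in\{h,2h,\dots,\lfloor q/h\rfloor h,q\}:Y_s\notin D\},\qquad \inf\emptyset=+\infty ,$$ and $\widehat T_D^{\,h,L_t}$ is obtained by taking pathwise $q=L_t$. Expressions of the form $f(\cdot)\mathbf 1_{A}$ are $0$ off $A$. Estimator. $Z_h=f(Y_{L_t})\mathbf 1_{\{L_t<\widehat T_D^{\,h,L_t}\}}$ and $u_N^h(t)=\frac1N\sum_{k=1}^NZ_h^k$, where $Z_h^1,\dots,Z_h^N$ are independent copies of $Z_h$ under $\mathbb{P}_x$. Hölder spaces. $\alpha\in(0,1)$ is a fixed exponent; $C^{2+\alpha}(\overline D)$ is the space of functions with bounded continuous derivatives up to order $2$ whose second derivatives are $\alpha$-Hölder on $\overline D$. Class $C^{3+\alpha}$ for domains is in the usual (Gilbarg–Trudinger) sense. *)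

theory Defs
  imports "HOL-Probability.Probability"
begin

section \<open>Hoelder classes and domains\<close>

definition partial_deriv :: "'d::finite \<Rightarrow> (real^'d \<Rightarrow> real) \<Rightarrow> real^'d \<Rightarrow> real" where
  "partial_deriv i g z = frechet_derivative g (at z) (axis i 1)"

primrec iter_partial :: "'d::finite list \<Rightarrow> (real^'d \<Rightarrow> real) \<Rightarrow> real^'d \<Rightarrow> real" where
  "iter_partial [] g = g"
| "iter_partial (i # \<beta>) g = partial_deriv i (iter_partial \<beta> g)"

text \<open>Multi-indices are lists of coordinates, so the order of a derivative is the length of the
  list. The set \<^term>\<open>U\<close> is meant to be open.\<close>

definition C_k_on :: "nat \<Rightarrow> (real^'d::finite) set \<Rightarrow> (real^'d \<Rightarrow> real) \<Rightarrow> bool" where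
  "C_k_on k U g \<longleftrightarrow>
     (\<forall>\<beta>. length \<beta> < k \<longrightarrow> (\<forall>z\<in>U. iter_partial \<beta> g differentiable (at z))) \<and>
     (\<forall>\<beta>. length \<beta> \<le> k \<longrightarrow> continuous_on U (iter_partial \<beta> g))"

definition hoelder_on :: "real \<Rightarrow> 'a::metric_space set \<Rightarrow> ('a \<Rightarrow> real) \<Rightarrow> bool" where
  "hoelder_on \<alpha> K g \<longleftrightarrow> (\<exists>C. \<forall>y\<in>K. \<forall>z\<in>K. \<bar>g y - g z\<bar> \<le> C * dist y z powr \<alpha>)"

text \<open>The class $C^{k,\alpha}(U)$ for open $U$: as in Gilbarg--Trudinger, the Hoelder condition on
  the derivatives of order $k$ is local, i.e. uniform on compact subsets.\<close>

definition C_k_alpha_on :: "nat \<Rightarrow> real \<Rightarrow> (real^'d::finite) set \<Rightarrow> (real^'d \<Rightarrow> real) \<Rightarrow> bool" where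
  "C_k_alpha_on k \<alpha> U g \<longleftrightarrow> C_k_on k U g \<and>
     (\<forall>\<beta>. length \<beta> = k \<longrightarrow> (\<forall>K. compact K \<and> K \<subseteq> U \<longrightarrow> hoelder_on \<alpha> K (iter_partial \<beta> g)))"

text \<open>Derivatives are taken in the open set \<^term>\<open>D\<close> only and carried over to the closure by
  taking limits from inside; at points of \<^term>\<open>D\<close> where the derivative is continuous the limit
  is the derivative itself.\<close>

definition closure_partial ::
    "(real^'d::finite) set \<Rightarrow> 'd list \<Rightarrow> (real^'d \<Rightarrow> real) \<Rightarrow> real^'d \<Rightarrow> real" where
  "closure_partial D \<beta> g z = Lim (at z within D) (iter_partial \<beta> g)"

text \<open>The class $C^{k+\alpha}(\overline D)$, for open $D$. Continuity of
  \<^term>\<open>closure_partial D \<beta> g\<close> on the closure forces the limits at boundary points to exist.\<close>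

definition C_k_alpha_closure ::
    "nat \<Rightarrow> real \<Rightarrow> (real^'d::finite) set \<Rightarrow> (real^'d \<Rightarrow> real) \<Rightarrow> bool" where
  "C_k_alpha_closure k \<alpha> D g \<longleftrightarrow> C_k_on k D g \<and> continuous_on (closure D) g \<and>
     (\<forall>\<beta>. length \<beta> \<le> k \<longrightarrow> continuous_on (closure D) (closure_partial D \<beta> g) \<and>
                         bounded (closure_partial D \<beta> g ` closure D)) \<and>
     (\<forall>\<beta>. length \<beta> = k \<longrightarrow> hoelder_on \<alpha> (closure D) (closure_partial D \<beta> g))"

text \<open>A bounded domain of class $C^{k,\alpha}$ in the sense of Gilbarg--Trudinger: the boundary is
  locally straightened by $C^{k,\alpha}$ diffeomorphisms. The index type has no distinguished last
  coordinate, so the half space is allowed to be $\{y_j > 0\}$ for any $j$; the image of the ball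
  is open by invariance of domain.\<close>

definition C_k_alpha_bounded_domain :: "nat \<Rightarrow> real \<Rightarrow> (real^'d::finite) set \<Rightarrow> bool" where
  "C_k_alpha_bounded_domain k \<alpha> D \<longleftrightarrow>
     open D \<and> connected D \<and> D \<noteq> {} \<and> bounded D \<and>
     (\<forall>z\<in>frontier D. \<exists>r>0. \<exists>\<Psi> :: real^'d \<Rightarrow> real^'d. \<exists>j.
        inj_on \<Psi> (ball z r) \<and>
        \<Psi> ` (ball z r \<inter> D) \<subseteq> {y. y $ j > 0} \<and>
        \<Psi> ` (ball z r \<inter> frontier D) \<subseteq> {y. y $ j = 0} \<and>
        (\<forall>i. C_k_alpha_on k \<alpha> (ball z r) (\<lambda>y. \<Psi> y $ i)) \<and>
        (\<forall>i. C_k_alpha_on k \<alpha> (\<Psi> ` ball z r) (\<lambda>y. inv_into (ball z r) \<Psi> y $ i)))"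

definition pos_def_matrix :: "real^'d^'d::finite \<Rightarrow> bool" where
  "pos_def_matrix A \<longleftrightarrow> transpose A = A \<and> (\<forall>v. v \<noteq> 0 \<longrightarrow> 0 < v \<bullet> (A *v v))"

text \<open>The generator $Gg = \sum_i \mu_i \partial_i g + \frac12 \sum_{i,j} A_{ij} \partial_{ij} g$ on
  the closure of \<^term>\<open>D\<close>.\<close>

definition generator_on_closure ::
    "real^'d \<Rightarrow> real^'d^'d \<Rightarrow> (real^'d::finite) set \<Rightarrow> (real^'d \<Rightarrow> real) \<Rightarrow> real^'d \<Rightarrow> real" where
  "generator_on_closure \<mu> A D g z =
     (\<Sum>i\<in>UNIV. \<mu> $ i * closure_partial D [i] g z) +
     1 / 2 * (\<Sum>i\<in>UNIV. \<Sum>j\<in>UNIV. A $ i $ j * closure_partial D [i, j] g z)"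

definition supp_in :: "'a::topological_space set \<Rightarrow> ('a \<Rightarrow> real) \<Rightarrow> 'a set" where
  "supp_in D g = closure {z \<in> D. g z \<noteq> 0}"


section \<open>Processes\<close>

text \<open>Processes are functions \<^typ>\<open>real \<Rightarrow> 'a \<Rightarrow> 'b\<close> of which only times $\ge 0$ matter. Path
  regularity is required for every \<^term>\<open>\<omega> \<in> space M\<close>, so that path functionals such as exit
  times are measurable although \<^term>\<open>M\<close> need not be complete.\<close>

definition indep_increments :: "'a measure \<Rightarrow> (real \<Rightarrow> 'a \<Rightarrow> 'b::euclidean_space) \<Rightarrow> bool" where
  "indep_increments M X \<longleftrightarrow>
     (\<forall>n \<tau>. 0 \<le> \<tau> 0 \<and> (\<forall>i<n. \<tau> i \<le> \<tau> (Suc i)) \<longrightarrow>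
        prob_space.indep_vars M (\<lambda>_. borel) (\<lambda>i \<omega>. X (\<tau> (Suc i)) \<omega> - X (\<tau> i) \<omega>) {..<n})"

definition standard_brownian_motion :: "'a measure \<Rightarrow> (real \<Rightarrow> 'a \<Rightarrow> real^'d::finite) \<Rightarrow> bool" where
  "standard_brownian_motion M W \<longleftrightarrow>
     prob_space M \<and>
     (\<forall>s\<ge>0. W s \<in> borel_measurable M) \<and>
     (\<forall>\<omega>\<in>space M. W 0 \<omega> = 0 \<and> continuous_on {0..} (\<lambda>s. W s \<omega>)) \<and>
     indep_increments M W \<and>
     (\<forall>r s. 0 \<le> r \<and> r < s \<longrightarrow>
        distributed M lborel (\<lambda>\<omega>. W s \<omega> - W r \<omega>)
          (\<lambda>y. ennreal (\<Prod>i\<in>UNIV. normal_density 0 (sqrt (s - r)) (y $ i))))"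

definition levy_exponent :: "real \<Rightarrow> real measure \<Rightarrow> real \<Rightarrow> real" where
  "levy_exponent b \<nu> l = b * l + (LINT s:{0<..}|\<nu>. 1 - exp (- l * s))"

text \<open>A subordinator with drift \<^term>\<open>b\<close> and Levy measure \<^term>\<open>\<nu>\<close>; of \<^term>\<open>\<nu>\<close> only the
  restriction to $(0,\infty)$ matters. Left limits exist by monotonicity.\<close>

definition subordinator :: "'a measure \<Rightarrow> (real \<Rightarrow> 'a \<Rightarrow> real) \<Rightarrow> real \<Rightarrow> real measure \<Rightarrow> bool" where
  "subordinator M S b \<nu> \<longleftrightarrow>
     prob_space M \<and>
     (\<forall>s\<ge>0. S s \<in> borel_measurable M) \<and>
     (\<forall>\<omega>\<in>space M. S 0 \<omega> = 0 \<and> mono_on {0..} (\<lambda>s. S s \<omega>) \<and>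
        (\<forall>s\<ge>0. continuous (at_right s) (\<lambda>r. S r \<omega>))) \<and>
     indep_increments M S \<and>
     (\<forall>r s. 0 \<le> r \<and> r \<le> s \<longrightarrow>
        distr M borel (\<lambda>\<omega>. S s \<omega> - S r \<omega>) = distr M borel (S (s - r))) \<and>
     0 \<le> b \<and> sets \<nu> = sets borel \<and> (\<integral>\<^sup>+s\<in>{0<..}. ennreal (min 1 s) \<partial>\<nu>) < \<infinity> \<and>
     (\<forall>s\<ge>0. \<forall>l\<ge>0. prob_space.expectation M (\<lambda>\<omega>. exp (- l * S s \<omega>)) =
        exp (- s * levy_exponent b \<nu> l))"

text \<open>Independence of the sigma-algebras generated by the two processes; \<^const>\<open>prob_space.indep_var\<close>
  would need both of them to have the same value type.\<close>

definition process_sets :: "'a measure \<Rightarrow> (real \<Rightarrow> 'a \<Rightarrow> 'b::topological_space) \<Rightarrow> 'a set set" where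
  "process_sets M X =
     sets (vimage_algebra (space M) (\<lambda>\<omega>. \<lambda>s\<in>{0..}. X s \<omega>) (\<Pi>\<^sub>M s\<in>{0..}. borel))"

definition indep_processes ::
    "'a measure \<Rightarrow> (real \<Rightarrow> 'a \<Rightarrow> 'b::topological_space) \<Rightarrow> (real \<Rightarrow> 'a \<Rightarrow> 'c::topological_space) \<Rightarrow> bool" where
  "indep_processes M X Y \<longleftrightarrow> prob_space.indep_set M (process_sets M X) (process_sets M Y)"

text \<open>From here on everything is pathwise: \<^term>\<open>w\<close> and \<^term>\<open>\<xi>\<close> stand for paths of the Brownian
  motion and of the subordinator. Hitting times are extended reals, so that the infimum of the
  empty set is $\infty$.\<close>

definition inverse_time :: "(real \<Rightarrow> real) \<Rightarrow> real \<Rightarrow> ereal" where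
  "inverse_time \<xi> t = Inf {ereal s | s. 0 < s \<and> t < \<xi> s}"

definition diffusion ::
    "real^'d \<Rightarrow> real^'d^'d \<Rightarrow> real^'d \<Rightarrow> (real \<Rightarrow> real^'d) \<Rightarrow> real \<Rightarrow> real^'d::finite" where
  "diffusion \<mu> \<sigma> x w s = x + s *\<^sub>R \<mu> + \<sigma> *v w s"

definition exit_time :: "'b set \<Rightarrow> (real \<Rightarrow> 'b) \<Rightarrow> ereal" where
  "exit_time D X = Inf {ereal s | s. 0 < s \<and> X s \<notin> D}"

text \<open>The random variable $Z = f(X_{L_t}) 1_{\{L_t < T_D\}}$. On $\{L_t = \infty\}$ (a null event)
  it is $0$, since then $L_t < T_D$ fails.\<close>

definition killed_value ::
    "real^'d \<Rightarrow> real^'d^'d \<Rightarrow> (real^'d::finite) set \<Rightarrow> (real^'d \<Rightarrow> real) \<Rightarrow> real \<Rightarrow> real^'d \<Rightarrow>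
     (real \<Rightarrow> real^'d) \<Rightarrow> (real \<Rightarrow> real) \<Rightarrow> real" where
  "killed_value \<mu> \<sigma> D f t x w \<xi> =
     (let L = inverse_time \<xi> t; X = diffusion \<mu> \<sigma> x w
      in if L < exit_time D X then f (X (real_of_ereal L)) else 0)"


section \<open>The discretely killed Euler scheme\<close>

text \<open>The grid $0, h, 2h, \dots, \lfloor q/h\rfloor h, q$; its last index is
  $\lfloor q/h\rfloor + 1$, and the last two points coincide if $q$ is a multiple of $h$.\<close>

definition grid_point :: "real \<Rightarrow> real \<Rightarrow> nat \<Rightarrow> real" where
  "grid_point h q i = (if i \<le> nat \<lfloor>q / h\<rfloor> then real i * h else q)"

primrec euler_grid ::
    "real^'d \<Rightarrow> real^'d^'d \<Rightarrow> real^'d \<Rightarrow> real \<Rightarrow> real \<Rightarrow> (real \<Rightarrow> real^'d) \<Rightarrow> nat \<Rightarrow> real^'d::finite" where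
  "euler_grid \<mu> \<sigma> x h q w 0 = x"
| "euler_grid \<mu> \<sigma> x h q w (Suc i) =
     euler_grid \<mu> \<sigma> x h q w i
       + (grid_point h q (Suc i) - grid_point h q i) *\<^sub>R \<mu>
       + \<sigma> *v (w (grid_point h q (Suc i)) - w (grid_point h q i))"

text \<open>Interpolation of the scheme at times $0 \le s \le q$; the left neighbour of $s$ in the grid
  has index $\lfloor s/h\rfloor$.\<close>

definition euler_scheme ::
    "real^'d \<Rightarrow> real^'d^'d \<Rightarrow> real^'d \<Rightarrow> real \<Rightarrow> real \<Rightarrow> (real \<Rightarrow> real^'d) \<Rightarrow> real \<Rightarrow> real^'d::finite" where
  "euler_scheme \<mu> \<sigma> x h q w s =
     (let i = nat \<lfloor>s / h\<rfloor>
      in euler_grid \<mu> \<sigma> x h q w i + (s - grid_point h q i) *\<^sub>R \<mu> + \<sigma> *v (w s - w (grid_point h q i)))"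

definition discrete_exit_time :: "real \<Rightarrow> real \<Rightarrow> 'b set \<Rightarrow> (real \<Rightarrow> 'b) \<Rightarrow> ereal" where
  "discrete_exit_time h q D Y =
     Inf {ereal s | s. s \<in> grid_point h q ` {1..Suc (nat \<lfloor>q / h\<rfloor>)} \<and> Y s \<notin> D}"

text \<open>The random variable $Z_h$, with the horizon $q = L_t$ taken pathwise. As above, it is $0$ on
  $\{L_t = \infty\}$, whatever the value of \<^term>\<open>real_of_ereal \<infinity>\<close>.\<close>

definition euler_killed_value ::
    "real^'d \<Rightarrow> real^'d^'d \<Rightarrow> (real^'d::finite) set \<Rightarrow> (real^'d \<Rightarrow> real) \<Rightarrow> real \<Rightarrow> real^'d \<Rightarrow> real \<Rightarrow>
     (real \<Rightarrow> real^'d) \<Rightarrow> (real \<Rightarrow> real) \<Rightarrow> real" where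
  "euler_killed_value \<mu> \<sigma> D f t x h w \<xi> =
     (let L = inverse_time \<xi> t; q = real_of_ereal L; Y = euler_scheme \<mu> \<sigma> x h q w
      in if L < discrete_exit_time h q D Y then f (Y q) else 0)"

text \<open>The copies may live on a probability space \<^term>\<open>P\<close> other than the space \<^term>\<open>M\<close> of the
  original random variable.\<close>

definition iid_copies ::
    "'b measure \<Rightarrow> (nat \<Rightarrow> 'b \<Rightarrow> real) \<Rightarrow> nat set \<Rightarrow> 'a measure \<Rightarrow> ('a \<Rightarrow> real) \<Rightarrow> bool" where
  "iid_copies P V I M Z \<longleftrightarrow>
     prob_space.indep_vars P (\<lambda>_. borel) V I \<and> (\<forall>k\<in>I. distr P borel (V k) = distr M borel Z)"

definition monte_carlo_mean :: "(nat \<Rightarrow> 'b \<Rightarrow> real) \<Rightarrow> nat \<Rightarrow> 'b \<Rightarrow> real" where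
  "monte_carlo_mean V N \<omega> = 1 / real N * (\<Sum>k=1..N. V k \<omega>)"

end

theory Submission
  imports Defs
begin

text \<open>The Euler scheme is exact on its grid, so $Z_h - Z$ is $f(X_{L_t})$ on the event that the path
  leaves $D$ before $L_t$ although all grid points lie in $D$. In both cases of the hypothesis
  $|f| \le A\,\mathrm{dist}(\cdot, D^c)$ on $D$. Exterior balls of a fixed radius $R$ give a strict
  supersolution $\Phi = \inf_c (e^{-\lambda R^2} - e^{-\lambda |\cdot - c|^2})$ of the generator that is
  comparable to the distance to $D^c$, and $1_D (\Phi + h^\gamma)$ with $\gamma < 1/2$ decreases in mean
  along a step of the grid: the drift of $\Phi$ absorbs the overshoots exceeding $h^\gamma$. A path that
  comes close to $\partial D$ is at distance of order $\sqrt h$ from $D^c$ at the next grid time, hence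
  the bias is $O(h^\gamma)$ uniformly in the horizon, and the horizon $L_t$ can be frozen by
  independence. As $\delta < -1$, the bias for $h = N^\delta$ is $o(N^{-1/2})$ for $\gamma$ close to
  $1/2$, and the central limit theorem for triangular arrays with bounded entries applies.\<close>

section \<open>The central limit theorem for bounded triangular arrays\<close>

text \<open>The drift of \<Phi> alone does not make the killed walk decrease in mean: outside D the
  barrier is negative, so replacing it by 0 there raises the mean by the expected negative part,
  which is of order sqrt h close to the boundary, while the drift yields only order h. The jump
  h^\<gamma> at the boundary pays for this, up to overshoots beyond h^\<gamma>; their mean excess is
  bounded by a moment of order 2k, and (sqrt h)^(2k) / h^(\<gamma>(2k-1)) is below order h for large
  k exactly because \<gamma> < 1/2. An infimum over balls replaces the distance function since E inf
  <= inf E preserves the drift and no smoothness of the distance is involved. Closeness to the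
  boundary is monitored on deterministic grids of mesh h/m only, so that independent increments
  replace the strong Markov property; m tends to infinity by Fatou's lemma. The error is estimated
  in L1, which for bounded payoffs controls mean and variance at once.\<close>

lemma tendsto_const_over_sqrt: "(\<lambda>n. C / sqrt (real n)) \<longlonglongrightarrow> 0"
  by (auto intro!: tendsto_divide_0 filterlim_at_top_imp_at_infinity sqrt_at_top[THEN filterlim_compose]
        filterlim_real_sequentially)

text \<open>The law of the entries changes with n, so the classical theorem for a single sequence is
  not enough. The bias becomes a deterministic shift \<open>a n\<close>, hence a factor of the
  characteristic function that tends to 1; the centred rest is an n-th power. Entries bounded by B
  make the third order Taylor error of its base uniform in n, so n such errors add up to order 1 /
  sqrt n, and Levy's continuity theorem concludes.\<close>

theorem (in prob_space) clt_bounded_triangular_array: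
  fixes V :: "nat \<Rightarrow> nat \<Rightarrow> 'a \<Rightarrow> real" and Q :: "nat \<Rightarrow> real measure"
  assumes indep: "\<And>n. n \<ge> 1 \<Longrightarrow> indep_vars (\<lambda>_. borel) (V n) {1..n}"
    and law: "\<And>n k. n \<ge> 1 \<Longrightarrow> k \<in> {1..n} \<Longrightarrow> distr M borel (V n k) = Q n"
    and Q: "\<And>n. real_distribution (Q n)"
    and bnd: "\<And>n. AE x in Q n. \<bar>x\<bar> \<le> B"
    and sd: "sd > 0"
    and var: "(\<lambda>n. integral\<^sup>L (Q n) (\<lambda>x. (x - integral\<^sup>L (Q n) (\<lambda>x. x))\<^sup>2)) \<longlonglongrightarrow> sd\<^sup>2"
    and bias: "(\<lambda>n. sqrt (real n) * (integral\<^sup>L (Q n) (\<lambda>x. x) - u)) \<longlonglongrightarrow> 0"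
  shows "weak_conv_m
    (\<lambda>n. distr M borel (\<lambda>\<omega>. sqrt (real n) * (1 / real n * (\<Sum>k=1..n. V n k \<omega>) - u) / sd))
    std_normal_distribution"
proof -
  define m where "m n = integral\<^sup>L (Q n) (\<lambda>x. x)" for n
  define v where "v n = integral\<^sup>L (Q n) (\<lambda>x. (x - m n)\<^sup>2)" for n
  define a where "a n = sqrt (real n) * (m n - u) / sd" for n
  define X where "X n k \<omega> = (V n k \<omega> - m n) / (sd * sqrt n)" for n k \<omega>
  let ?T = "\<lambda>n \<omega>. sqrt (real n) * (1 / real n * (\<Sum>k=1..n. V n k \<omega>) - u) / sd"
  have Vm[measurable]: "V n k \<in> borel_measurable M" if "k \<in> {1..n}" for n k
    using indep[of n] that by (auto simp: indep_vars_def2)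
  have Tm[measurable]: "?T n \<in> borel_measurable M" for n
    by measurable
  have Teq: "?T n \<omega> = a n + (\<Sum>k=1..n. X n k \<omega>)" if "n \<ge> 1" for n \<omega>
  proof -
    have sq: "sqrt (real n) * sqrt (real n) = real n" by simp
    have "(\<Sum>k=1..n. X n k \<omega>) = ((\<Sum>k=1..n. V n k \<omega>) - real n * m n) / (sd * sqrt n)"
      by (simp add: X_def sum_divide_distrib[symmetric] sum_subtractf)
    also have "\<dots> = sqrt (real n) * ((\<Sum>k=1..n. V n k \<omega>) / n - m n) / sd"
      using that sd sq by (simp add: field_simps)
    finally show ?thesis
      by (simp add: a_def diff_divide_distrib[symmetric] add_divide_distrib[symmetric] algebra_simps)
  qed
  define R where "R n = distr (Q n) borel (\<lambda>x. x - m n)" for n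
  have Rr: "real_distribution (R n)" for n
  proof -
    interpret Q: real_distribution "Q n" by (rule Q)
    show ?thesis unfolding R_def by (rule Q.real_distribution_distr) simp
  qed
  have mB: "\<bar>m n\<bar> \<le> B" for n
  proof -
    interpret Q: real_distribution "Q n" by (rule Q)
    have "\<bar>m n\<bar> \<le> integral\<^sup>L (Q n) (\<lambda>x. \<bar>x\<bar>)" unfolding m_def by (rule integral_abs_bound)
    also have "\<dots> \<le> integral\<^sup>L (Q n) (\<lambda>x. B)"
    proof (rule integral_mono_AE)
      show "integrable (Q n) (\<lambda>x. \<bar>x\<bar>)"
        by (rule Q.integrable_const_bound[of _ B]) (use bnd[of n] in auto)
    qed (use bnd[of n] in auto)
    also have "\<dots> = B" using Q.prob_space by simp
    finally show ?thesis .
  qed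
  have B0: "B \<ge> 0" using mB[of 0] by linarith
  have charR: "norm (char (R n) t - (1 - t\<^sup>2 * v n / 2)) \<le> \<bar>t\<bar>^3 / 6 * (2*B)^3" for n t
  proof -
    interpret Q: real_distribution "Q n" by (rule Q)
    let ?X = "\<lambda>x. x - m n"
    have ae: "AE x in Q n. \<bar>?X x\<bar> \<le> 2*B"
      using bnd[of n] by eventually_elim (use mB[of n] in auto)
    have rv: "?X \<in> borel_measurable (Q n)" by simp
    have int0: "integrable (Q n) (\<lambda>x. x)"
      by (rule Q.integrable_const_bound[of _ B]) (use bnd[of n] in auto)
    have int1: "integrable (Q n) ?X"
      by (rule Q.integrable_const_bound[OF _ rv, of "2*B"]) (use ae in simp)
    have e1: "Q.expectation ?X = 0"
      using Q.prob_space by (simp add: int0 m_def)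
    have ae2: "AE x in Q n. norm ((?X x)\<^sup>2) \<le> (2*B)\<^sup>2"
      using ae by eventually_elim (simp only: real_norm_def abs_power2, metis abs_le_square_iff abs_of_nonneg B0 zero_le_mult_iff zero_le_numeral)
    have int2: "integrable (Q n) (\<lambda>x. (?X x)\<^sup>2)"
      by (rule Q.integrable_const_bound[OF ae2]) simp
    have v: "Q.variance ?X = v n"
      unfolding e1 by (simp add: v_def)
    have aeR: "AE x in Q n. \<bar>?X x\<bar>^3 \<le> (2*B)^3"
      using ae by eventually_elim (rule power_mono, auto)
    have *: "norm (char (R n) t - (1 - t\<^sup>2 * v n / 2)) \<le> (t^2 / 6) * Q.expectation (\<lambda>x. min (6 * (?X x)\<^sup>2) (\<bar>t\<bar> * \<bar>?X x\<bar>^3))"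
      by (rule Q.char_approx3'[OF rv int1 int2 e1 v R_def])
    \<comment> \<open>The minimum in the Taylor bound is replaced by its cubic branch, as |x - m n|
      <= 2 B almost everywhere.\<close>
    have "Q.expectation (\<lambda>x. min (6 * (?X x)\<^sup>2) (\<bar>t\<bar> * \<bar>?X x\<bar>^3)) \<le> Q.expectation (\<lambda>x. \<bar>t\<bar> * (2*B)^3)"
    proof (rule integral_mono_AE)
      show "integrable (Q n) (\<lambda>x. min (6 * (?X x)\<^sup>2) (\<bar>t\<bar> * \<bar>?X x\<bar>^3))"
        by (rule Bochner_Integration.integrable_bound[OF integrable_mult_right[OF int2, of 6]]) auto
      show "AE x in Q n. min (6 * (?X x)\<^sup>2) (\<bar>t\<bar> * \<bar>?X x\<bar> ^ 3) \<le> \<bar>t\<bar> * (2 * B) ^ 3"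
        using aeR by eventually_elim (meson abs_ge_zero min.coboundedI2 mult_left_mono)
    qed simp
    also have "\<dots> = \<bar>t\<bar> * (2*B)^3" using Q.prob_space by simp
    finally have "(t^2 / 6) * Q.expectation (\<lambda>x. min (6 * (?X x)\<^sup>2) (\<bar>t\<bar> * \<bar>?X x\<bar>^3))
        \<le> (t^2 / 6) * (\<bar>t\<bar> * (2*B)^3)"
      by (rule mult_left_mono) simp
    also have "\<dots> = \<bar>t\<bar>^3 / 6 * (2*B)^3"
      by (simp add: power3_eq_cube power2_eq_square abs_mult_self_eq)
    finally show ?thesis using * by linarith
  qed
  have char_sum: "char (distr M borel (\<lambda>\<omega>. \<Sum>k=1..n. X n k \<omega>)) t = char (R n) (t / (sd * sqrt n)) ^ n"
    if n: "n \<ge> 1" for n t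
  proof -
    have "indep_vars (\<lambda>_. borel) (X n) {1..n}"
      unfolding X_def[abs_def] by (rule indep_vars_compose2[OF indep[OF n]]) auto
    then have "char (distr M borel (\<lambda>\<omega>. \<Sum>k=1..n. X n k \<omega>)) t =
        (\<Prod>k=1..n. char (distr M borel (X n k)) t)"
      by (rule char_distr_sum)
    also have "\<dots> = (\<Prod>k=1..n. char (R n) (t / (sd * sqrt n)))"
    proof (rule prod.cong)
      fix k assume k: "k \<in> {1..n}"
      have "distr M borel (X n k) = distr (distr M borel (V n k)) borel (\<lambda>x. (x - m n) / (sd * sqrt n))"
        using Vm[OF k] by (subst distr_distr) (auto simp: X_def[abs_def] comp_def)
      also have "\<dots> = distr (R n) borel (\<lambda>x. x / (sd * sqrt n))"
        using Q[of n] unfolding law[OF n k] R_def by (subst distr_distr) (auto simp: comp_def real_distribution_def real_distribution_axioms_def)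
      finally show "char (distr M borel (X n k)) t = char (R n) (t / (sd * sqrt n))"
        unfolding char_def by (simp add: integral_distr R_def)
    qed simp
    finally show ?thesis by simp
  qed
  have charT: "char (distr M borel (?T n)) t = iexp (t * a n) * char (R n) (t / (sd * sqrt n)) ^ n"
    if n: "n \<ge> 1" for n t
  proof -
    have [measurable]: "(\<lambda>\<omega>. \<Sum>k=1..n. X n k \<omega>) \<in> borel_measurable M"
      unfolding X_def by measurable
    define Y where "Y \<omega> = (\<Sum>k=1..n. X n k \<omega>)" for \<omega>
    have [measurable]: "Y \<in> borel_measurable M"
      unfolding Y_def[abs_def] by fact
    have T: "?T n = (\<lambda>\<omega>. a n + Y \<omega>)"
      unfolding Y_def by (rule ext) (rule Teq[OF n])
    have "char (distr M borel (?T n)) t = (CLINT \<omega>|M. iexp (t * (a n + Y \<omega>)))"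
      unfolding char_def T by (subst integral_distr) auto
    also have "\<dots> = (CLINT \<omega>|M. iexp (t * a n) * iexp (t * Y \<omega>))"
      by (simp add: algebra_simps exp_add)
    also have "\<dots> = iexp (t * a n) * char (distr M borel Y) t"
      unfolding char_def by (subst integral_distr) auto
    also have "Y = (\<lambda>\<omega>. \<Sum>k=1..n. X n k \<omega>)" by (rule ext) (rule Y_def)
    finally show ?thesis using char_sum[OF n] by simp
  qed
  have a0: "a \<longlonglongrightarrow> 0"
    using tendsto_divide[OF bias tendsto_const, of sd] sd by (simp add: a_def[abs_def] m_def)
  have v0: "v \<longlonglongrightarrow> sd\<^sup>2" using var by (simp add: v_def[abs_def] m_def)
  show ?thesis
  proof (rule levy_continuity)
    show "real_distribution (distr M borel (?T n))" for n
      by (rule real_distribution_distr) simp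
    show "real_distribution std_normal_distribution" by (rule real_dist_normal_dist)
    fix t :: real
    let ?c = "\<lambda>n. char (R n) (t / (sd * sqrt n))"
    \<comment> \<open>The first summand measures the mismatch between the variance of row n and that
      of the limit, the second is n times the cubic Taylor error.\<close>
    let ?e = "\<lambda>n. t\<^sup>2 / 2 * \<bar>1 - v n / sd\<^sup>2\<bar> + (\<bar>t\<bar>^3 / (6 * sd^3) * (2*B)^3) / sqrt (real n)"
    \<comment> \<open>The threshold t^2 / 4 puts 1 - t^2 / (2n) into [-1, 1], as
      \<open>norm_power_diff\<close> asks of both bases.\<close>
    have main: "norm (?c n ^ n - (1 + (-(t^2) / 2) / n)^n) \<le> ?e n" if "n \<ge> max 1 (nat \<lceil>t^2 / 4\<rceil>)" for n
    proof -
      from that have n1: "n \<ge> 1" and n2: "real n \<ge> t^2 / 4" by auto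
      interpret R: real_distribution "R n" by (rule Rr)
      let ?t = "t / (sd * sqrt n)"
      have *: "norm (?c n ^ n - (complex_of_real (1 + (-(t^2) / 2) / n))^n) \<le>
           n * norm (?c n - (complex_of_real (1 + (-(t^2) / 2) / n)))"
        using n1 n2
        by (intro norm_power_diff R.cmod_char_le_1)
          (auto intro!: abs_leI simp del: of_real_diff simp: of_real_diff[symmetric] divide_le_eq)
      have "norm (?c n - (complex_of_real (1 + (-(t^2) / 2) / n)))
          \<le> norm (?c n - (1 - ?t\<^sup>2 * v n / 2)) + norm ((1 - ?t\<^sup>2 * v n / 2) - complex_of_real (1 + (-(t^2) / 2) / n))"
        by norm
      also have "\<dots> \<le> \<bar>?t\<bar>^3 / 6 * (2*B)^3 + \<bar>(1 - ?t\<^sup>2 * v n / 2) - (1 + (-(t^2) / 2) / n)\<bar>"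
      proof (rule add_mono[OF charR])
        have "(1 - ?t\<^sup>2 * v n / 2) - complex_of_real (1 + (-(t^2) / 2) / n) =
          complex_of_real ((1 - ?t\<^sup>2 * v n / 2) - (1 + (-(t^2) / 2) / n))" by simp
        then show "norm ((1 - ?t\<^sup>2 * v n / 2) - complex_of_real (1 + (-(t^2) / 2) / n)) \<le>
           \<bar>(1 - ?t\<^sup>2 * v n / 2) - (1 + (-(t^2) / 2) / n)\<bar>"
          by (simp only: norm_of_real)
      qed
      also have "(1 - ?t\<^sup>2 * v n / 2) - (1 + (-(t^2) / 2) / n) = (t\<^sup>2 / 2 * (1 - v n / sd\<^sup>2)) / n"
        using n1 sd by (simp add: field_simps power2_eq_square)
      also have "\<bar>?t\<bar>^3 = (\<bar>t\<bar>^3 / sd^3 / sqrt n) / n"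
      proof -
        have "sqrt (real n) ^ 3 = sqrt n * n" by (simp add: power3_eq_cube)
        then show ?thesis using sd by (simp add: abs_mult power_divide power_mult_distrib)
      qed
      finally have "n * norm (?c n - (complex_of_real (1 + (-(t^2) / 2) / n)))
          \<le> n * ((\<bar>t\<bar>^3 / sd^3 / sqrt n) / n / 6 * (2*B)^3 + \<bar>(t\<^sup>2 / 2 * (1 - v n / sd\<^sup>2)) / n\<bar>)"
        by (rule mult_left_mono) simp
      also have "\<dots> = ?e n" using n1 by (simp add: abs_mult distrib_left)
      finally show ?thesis using * by simp
    qed
    have e0: "?e \<longlonglongrightarrow> 0"
    proof -
      have "(\<lambda>n. t\<^sup>2 / 2 * \<bar>1 - v n / sd\<^sup>2\<bar>) \<longlonglongrightarrow> t\<^sup>2 / 2 * \<bar>1 - sd\<^sup>2 / sd\<^sup>2\<bar>"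
        using sd by (intro tendsto_intros v0) auto
      then have "(\<lambda>n. t\<^sup>2 / 2 * \<bar>1 - v n / sd\<^sup>2\<bar>) \<longlonglongrightarrow> 0" using sd by simp
      from tendsto_add[OF this tendsto_const_over_sqrt[of "\<bar>t\<bar>^3 / (6 * sd^3) * (2*B)^3"]]
      show ?thesis by (simp only: add_0_left)
    qed
    have "(\<lambda>n. complex_of_real ((1 + (-(t^2) / 2) / n)^n)) \<longlonglongrightarrow> complex_of_real (exp (-(t^2) / 2))"
      by (rule isCont_tendsto_compose [OF _ tendsto_exp_limit_sequentially]) auto
    then have "(\<lambda>n. ?c n ^ n) \<longlonglongrightarrow> complex_of_real (exp (-(t^2) / 2))"
    proof (rule Lim_transform)
      show "(\<lambda>n. ?c n ^ n - complex_of_real ((1 + (-(t^2) / 2) / n)^n)) \<longlonglongrightarrow> 0"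
        by (rule Lim_null_comparison[OF _ e0])
          (use main in \<open>auto simp: eventually_sequentially intro!: exI[of _ "max 1 (nat \<lceil>t^2 / 4\<rceil>)"]\<close>)
    qed
    moreover have "(\<lambda>n. iexp (t * a n)) \<longlonglongrightarrow> iexp (t * 0)"
      by (intro tendsto_intros a0)
    ultimately have "(\<lambda>n. iexp (t * a n) * ?c n ^ n) \<longlonglongrightarrow> 1 * complex_of_real (exp (-(t^2) / 2))"
      by (intro tendsto_mult) auto
    then show "(\<lambda>n. char (distr M borel (?T n)) t) \<longlonglongrightarrow> char std_normal_distribution t"
      unfolding char_std_normal_distribution mult_1
      by (rule Lim_transform_eventually)
         (use charT in \<open>auto simp: eventually_sequentially intro!: exI[of _ 1]\<close>)
  qed
qed

section \<open>Gaussian increments\<close>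

text \<open>The law N(0, s I) of a Brownian increment over time s > 0, with the density from
  \<open>standard_brownian_motion\<close>. At s = 0 it is not a point mass, so steps of length zero
  are treated apart.\<close>

definition gauss_measure :: "real \<Rightarrow> (real^'d::finite) measure" where
  "gauss_measure s = density lborel (\<lambda>y. ennreal (\<Prod>i\<in>UNIV. normal_density 0 (sqrt s) (y $ i)))"

lemma sets_gauss_measure [simp, measurable_cong]: "sets (gauss_measure s) = sets borel"
  by (simp add: gauss_measure_def)

lemma space_gauss_measure [simp]: "space (gauss_measure s) = UNIV"
  by (simp add: gauss_measure_def)

lemma Basis_vec_eq_range_axis: "(Basis :: (real^'d::finite) set) = range (\<lambda>i. axis i 1)"
  by (auto simp: Basis_vec_def)

lemma prod_Basis_vec: "(\<Prod>b\<in>(Basis :: (real^'d::finite) set). g b) = (\<Prod>i\<in>UNIV. g (axis i 1))"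
  unfolding Basis_vec_eq_range_axis
  by (subst prod.reindex) (auto simp: inj_on_def axis_eq_axis)

text \<open>Fubini in coordinates. \<open>lborel\<close> is the image of a product indexed by
  \<open>Basis\<close>, whose elements are the axis vectors; \<open>?ix\<close> recovers the index
  of an axis vector.\<close>

lemma lborel_prod_vec:
  fixes f :: "'d::finite \<Rightarrow> real \<Rightarrow> real"
  assumes int: "\<And>i. integrable lborel (f i)"
  shows "has_bochner_integral lborel (\<lambda>y::real^'d. \<Prod>i\<in>UNIV. f i (y $ i)) (\<Prod>i\<in>UNIV. integral\<^sup>L lborel (f i))"
proof -
  let ?ix = "\<lambda>b::real^'d. THE i. b = axis i 1"
  have ix: "?ix (axis i 1) = i" for i
    by (rule the_equality) (auto simp: axis_eq_axis)
  define F where "F b = f (?ix b)" for b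
  interpret product_sigma_finite "\<lambda>_::real^'d. lborel :: real measure" ..
  have Fint: "integrable lborel (F b)" for b unfolding F_def by (rule int)
  have fm[measurable]: "f i \<in> borel_measurable borel" for i using int[of i] by auto
  have eq: "(\<Prod>i\<in>UNIV. f i (y $ i)) = (\<Prod>b\<in>Basis. F b (y \<bullet> b))" for y :: "real^'d"
    unfolding prod_Basis_vec F_def ix by (simp add: inner_axis)
  have m: "(\<lambda>f. \<Sum>b\<in>(Basis::(real^'d) set). f b *\<^sub>R b) \<in> borel_measurable (\<Pi>\<^sub>M b\<in>Basis. lborel)"
    by measurable
  have b: "(\<Sum>b\<in>Basis. g b *\<^sub>R b) \<bullet> c = g c" if "c \<in> Basis" for g and c :: "real^'d"
    using that by (simp add: inner_sum_left inner_Basis if_distrib cong: if_cong)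
  have eqb: "(\<Prod>i\<in>UNIV. f i ((\<Sum>b\<in>Basis. g b *\<^sub>R b :: real^'d) $ i)) = (\<Prod>b\<in>Basis. F b (g b))" for g
    unfolding eq by (rule prod.cong) (simp_all only: b)
  have meas: "(\<lambda>y::real^'d. \<Prod>i\<in>UNIV. f i (y $ i)) \<in> borel_measurable borel"
    by measurable
  have I: "integrable (\<Pi>\<^sub>M b\<in>Basis. lborel) (\<lambda>g. \<Prod>b\<in>(Basis::(real^'d) set). F b (g b))"
    by (rule product_integrable_prod) (auto intro: Fint)
  have "integrable lborel (\<lambda>y::real^'d. \<Prod>i\<in>UNIV. f i (y $ i))"
    unfolding lborel_eq[where 'a="real^'d"] integrable_distr_eq[OF m meas]
    using I by (simp only: eqb)
  moreover have "integral\<^sup>L lborel (\<lambda>y::real^'d. \<Prod>i\<in>UNIV. f i (y $ i)) = (\<Prod>i\<in>UNIV. integral\<^sup>L lborel (f i))"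
  proof -
    have "integral\<^sup>L lborel (\<lambda>y::real^'d. \<Prod>i\<in>UNIV. f i (y $ i)) =
      integral\<^sup>L (\<Pi>\<^sub>M b\<in>Basis. lborel) (\<lambda>g. \<Prod>b\<in>(Basis::(real^'d) set). F b (g b))"
      unfolding lborel_eq[where 'a="real^'d"] integral_distr[OF m meas]
      by (simp only: eqb)
    also have "\<dots> = (\<Prod>b\<in>(Basis::(real^'d) set). integral\<^sup>L lborel (F b))"
      by (rule product_integral_prod) (auto intro: Fint)
    also have "\<dots> = (\<Prod>i\<in>UNIV. integral\<^sup>L lborel (f i))"
      unfolding prod_Basis_vec F_def ix ..
    finally show ?thesis .
  qed
  ultimately show ?thesis by (simp add: has_bochner_integral_iff)
qed

lemma gauss_measure_prod:
  fixes f :: "'d::finite \<Rightarrow> real \<Rightarrow> real"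
  assumes int: "\<And>i. has_bochner_integral lborel (\<lambda>t. normal_density 0 (sqrt s) t * f i t) (c i)"
    and [measurable]: "\<And>i. f i \<in> borel_measurable borel"
  shows "has_bochner_integral (gauss_measure s) (\<lambda>y::real^'d. \<Prod>i\<in>UNIV. f i (y $ i)) (\<Prod>i\<in>UNIV. c i)"
proof -
  have "has_bochner_integral lborel (\<lambda>y::real^'d. \<Prod>i\<in>UNIV. normal_density 0 (sqrt s) (y $ i) * f i (y $ i)) (\<Prod>i\<in>UNIV. c i)"
    using lborel_prod_vec[of "\<lambda>i t. normal_density 0 (sqrt s) t * f i t"] int
    by (simp add: has_bochner_integral_iff)
  then show ?thesis
    unfolding gauss_measure_def
    by (intro has_bochner_integral_density) (auto simp: prod.distrib prod_nonneg)
qed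

lemma prob_space_gauss_measure: "s > 0 \<Longrightarrow> prob_space (gauss_measure s :: (real^'d::finite) measure)"
proof
  assume s: "s > 0"
  have "has_bochner_integral lborel (\<lambda>t. normal_density 0 (sqrt s) t * 1) 1"
    using s by (simp add: has_bochner_integral_iff integral_normal_density integrable_normal_density)
  from gauss_measure_prod[OF this] have *: "has_bochner_integral (gauss_measure s) (\<lambda>y::real^'d. 1::real) 1" by simp
  have "emeasure (gauss_measure s :: (real^'d) measure) (space (gauss_measure s)) =
      (\<integral>\<^sup>+y. ennreal 1 \<partial>(gauss_measure s :: (real^'d) measure))" by simp
  also have "\<dots> = ennreal 1"
    using * by (subst nn_integral_eq_integral) (auto simp: has_bochner_integral_iff)
  finally show "emeasure (gauss_measure s :: (real^'d) measure) (space (gauss_measure s)) = 1" by simp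
qed

text \<open>All factors but the i-th integrate to 1. The value is (2k-1)!! s^k in the form that
  \<open>normal_moment_even\<close> delivers.\<close>

lemma gauss_measure_even_moment:
  assumes s: "s > 0"
  shows "has_bochner_integral (gauss_measure s) (\<lambda>y::real^'d::finite. (y $ i) ^ (2 * k)) (fact (2*k) / ((2/s)^k * fact k))"
proof -
  have 1: "has_bochner_integral lborel (\<lambda>t. normal_density 0 (sqrt s) t * 1) 1"
    using s by (simp add: has_bochner_integral_iff integral_normal_density integrable_normal_density)
  have 2: "has_bochner_integral lborel (\<lambda>t. normal_density 0 (sqrt s) t * t^(2*k)) (fact (2*k) / ((2/s)^k * fact k))"
    using normal_moment_even[of "sqrt s" 0 k] s by simp
  let ?f = "\<lambda>j t::real. if j = i then t^(2*k) else 1"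
  have "has_bochner_integral (gauss_measure s) (\<lambda>y::real^'d. \<Prod>j\<in>UNIV. ?f j (y $ j))
    (\<Prod>j\<in>UNIV. if j = i then (fact (2*k) / ((2/s)^k * fact k)) else 1)"
    by (rule gauss_measure_prod) (use 1 2 in \<open>auto simp del: mult_1_right\<close>)
  then show ?thesis
    by (simp add: prod.delta)
qed

lemma gauss_measure_mean:
  assumes s: "s > 0"
  shows "has_bochner_integral (gauss_measure s) (\<lambda>y::real^'d::finite. y $ i) 0"
proof -
  have 1: "has_bochner_integral lborel (\<lambda>t. normal_density 0 (sqrt s) t * 1) 1"
    using s by (simp add: has_bochner_integral_iff integral_normal_density integrable_normal_density)
  have 2: "has_bochner_integral lborel (\<lambda>t. normal_density 0 (sqrt s) t * t) 0"
    using normal_moment_nz_1[of "sqrt s" 0] s by simp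
  let ?f = "\<lambda>j t::real. if j = i then t else 1"
  have "has_bochner_integral (gauss_measure s) (\<lambda>y::real^'d. \<Prod>j\<in>UNIV. ?f j (y $ j))
    (\<Prod>j\<in>UNIV. if j = i then 0 else 1)"
    by (rule gauss_measure_prod) (use 1 2 in \<open>auto simp del: mult_1_right\<close>)
  then show ?thesis
    by (simp add: prod.delta)
qed

text \<open>Off the diagonal the factors of index i and j have mean 0, so the whole product
  vanishes.\<close>

lemma gauss_measure_cov:
  assumes s: "s > 0"
  shows "has_bochner_integral (gauss_measure s) (\<lambda>y::real^'d::finite. y $ i * y $ j) (if i = j then s else 0)"
proof (cases "i = j")
  case True
  then show ?thesis using gauss_measure_even_moment[OF s, of i 1] s by (simp add: power2_eq_square)
next
  case False
  have 1: "has_bochner_integral lborel (\<lambda>t. normal_density 0 (sqrt s) t * 1) 1"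
    using s by (simp add: has_bochner_integral_iff integral_normal_density integrable_normal_density)
  have 2: "has_bochner_integral lborel (\<lambda>t. normal_density 0 (sqrt s) t * t) 0"
    using normal_moment_nz_1[of "sqrt s" 0] s by simp
  let ?f = "\<lambda>k t::real. if k = i \<or> k = j then t else 1"
  have "has_bochner_integral (gauss_measure s) (\<lambda>y::real^'d. \<Prod>k\<in>UNIV. ?f k (y $ k))
    (\<Prod>k\<in>UNIV. if k = i \<or> k = j then 0 else 1)"
    by (rule gauss_measure_prod) (use 1 2 in \<open>auto simp del: mult_1_right\<close>)
  moreover have "(\<Prod>k\<in>UNIV. if k = i \<or> k = j then 0 else (1::real)) = 0"
    by (rule prod_zero) auto
  moreover have "(\<Prod>k\<in>UNIV. ?f k (y $ k)) = y $ i * y $ j" for y :: "real^'d"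
  proof -
    have "(\<Prod>k\<in>UNIV. ?f k (y $ k)) = (\<Prod>k\<in>UNIV. (if k = i then y $ k else 1) * (if k = j then y $ k else 1))"
      using False by (intro prod.cong) auto
    then show ?thesis by (simp add: prod.distrib prod.delta)
  qed
  ultimately show ?thesis using False by simp
qed

text \<open>Every summand is at most the largest one, whose n-th power is among the summands on the
  right. The constant is crude; only orders in s matter where this is used.\<close>

lemma power_sum_le_card_power:
  fixes a :: "'i \<Rightarrow> real"
  assumes "finite I" "\<And>i. i \<in> I \<Longrightarrow> 0 \<le> a i" "n > 0"
  shows "(\<Sum>i\<in>I. a i) ^ n \<le> real (card I) ^ n * (\<Sum>i\<in>I. a i ^ n)"
proof (cases "I = {}")
  case True
  then show ?thesis using assms(3) by (simp add: zero_power)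
next
  case False
  define m where "m = Max (a ` I)"
  have "m \<in> a ` I"
    unfolding m_def using False assms(1) by (intro Max_in) auto
  then obtain j where j: "j \<in> I" "m = a j" by blast
  have "a i \<le> m" if "i \<in> I" for i
    unfolding m_def using that assms(1) by auto
  then have "(\<Sum>i\<in>I. a i) \<le> real (card I) * m"
    by (rule sum_bounded_above)
  then have "(\<Sum>i\<in>I. a i) ^ n \<le> (real (card I) * m) ^ n"
    using assms by (intro power_mono sum_nonneg) auto
  also have "\<dots> = real (card I) ^ n * m ^ n" by (rule power_mult_distrib)
  also have "m ^ n \<le> (\<Sum>i\<in>I. a i ^ n)"
    using j assms by (auto intro!: member_le_sum zero_le_power)
  finally show ?thesis by (simp add: mult_left_mono)
qed

section \<open>Moments of a step of the diffusion\<close>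

definition increment :: "real^'d \<Rightarrow> real^'d^'d \<Rightarrow> real \<Rightarrow> real^'d \<Rightarrow> real^'d::finite" where
  "increment \<mu> \<sigma> s z = s *\<^sub>R \<mu> + \<sigma> *v z"

lemma borel_measurable_matrix_vector_mult [measurable (raw)]:
  fixes \<sigma> :: "real^'d^'d::finite"
  assumes "f \<in> borel_measurable M"
  shows "(\<lambda>\<omega>. \<sigma> *v f \<omega>) \<in> borel_measurable M"
proof -
  have "((*v) \<sigma>) \<in> borel_measurable borel"
    by (intro borel_measurable_continuous_onI linear_continuous_on matrix_vector_mul_bounded_linear)
  from measurable_compose[OF assms this] show ?thesis .
qed

lemma borel_measurable_increment [measurable (raw)]:
  assumes "f \<in> borel_measurable M" "g \<in> borel_measurable M"
  shows "(\<lambda>\<omega>. increment \<mu> \<sigma> (f \<omega>) (g \<omega>)) \<in> borel_measurable M"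
  using assms unfolding increment_def by measurable

text \<open>The Brownian part contributes order s^k and the drift order s^(2k), which is at most s^k
  because s <= 1. Even moments reduce coordinate by coordinate to one-dimensional Gaussian
  ones.\<close>

lemma increment_even_moment:
  fixes \<mu> :: "real^'d::finite" and \<sigma> :: "real^'d^'d"
  assumes "k > 0"
  obtains C where "C \<ge> 0"
    and "\<And>s. 0 < s \<Longrightarrow> s \<le> 1 \<Longrightarrow> integrable (gauss_measure s) (\<lambda>z. norm (increment \<mu> \<sigma> s z) ^ (2*k))"
    and "\<And>s. 0 < s \<Longrightarrow> s \<le> 1 \<Longrightarrow> integral\<^sup>L (gauss_measure s) (\<lambda>z. norm (increment \<mu> \<sigma> s z) ^ (2*k)) \<le> C * s ^ k"
proof -
  define K where "K = onorm ((*v) \<sigma>)"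
  have K: "norm (\<sigma> *v z) \<le> K * norm z" for z
    unfolding K_def by (rule onorm[OF matrix_vector_mul_bounded_linear])
  have K0: "K \<ge> 0" unfolding K_def by (rule onorm_pos_le[OF matrix_vector_mul_bounded_linear])
  \<comment> \<open>Number of summands in the bound of the norm: the drift, indexed by
    \<open>None\<close>, and one for each coordinate.\<close>
  define n where "n = real (card (UNIV :: 'd option set))"
  define c where "c = (fact (2*k) / (2^k * fact k) :: real)"
  define C where "C = n ^ (2*k) * (norm \<mu> ^ (2*k) + real CARD('d) * (K ^ (2*k) * c))"
  define F where "F s z = n ^ (2*k) * ((s * norm \<mu>) ^ (2*k) + (\<Sum>i\<in>UNIV. K ^ (2*k) * (z $ i) ^ (2*k)))" for s and z :: "real^'d"
  have bound: "norm (increment \<mu> \<sigma> s z) ^ (2*k) \<le> F s z" if "s > 0" for s z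
  proof -
    define a where "a j = (case j of None \<Rightarrow> s * norm \<mu> | Some i \<Rightarrow> K * \<bar>z $ i\<bar>)" for j
    have a0: "a j \<ge> 0" for j using that K0 by (auto simp: a_def split: option.split)
    have ss: "(\<Sum>j\<in>UNIV. g j) = g None + (\<Sum>i\<in>UNIV. g (Some i))" for g :: "'d option \<Rightarrow> real"
      unfolding UNIV_option_conv by (subst sum.insert) (auto simp: sum.reindex)
    have "norm (increment \<mu> \<sigma> s z) \<le> s * norm \<mu> + K * norm z"
      unfolding increment_def using that K[of z] norm_triangle_ineq[of "s *\<^sub>R \<mu>" "\<sigma> *v z"] by simp
    also have "\<dots> \<le> s * norm \<mu> + K * (\<Sum>i\<in>UNIV. \<bar>z $ i\<bar>)"
      using K0 norm_le_l1_cart[of z] by (simp add: mult_left_mono)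
    also have "\<dots> = (\<Sum>j\<in>UNIV. a j)"
      unfolding ss a_def by (simp add: sum_distrib_left)
    finally have "norm (increment \<mu> \<sigma> s z) ^ (2*k) \<le> (\<Sum>j\<in>UNIV. a j) ^ (2*k)"
      by (rule power_mono) simp
    also have "\<dots> \<le> n ^ (2*k) * (\<Sum>j\<in>UNIV. a j ^ (2*k))"
      unfolding n_def by (rule power_sum_le_card_power) (use a0 assms in auto)
    also have "\<dots> = F s z"
      unfolding ss F_def a_def by (simp add: power_mult_distrib power_even_abs)
    finally show ?thesis .
  qed
  have intF: "has_bochner_integral (gauss_measure s) (F s)
      (n ^ (2*k) * ((s * norm \<mu>) ^ (2*k) * 1 + (\<Sum>i\<in>(UNIV::'d set). K ^ (2*k) * (c * s^k))))" if s: "s > 0" for s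
  proof -
    interpret prob_space "gauss_measure s :: (real^'d) measure" by (rule prob_space_gauss_measure[OF s])
    have 1: "has_bochner_integral (gauss_measure s) (\<lambda>z::real^'d. 1::real) 1"
      using prob_space by (simp add: has_bochner_integral_iff)
    have 2: "has_bochner_integral (gauss_measure s) (\<lambda>z::real^'d. (z $ i) ^ (2*k)) (c * s^k)" for i
      using gauss_measure_even_moment[OF s, of i k] by (simp add: c_def power_divide)
    have "has_bochner_integral (gauss_measure s) (\<lambda>z::real^'d. n ^ (2*k) * ((s * norm \<mu>) ^ (2*k) * 1 + (\<Sum>i\<in>UNIV. K ^ (2*k) * (z $ i) ^ (2*k))))
        (n ^ (2*k) * ((s * norm \<mu>) ^ (2*k) * 1 + (\<Sum>i\<in>(UNIV::'d set). K ^ (2*k) * (c * s^k))))"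
      by (intro has_bochner_integral_mult_right has_bochner_integral_add has_bochner_integral_sum 1 2)
    then show ?thesis by (simp add: F_def[abs_def])
  qed
  have int: "integrable (gauss_measure s) (\<lambda>z. norm (increment \<mu> \<sigma> s z) ^ (2*k))" if "s > 0" for s
    by (rule Bochner_Integration.integrable_bound[of _ "F s"])
      (use intF[OF that] bound[OF that] in \<open>auto simp: has_bochner_integral_iff intro!: order_trans[OF bound[OF that] abs_ge_self]\<close>)
  show thesis
  proof
    show "C \<ge> 0" unfolding C_def n_def c_def using K0
      by (intro mult_nonneg_nonneg add_nonneg_nonneg) auto
    fix s :: real assume s: "0 < s" "s \<le> 1"
    show "integrable (gauss_measure s) (\<lambda>z. norm (increment \<mu> \<sigma> s z) ^ (2*k))" using int s by simp
    have "integral\<^sup>L (gauss_measure s) (\<lambda>z. norm (increment \<mu> \<sigma> s z) ^ (2*k)) \<le> integral\<^sup>L (gauss_measure s) (F s)"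
      by (rule integral_mono) (use int s bound intF in \<open>auto simp: has_bochner_integral_iff\<close>)
    also have "\<dots> = n ^ (2*k) * ((s * norm \<mu>) ^ (2*k) * 1 + (\<Sum>i\<in>(UNIV::'d set). K ^ (2*k) * (c * s^k)))"
      using intF[OF s(1)] by (simp only: has_bochner_integral_iff)
    also have "\<dots> = n ^ (2*k) * (s ^ (2*k) * norm \<mu> ^ (2*k) + real CARD('d) * (K ^ (2*k) * c) * s^k)"
      by (simp add: power_mult_distrib)
    also have "\<dots> \<le> n ^ (2*k) * (s ^ k * norm \<mu> ^ (2*k) + real CARD('d) * (K ^ (2*k) * c) * s^k)"
      using s by (intro mult_left_mono add_right_mono mult_right_mono power_decreasing) (auto simp: n_def)
    also have "\<dots> = C * s ^ k" by (simp add: C_def algebra_simps)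
    finally show "integral\<^sup>L (gauss_measure s) (\<lambda>z. norm (increment \<mu> \<sigma> s z) ^ (2*k)) \<le> C * s ^ k" .
  qed
qed

lemma inner_matrix_transpose: "v \<bullet> (\<sigma> *v z) = (transpose \<sigma> *v v) \<bullet> (z::real^'d::finite)"
  by (simp add: dot_lmul_matrix)

lemma gauss_measure_inner:
  fixes w :: "real^'d::finite"
  assumes s: "s > 0"
  shows "has_bochner_integral (gauss_measure s) (\<lambda>z. w \<bullet> z) 0"
    and "has_bochner_integral (gauss_measure s) (\<lambda>z. (w \<bullet> z)\<^sup>2) (s * (w \<bullet> w))"
proof -
  have "has_bochner_integral (gauss_measure s) (\<lambda>z. \<Sum>i\<in>UNIV. w $ i * z $ i) (\<Sum>i\<in>UNIV. w $ i * 0)"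
    by (intro has_bochner_integral_sum has_bochner_integral_mult_right gauss_measure_mean[OF s])
  then show "has_bochner_integral (gauss_measure s) (\<lambda>z. w \<bullet> z) 0"
    by (simp add: inner_vec_def)
  have "has_bochner_integral (gauss_measure s) (\<lambda>z. \<Sum>i\<in>UNIV. \<Sum>j\<in>UNIV. (w $ i * w $ j) * (z $ i * z $ j))
     (\<Sum>i\<in>UNIV. \<Sum>j\<in>UNIV. (w $ i * w $ j) * (if i = j then s else 0))"
    by (intro has_bochner_integral_sum has_bochner_integral_mult_right gauss_measure_cov[OF s])
  moreover have "(\<lambda>z. \<Sum>i\<in>UNIV. \<Sum>j\<in>UNIV. (w $ i * w $ j) * (z $ i * z $ j)) = (\<lambda>z. (w \<bullet> z)\<^sup>2)"
    by (auto simp: inner_vec_def power2_eq_square sum_product intro!: ext sum.cong)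
  moreover have "(\<Sum>i\<in>UNIV. \<Sum>j\<in>UNIV. (w $ i * w $ j) * (if i = j then s else 0)) = s * (w \<bullet> w)"
  proof -
    have "(\<Sum>i\<in>UNIV. \<Sum>j\<in>UNIV. (w $ i * w $ j) * (if i = j then s else 0)) =
        (\<Sum>i\<in>UNIV. \<Sum>j\<in>UNIV. if i = j then s * (w $ i * w $ i) else 0)"
      by (intro sum.cong) auto
    then show ?thesis by (simp add: inner_vec_def sum_distrib_left)
  qed
  ultimately show "has_bochner_integral (gauss_measure s) (\<lambda>z. (w \<bullet> z)\<^sup>2) (s * (w \<bullet> w))"
    by simp
qed

text \<open>The step is the constant s \<mu> plus a centred Gaussian vector with covariance s times
  \<open>\<sigma> ** transpose \<sigma>\<close>; the cross term of the square has mean 0.\<close>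

lemma increment_inner:
  fixes v :: "real^'d::finite"
  assumes s: "s > 0"
  shows "has_bochner_integral (gauss_measure s) (\<lambda>z. v \<bullet> increment \<mu> \<sigma> s z) (s * (v \<bullet> \<mu>))"
    and "has_bochner_integral (gauss_measure s) (\<lambda>z. (v \<bullet> increment \<mu> \<sigma> s z)\<^sup>2)
      (s * (v \<bullet> ((\<sigma> ** transpose \<sigma>) *v v)) + (s * (v \<bullet> \<mu>))\<^sup>2)"
proof -
  interpret prob_space "gauss_measure s :: (real^'d) measure" by (rule prob_space_gauss_measure[OF s])
  define w where "w = transpose \<sigma> *v v"
  have eq: "v \<bullet> increment \<mu> \<sigma> s z = s * (v \<bullet> \<mu>) + w \<bullet> z" for z
    by (simp add: increment_def inner_add_right inner_matrix_transpose w_def)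
  have c: "has_bochner_integral (gauss_measure s) (\<lambda>z::real^'d. c::real) c" for c
    using prob_space by (simp add: has_bochner_integral_iff)
  show "has_bochner_integral (gauss_measure s) (\<lambda>z. v \<bullet> increment \<mu> \<sigma> s z) (s * (v \<bullet> \<mu>))"
    unfolding eq using has_bochner_integral_add[OF c gauss_measure_inner(1)[OF s, of w]] by simp
  have ww: "w \<bullet> w = v \<bullet> ((\<sigma> ** transpose \<sigma>) *v v)"
    unfolding w_def inner_matrix_transpose[symmetric] by (simp add: matrix_vector_mul_assoc del: transpose_matrix_vector)
  have "has_bochner_integral (gauss_measure s) (\<lambda>z. (s * (v \<bullet> \<mu>))\<^sup>2 + (2 * (s * (v \<bullet> \<mu>)) * (w \<bullet> z) + (w \<bullet> z)\<^sup>2))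
    ((s * (v \<bullet> \<mu>))\<^sup>2 + (2 * (s * (v \<bullet> \<mu>)) * 0 + s * (w \<bullet> w)))"
    by (intro has_bochner_integral_add has_bochner_integral_mult_right c gauss_measure_inner[OF s])
  then show "has_bochner_integral (gauss_measure s) (\<lambda>z. (v \<bullet> increment \<mu> \<sigma> s z)\<^sup>2)
      (s * (v \<bullet> ((\<sigma> ** transpose \<sigma>) *v v)) + (s * (v \<bullet> \<mu>))\<^sup>2)"
    unfolding eq ww[symmetric] by (simp add: power2_sum algebra_simps)
qed

text \<open>The Lagrange remainder is of the even order four, hence nonnegative for either sign of
  x. A cut after the quadratic term would fail for negative x, and one after the linear term would
  lose the quadratic part that drives the barrier.\<close>

lemma exp_ge_cubic: "1 + x + x\<^sup>2 / 2 + x^3 / 6 \<le> exp (x::real)"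
proof -
  obtain t where "exp x = (\<Sum>m<4. x ^ m / fact m) + (exp t / fact 4) * x ^ 4"
    using Maclaurin_exp_le[of x 4] by blast
  moreover have "(\<Sum>m<4. x ^ m / fact m) = 1 + x + x\<^sup>2 / 2 + x^3 / 6"
    by (simp add: eval_nat_numeral)
  ultimately show ?thesis by simp
qed

text \<open>The third order terms in $|e|$ are split by $2|e|^3 \le q |e|^2 + |e|^4 / q$, so that only even
  moments of the increment are needed; for an increment over time $s$ one takes $q = \sqrt s$.\<close>

lemma exp_perturbed_square_ge:
  fixes v e :: "'a::real_inner" and l M q :: real
  assumes l: "l > 0" and M: "norm v \<le> M" and q: "q > 0"
  shows "1 - 2 * l * (v \<bullet> e) - l * norm e ^ 2 + 2 * l\<^sup>2 * (v \<bullet> e)\<^sup>2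
      - (l\<^sup>2 * M + 8 * l^3 * M^3 / 3) * (q * norm e ^ 2 + norm e ^ 4 / q) - 2 * l^3 / 3 * norm e ^ 6
    \<le> exp (- l * (2 * (v \<bullet> e) + norm e ^ 2))"
proof -
  define r where "r = norm e"
  define b where "b = v \<bullet> e"
  have r: "r \<ge> 0" by (simp add: r_def)
  have M0: "M \<ge> 0" using M norm_ge_zero order_trans by blast
  have b: "\<bar>b\<bar> \<le> M * r"
    using Cauchy_Schwarz_ineq2[of v e] M r unfolding b_def r_def by (meson mult_right_mono norm_ge_zero order_trans)
  let ?y = "2 * b + r\<^sup>2"
  have y: "\<bar>?y\<bar> \<le> 2 * (M * r) + r\<^sup>2"
    using b by (simp add: abs_le_iff) (smt (verit) zero_le_power2)
  have sq: "?y\<^sup>2 \<ge> 4 * b\<^sup>2 - 4 * M * r^3"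
  proof -
    have "\<bar>b * r\<^sup>2\<bar> \<le> M * r * r\<^sup>2" using b by (simp add: abs_mult mult_right_mono)
    then have "b * r\<^sup>2 \<ge> - (M * r^3)" by (simp add: power3_eq_cube power2_eq_square abs_le_iff mult.assoc)
    then show ?thesis by (simp add: power2_sum power3_eq_cube algebra_simps)
  qed
  have cub: "\<bar>?y\<bar>^3 \<le> 32 * M^3 * r^3 + 4 * r^6"
  proof -
    have "\<bar>?y\<bar>^3 \<le> (2 * (M * r) + r\<^sup>2)^3" using y by (rule power_mono) simp
    \<comment> \<open>Convexity of the cube on the nonnegative half line.\<close>
    also have "\<dots> \<le> 4 * ((2 * (M * r))^3 + (r\<^sup>2)^3)"
    proof -
      have "4 * (p^3 + p'^3) - (p + p')^3 = 3 * (p + p') * (p - p')\<^sup>2" for p p' :: real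
        by (simp add: power3_eq_cube power2_eq_square algebra_simps)
      then have "4 * (p^3 + p'^3) - (p + p')^3 \<ge> 0" if "p \<ge> 0" "p' \<ge> 0" for p p' :: real using that by simp
      from this[of "2 * (M * r)" "r\<^sup>2"] show ?thesis using M0 r by simp
    qed
    also have "\<dots> = 32 * M^3 * r^3 + 4 * r^6"
      by (simp add: power_mult_distrib flip: power_mult)
    finally show ?thesis .
  qed
  have r3: "2 * r^3 \<le> q * r\<^sup>2 + r^4 / q"
  proof -
    have "q * r\<^sup>2 + r^4 / q - 2 * r^3 = r\<^sup>2 * (q - r)\<^sup>2 / q"
      using q by (simp add: field_simps power2_eq_square power3_eq_cube power4_eq_xxxx)
    also have "\<dots> \<ge> 0" using q by simp
    finally show ?thesis by simp
  qed
  let ?A = "l\<^sup>2 * M + 8 * l^3 * M^3 / 3"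
  have A0: "?A \<ge> 0" using l M0 by simp
  have "1 + (- l * ?y) + (- l * ?y)\<^sup>2 / 2 + (- l * ?y)^3 / 6 \<le> exp (- l * ?y)"
    by (rule exp_ge_cubic)
  moreover have "(- l * ?y)\<^sup>2 \<ge> l\<^sup>2 * (4 * b\<^sup>2 - 4 * M * r^3)"
    using sq by (simp add: power_mult_distrib mult_left_mono)
  moreover have "(- l * ?y)^3 \<ge> - (l^3 * (32 * M^3 * r^3 + 4 * r^6))"
  proof -
    have "(- l * ?y)^3 = - (l^3 * ?y^3)" by (simp add: power3_eq_cube)
    moreover have "?y^3 \<le> \<bar>?y\<bar>^3" using abs_ge_self[of "?y^3"] by (simp only: power_abs)
    ultimately show ?thesis using cub l by (simp add: mult_left_mono)
  qed
  ultimately have "1 - l * ?y + l\<^sup>2 * (4 * b\<^sup>2 - 4 * M * r^3) / 2 - l^3 * (32 * M^3 * r^3 + 4 * r^6) / 6 \<le> exp (- l * ?y)"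
    by simp
  moreover have "l\<^sup>2 * (4 * b\<^sup>2 - 4 * M * r^3) / 2 - l^3 * (32 * M^3 * r^3 + 4 * r^6) / 6
     = 2 * l\<^sup>2 * b\<^sup>2 - ?A * (2 * r^3) - 2 * l^3 / 3 * r^6"
    by (simp add: field_simps)
  moreover have "?A * (2 * r^3) \<le> ?A * (q * r\<^sup>2 + r^4 / q)"
    using r3 A0 by (rule mult_left_mono)
  ultimately have "1 - l * ?y + 2 * l\<^sup>2 * b\<^sup>2 - ?A * (q * r\<^sup>2 + r^4 / q) - 2 * l^3 / 3 * r^6 \<le> exp (- l * ?y)"
    by linarith
  then show ?thesis unfolding b_def r_def by (simp add: algebra_simps)
qed

text \<open>For g(v) = exp(-l |v|^2) the generator yields g(v) (2 l^2 v.\<Sigma>v - 2 l v.\<mu> - l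
  tr \<Sigma>). Away from the origin the term in l^2 dominates for large l by ellipticity, so g
  grows in mean along a short step, at a rate uniform over R <= |v| <= M. Moment bounds of the step
  take the place of the generator and give an explicit range of s.\<close>

lemma gauss_barrier_step:
  fixes \<mu> :: "real^'d::finite" and \<sigma> :: "real^'d^'d"
  assumes m: "m > 0" "\<And>v. m * (v \<bullet> v) \<le> v \<bullet> ((\<sigma> ** transpose \<sigma>) *v v)"
    and R: "R > 0" "R \<le> M"
  obtains l c s0 where "l > 0" "c > 0" "0 < s0" "s0 \<le> 1"
    and "\<And>s v. 0 < s \<Longrightarrow> s \<le> s0 \<Longrightarrow> R \<le> norm v \<Longrightarrow> norm v \<le> M \<Longrightarrow>
      exp (- l * (norm v)\<^sup>2) + c * s \<le> integral\<^sup>L (gauss_measure s) (\<lambda>z. exp (- l * (norm (v + increment \<mu> \<sigma> s z))\<^sup>2))"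
proof -
  obtain C1 where C1: "C1 \<ge> 0"
    "\<And>s. 0 < s \<Longrightarrow> s \<le> 1 \<Longrightarrow> integrable (gauss_measure s) (\<lambda>z. norm (increment \<mu> \<sigma> s z) ^ (2*1))"
    "\<And>s. 0 < s \<Longrightarrow> s \<le> 1 \<Longrightarrow> integral\<^sup>L (gauss_measure s) (\<lambda>z. norm (increment \<mu> \<sigma> s z) ^ (2*1)) \<le> C1 * s ^ 1"
    by (rule increment_even_moment[of 1]) auto
  obtain C2 where C2: "C2 \<ge> 0"
    "\<And>s. 0 < s \<Longrightarrow> s \<le> 1 \<Longrightarrow> integrable (gauss_measure s) (\<lambda>z. norm (increment \<mu> \<sigma> s z) ^ (2*2))"
    "\<And>s. 0 < s \<Longrightarrow> s \<le> 1 \<Longrightarrow> integral\<^sup>L (gauss_measure s) (\<lambda>z. norm (increment \<mu> \<sigma> s z) ^ (2*2)) \<le> C2 * s ^ 2"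
    by (rule increment_even_moment[of 2]) auto
  obtain C3 where C3: "C3 \<ge> 0"
    "\<And>s. 0 < s \<Longrightarrow> s \<le> 1 \<Longrightarrow> integrable (gauss_measure s) (\<lambda>z. norm (increment \<mu> \<sigma> s z) ^ (2*3))"
    "\<And>s. 0 < s \<Longrightarrow> s \<le> 1 \<Longrightarrow> integral\<^sup>L (gauss_measure s) (\<lambda>z. norm (increment \<mu> \<sigma> s z) ^ (2*3)) \<le> C3 * s ^ 3"
    by (rule increment_even_moment[of 3]) auto
  \<comment> \<open>Chosen so that the quadratic term beats the drift, 2 M |\<mu>|, and the trace,
    bounded through C1, with 1 to spare; this leaves a margin l s.\<close>
  define l where "l = (2 * M * norm \<mu> + C1 + 1) / (2 * m * R\<^sup>2)"
  have l: "l > 0" using C1(1) m R by (auto simp: l_def intro!: divide_pos_pos add_nonneg_pos)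
  have lR: "2 * l * m * R\<^sup>2 = 2 * M * norm \<mu> + C1 + 1"
    using m R by (simp add: l_def)
  have M0: "M > 0" using R by simp
  define A where "A = l\<^sup>2 * M + 8 * l^3 * M^3 / 3"
  have A0: "A \<ge> 0" using l M0 by (simp add: A_def)
  define B where "B = 2 * l^3 / 3"
  have B0: "B \<ge> 0" using l by (simp add: B_def)
  define K where "K = A * (C1 + C2) + B * C3"
  have K0: "K \<ge> 0" using A0 B0 C1 C2 C3 by (simp add: K_def)
  \<comment> \<open>For s <= s0 the remainder K sqrt s takes at most half of the margin l.\<close>
  define s0 where "s0 = min 1 ((l / (2 * (K + 1)))\<^sup>2)"
  \<comment> \<open>The other half of the margin, times a lower bound of exp(-l |v|^2) on |v| <=
    M.\<close>
  define c where "c = exp (- l * M\<^sup>2) * (l / 2)"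
  show thesis
  proof (rule that[of l c s0])
    show "l > 0" by fact
    show "c > 0" using l by (simp add: c_def)
    show "0 < s0" using l K0 by (simp add: s0_def)
    show "s0 \<le> 1" by (simp add: s0_def)
    fix s and v :: "real^'d"
    assume s: "0 < s" "s \<le> s0" and v: "R \<le> norm v" "norm v \<le> M"
    have s1: "s \<le> 1" using s by (simp add: s0_def)
    define q where "q = sqrt s"
    have q: "q > 0" "q * q = s" "q \<le> 1" using s s1 by (auto simp: q_def)
    have Kq: "K * q \<le> l / 2"
    proof -
      have "q \<le> l / (2 * (K + 1))"
        unfolding q_def using s l K0 by (intro real_le_lsqrt) (auto simp: s0_def)
      then have "(K + 1) * q \<le> l / 2" using K0 by (simp add: field_simps)
      then show ?thesis using q by (simp add: algebra_simps)
    qed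
    let ?e = "\<lambda>z. increment \<mu> \<sigma> s z"
    interpret prob_space "gauss_measure s :: (real^'d) measure" by (rule prob_space_gauss_measure[OF s(1)])
    define G where "G z = 1 - 2 * l * (v \<bullet> ?e z) - l * norm (?e z) ^ 2 + 2 * l\<^sup>2 * (v \<bullet> ?e z)\<^sup>2
      - A * (q * norm (?e z) ^ 2 + norm (?e z) ^ 4 / q) - B * norm (?e z) ^ 6" for z
    have I: "integrable (gauss_measure s) (\<lambda>z. norm (?e z) ^ 2)"
      "integrable (gauss_measure s) (\<lambda>z. norm (?e z) ^ 4)"
      "integrable (gauss_measure s) (\<lambda>z. norm (?e z) ^ 6)"
      using C1(2)[OF s(1) s1] C2(2)[OF s(1) s1] C3(2)[OF s(1) s1] by simp_all
    note inner = increment_inner[OF s(1), of v \<mu> \<sigma>, unfolded has_bochner_integral_iff]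
    let ?E = "integral\<^sup>L (gauss_measure s)"
    have intG: "integrable (gauss_measure s) G"
      unfolding G_def[abs_def] using I inner
      by (intro Bochner_Integration.integrable_diff Bochner_Integration.integrable_add integrable_mult_right integrable_divide integrable_const) auto
    have EG: "?E G = 1 - 2 * l * (s * (v \<bullet> \<mu>)) - l * ?E (\<lambda>z. norm (?e z) ^ 2)
       + 2 * l\<^sup>2 * (s * (v \<bullet> ((\<sigma> ** transpose \<sigma>) *v v)) + (s * (v \<bullet> \<mu>))\<^sup>2)
       - A * (q * ?E (\<lambda>z. norm (?e z) ^ 2) + ?E (\<lambda>z. norm (?e z) ^ 4) / q) - B * ?E (\<lambda>z. norm (?e z) ^ 6)"
      unfolding G_def[abs_def] using I inner prob_space by simp
    have e2: "?E (\<lambda>z. norm (?e z) ^ 2) \<le> C1 * s" using C1(3)[OF s(1) s1] by simp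
    \<comment> \<open>The choice q = sqrt s turns s^2 / q into s q, an order that the margin absorbs
      for small s.\<close>
    have e4: "?E (\<lambda>z. norm (?e z) ^ 4) / q \<le> C2 * (s * q)"
    proof -
      have "?E (\<lambda>z. norm (?e z) ^ 4) \<le> C2 * (s * q) * q"
        using C2(3)[OF s(1) s1] q(2) by (simp add: power2_eq_square mult.assoc)
      then show ?thesis using q by (simp add: divide_le_eq)
    qed
    have e6: "?E (\<lambda>z. norm (?e z) ^ 6) \<le> C3 * (s * q)"
    proof -
      have "s ^ 3 = s * q * (s * s / q)" using q by (simp add: power3_eq_cube)
      also have "s * s / q = q ^ 3" using q by (simp add: field_simps power3_eq_cube)
      also have "s * q * q ^ 3 \<le> s * q * 1" using q s by (intro mult_left_mono power_le_one) auto
      finally have "s ^ 3 \<le> s * q" by simp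
      then have "C3 * s ^ 3 \<le> C3 * (s * q)" using C3 by (simp add: mult_left_mono)
      then show ?thesis using C3(3)[OF s(1) s1] by simp
    qed
    have "A * (q * ?E (\<lambda>z. norm (?e z) ^ 2) + ?E (\<lambda>z. norm (?e z) ^ 4) / q) \<le> A * (q * (C1 * s) + C2 * (s * q))"
      using e2 e4 A0 q by (intro mult_left_mono add_mono) auto
    moreover have "B * ?E (\<lambda>z. norm (?e z) ^ 6) \<le> B * (C3 * (s * q))"
      using e6 B0 by (rule mult_left_mono)
    moreover have "A * (q * (C1 * s) + C2 * (s * q)) + B * (C3 * (s * q)) = s * (K * q)"
      by (simp add: K_def algebra_simps)
    moreover have "s * (K * q) \<le> s * (l / 2)" using Kq s by simp
    moreover have "l * ?E (\<lambda>z. norm (?e z) ^ 2) \<le> l * (C1 * s)" using e2 l by simp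
    \<comment> \<open>Ellipticity enters here; the squared mean of the step is nonnegative and
      dropped.\<close>
    moreover have "2 * l\<^sup>2 * (s * (v \<bullet> ((\<sigma> ** transpose \<sigma>) *v v)) + (s * (v \<bullet> \<mu>))\<^sup>2) \<ge> s * l * (2 * l * m * R\<^sup>2)"
    proof -
      have "R\<^sup>2 \<le> v \<bullet> v" using v R by (simp add: power_mono flip: power2_norm_eq_inner)
      then have "m * R\<^sup>2 \<le> v \<bullet> ((\<sigma> ** transpose \<sigma>) *v v)"
        using m(2)[of v] m(1) mult_left_mono[of "R\<^sup>2" "v \<bullet> v" m] by linarith
      then have "2 * l\<^sup>2 * (s * (m * R\<^sup>2)) \<le> 2 * l\<^sup>2 * (s * (v \<bullet> ((\<sigma> ** transpose \<sigma>) *v v)) + (s * (v \<bullet> \<mu>))\<^sup>2)"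
        using s by (intro mult_left_mono add_increasing2) auto
      then show ?thesis by (simp add: power2_eq_square algebra_simps)
    qed
    moreover have "2 * l * (s * (v \<bullet> \<mu>)) \<le> s * l * (2 * M * norm \<mu>)"
    proof -
      have "v \<bullet> \<mu> \<le> M * norm \<mu>"
        using norm_cauchy_schwarz[of v \<mu>] v by (meson mult_right_mono norm_ge_zero order_trans)
      then have "(2 * l * s) * (v \<bullet> \<mu>) \<le> (2 * l * s) * (M * norm \<mu>)"
        using l s by (intro mult_left_mono) auto
      then show ?thesis by (simp add: algebra_simps)
    qed
    moreover have "s * l * (2 * l * m * R\<^sup>2) = s * l * (2 * M * norm \<mu>) + l * (C1 * s) + s * l"
      unfolding lR by (simp add: algebra_simps)
    ultimately have EG1: "1 + s * (l / 2) \<le> ?E G" unfolding EG by linarith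
    let ?X = "\<lambda>z. exp (- l * (norm (v + ?e z))\<^sup>2)"
    have iX: "integrable (gauss_measure s) ?X"
    proof (rule integrable_const_bound[of _ 1])
      show "AE z in gauss_measure s. norm (?X z) \<le> 1" using l by simp
    qed measurable
    have X: "exp (- l * (norm v)\<^sup>2) * G z \<le> ?X z" for z
    proof -
      have "(norm (v + ?e z))\<^sup>2 = (norm v)\<^sup>2 + (2 * (v \<bullet> ?e z) + norm (?e z) ^ 2)"
        by (simp add: power2_norm_eq_inner inner_add_left inner_add_right inner_commute)
      then have "?X z = exp (- l * (norm v)\<^sup>2) * exp (- l * (2 * (v \<bullet> ?e z) + norm (?e z) ^ 2))"
        by (simp add: exp_add[symmetric] algebra_simps)
      moreover have "G z \<le> exp (- l * (2 * (v \<bullet> ?e z) + norm (?e z) ^ 2))"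
        unfolding G_def A_def B_def by (rule exp_perturbed_square_ge[OF l v(2) q(1)])
      ultimately show ?thesis by (simp only:) (rule mult_left_mono, auto)
    qed
    have "exp (- l * (norm v)\<^sup>2) * (1 + s * (l / 2)) \<le> exp (- l * (norm v)\<^sup>2) * ?E G"
      using EG1 by (rule mult_left_mono) simp
    also have "\<dots> = ?E (\<lambda>z. exp (- l * (norm v)\<^sup>2) * G z)" by simp
    also have "\<dots> \<le> ?E ?X"
      by (rule integral_mono) (use intG iX X in auto)
    finally have "exp (- l * (norm v)\<^sup>2) + exp (- l * (norm v)\<^sup>2) * (l / 2) * s \<le> ?E ?X"
      by (simp add: algebra_simps)
    moreover have "c * s \<le> exp (- l * (norm v)\<^sup>2) * (l / 2) * s"
      unfolding c_def using v l s R by (intro mult_right_mono) (auto intro: power_mono)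
    ultimately show "exp (- l * (norm v)\<^sup>2) + c * s \<le> ?E ?X" by linarith
  qed
qed

section \<open>A barrier from exterior balls\<close>

text \<open>With x = sqrt l |z| the derivative has modulus sqrt l (2 x exp(-x^2)), and 2 x <= 1 +
  x^2 <= exp(x^2).\<close>

lemma exp_neg_square_lipschitz:
  fixes l a b :: real
  assumes l: "l > 0"
  shows "\<bar>exp (- l * a\<^sup>2) - exp (- l * b\<^sup>2)\<bar> \<le> sqrt l * \<bar>a - b\<bar>"
proof -
  have *: "\<bar>exp (- l * a\<^sup>2) - exp (- l * b\<^sup>2)\<bar> \<le> sqrt l * \<bar>a - b\<bar>" if "a < b" for a b :: real
  proof -
    have "\<exists>z>a. z < b \<and> exp (- l * b\<^sup>2) - exp (- l * a\<^sup>2) = (b - a) * (- 2 * l * z * exp (- l * z\<^sup>2))"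
      by (rule MVT2[OF that]) (auto intro!: derivative_eq_intros)
    then obtain z where z: "exp (- l * b\<^sup>2) - exp (- l * a\<^sup>2) = (b - a) * (- 2 * l * z * exp (- l * z\<^sup>2))"
      by blast
    let ?x = "sqrt l * \<bar>z\<bar>"
    have "0 \<le> (?x - 1)\<^sup>2" by simp
    then have "2 * ?x \<le> 1 + ?x\<^sup>2" by (simp add: power2_diff)
    also have "?x\<^sup>2 = l * z\<^sup>2" using l by (simp add: power_mult_distrib)
    also have "1 + l * z\<^sup>2 \<le> exp (l * z\<^sup>2)" by (rule exp_ge_add_one_self)
    finally have "2 * ?x * exp (- l * z\<^sup>2) \<le> 1"
      by (simp add: exp_minus field_simps)
    then have "sqrt l * (2 * ?x * exp (- l * z\<^sup>2)) \<le> sqrt l * 1"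
      using l by (intro mult_left_mono) auto
    moreover have "sqrt l * (2 * ?x * exp (- l * z\<^sup>2)) = \<bar>- 2 * l * z * exp (- l * z\<^sup>2)\<bar>"
      using l by (simp add: abs_mult)
    ultimately have "\<bar>- 2 * l * z * exp (- l * z\<^sup>2)\<bar> \<le> sqrt l" by simp
    then have "\<bar>b - a\<bar> * \<bar>- 2 * l * z * exp (- l * z\<^sup>2)\<bar> \<le> \<bar>b - a\<bar> * sqrt l"
      by (rule mult_left_mono) simp
    then have "\<bar>exp (- l * b\<^sup>2) - exp (- l * a\<^sup>2)\<bar> \<le> \<bar>b - a\<bar> * sqrt l"
      unfolding z abs_mult .
    then show ?thesis by (simp add: abs_minus_commute mult.commute)
  qed
  show ?thesis
    using *[of a b] *[of b a] by (cases a b rule: linorder_cases) (auto simp: abs_minus_commute)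
qed

text \<open>The derivative 2 l z exp(-l z^2) is bounded below on [R, M] by taking z = R in the
  factor and z = M in the exponential. This is the linear growth of the barrier off the
  sphere.\<close>

lemma exp_neg_square_diff_ge:
  fixes l R r M :: real
  assumes l: "l > 0" and R: "0 < R" "R \<le> r" "r \<le> M"
  shows "2 * l * R * exp (- l * M\<^sup>2) * (r - R) \<le> exp (- l * R\<^sup>2) - exp (- l * r\<^sup>2)"
proof (cases "r = R")
  case False
  then have "R < r" using R by simp
  have "\<exists>z>R. z < r \<and> exp (- l * r\<^sup>2) - exp (- l * R\<^sup>2) = (r - R) * (- 2 * l * z * exp (- l * z\<^sup>2))"
    by (rule MVT2[OF \<open>R < r\<close>]) (auto intro!: derivative_eq_intros)
  then obtain z where z: "R < z" "z < r" "exp (- l * r\<^sup>2) - exp (- l * R\<^sup>2) = (r - R) * (- 2 * l * z * exp (- l * z\<^sup>2))"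
    by blast
  have "(r - R) * (2 * l * R * exp (- l * M\<^sup>2)) \<le> (r - R) * (2 * l * z * exp (- l * z\<^sup>2))"
    using l R z by (intro mult_left_mono mult_mono) (auto intro!: power_mono)
  then show ?thesis using z(3) by (simp add: algebra_simps)
qed simp

text \<open>The segment from y to a nearest point of the complement leaves D, hence meets the
  frontier, no farther from y than that nearest point.\<close>

lemma frontier_point_within_infdist:
  fixes y :: "'a::euclidean_space"
  assumes D: "open D" "bounded D" "y \<in> D"
  obtains q where "q \<in> frontier D" "dist y q \<le> infdist y (- D)"
proof -
  have ne: "- D \<noteq> {}" using D by (metis compl_bot_eq double_complement not_bounded_UNIV)
  obtain p where p: "p \<in> - D" "infdist y (- D) = dist y p"
    using infdist_attains_inf[of "- D" y] D ne by (auto simp: closed_def)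
  have "closed_segment y p \<inter> frontier D \<noteq> {}"
    by (rule connected_Int_frontier) (use D p in auto)
  then obtain q where q: "q \<in> closed_segment y p" "q \<in> frontier D" by blast
  have "dist y q \<le> dist y p" using q(1) by (metis dist_in_closed_segment dist_commute)
  with q p that show thesis by metis
qed

text \<open>The point p where the segment from c to y crosses the sphere is a limit of points of the
  ball. As D is open, p lies outside D, and |y - p| bounds the distance from y to the
  complement.\<close>

lemma infdist_compl_le_exterior_ball:
  fixes y c :: "'a::euclidean_space"
  assumes D: "open D" "y \<in> D" and R: "R > 0" and c: "ball c R \<inter> D = {}"
  shows "R \<le> dist y c" and "infdist y (- D) \<le> dist y c - R"
proof -
  show Ry: "R \<le> dist y c" using c D by (metis disjoint_iff dist_commute mem_ball not_le)
  define p where "p = c + (R / dist y c) *\<^sub>R (y - c)"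
  have pos: "dist y c > 0" using Ry R by linarith
  have "dist c p = R" using R pos by (simp add: p_def dist_norm norm_minus_commute)
  then have "p \<in> closure (ball c R)" using R by simp
  then have pD: "p \<in> - D" using open_Int_closure_eq_empty[OF D(1), of "ball c R"] c by blast
  have "y - p = (1 - R / dist y c) *\<^sub>R (y - c)" by (simp add: p_def algebra_simps)
  then have "dist y p = \<bar>1 - R / dist y c\<bar> * dist y c" by (simp add: dist_norm)
  also have "\<dots> = dist y c - R" using pos Ry by (simp add: abs_of_nonneg field_simps)
  finally show "infdist y (- D) \<le> dist y c - R" using infdist_le[OF pD, of y] by simp
qed

text \<open>Each \<open>W c\<close> vanishes on the sphere of an exterior ball and decreases in mean
  at a rate independent of c. The infimum keeps the drift by E inf <= inf E and inherits the common
  Lipschitz constant. The ball touching at a nearby frontier point gives the upper comparison with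
  the distance; the lower one holds for all balls at once.\<close>

lemma exterior_ball_barrier:
  fixes \<mu> :: "real^'d::finite" and \<sigma> :: "real^'d^'d" and D :: "(real^'d) set"
  assumes m: "m > 0" "\<And>v. m * (v \<bullet> v) \<le> v \<bullet> ((\<sigma> ** transpose \<sigma>) *v v)"
    and D: "open D" "bounded D" "D \<noteq> {}" and R: "R > 0"
    and ext: "\<And>z. z \<in> frontier D \<Longrightarrow> \<exists>c. dist z c = R \<and> ball c R \<inter> D = {}"
  obtains \<Phi> :: "real^'d \<Rightarrow> real" and L c0 c1 s0 where
    "L > 0" "c0 > 0" "c1 > 0" "s0 > 0" "s0 \<le> 1"
    "\<And>y y'. \<bar>\<Phi> y - \<Phi> y'\<bar> \<le> L * dist y y'" "\<And>y. \<bar>\<Phi> y\<bar> \<le> 1"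
    "\<And>y. y \<in> D \<Longrightarrow> c1 * infdist y (- D) \<le> \<Phi> y" "\<And>y. y \<in> D \<Longrightarrow> \<Phi> y \<le> L * infdist y (- D)"
    "\<And>s y. 0 < s \<Longrightarrow> s \<le> s0 \<Longrightarrow> y \<in> D \<Longrightarrow>
       integral\<^sup>L (gauss_measure s) (\<lambda>z. \<Phi> (y + increment \<mu> \<sigma> s z)) + c0 * s \<le> \<Phi> y"
proof -
  define Cs where "Cs = {c. ball c R \<inter> D = {} \<and> (\<exists>z\<in>frontier D. dist z c = R)}"
  obtain B where B: "\<And>y. y \<in> closure D \<Longrightarrow> norm y \<le> B"
    using bounded_closure[OF D(2)] by (auto simp: bounded_iff)
  have B0: "B \<ge> 0" using B D(3) closure_subset norm_ge_zero by (metis all_not_in_conv order_trans subsetD)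
  \<comment> \<open>Two points of the closure of D are at most 2 B apart and a centre has distance R
    from some frontier point, so M bounds every |y - c| that occurs.\<close>
  define M where "M = 2 * B + R"
  have M: "dist y c \<le> M" if y: "y \<in> D" and c: "c \<in> Cs" for y c
  proof -
    obtain z where z: "z \<in> frontier D" "dist z c = R" using c by (auto simp: Cs_def)
    have "dist y z \<le> norm y + norm z" by (simp add: dist_norm norm_triangle_ineq4)
    also have "\<dots> \<le> 2 * B" using B[of y] B[of z] y z closure_subset[of D] by (auto simp: frontier_def)
    finally show ?thesis using dist_triangle[of y c z] z by (simp add: M_def)
  qed
  obtain l c0 s0 where l: "l > 0" and c0: "c0 > 0" and s0: "0 < s0" "s0 \<le> 1"
    and step: "\<And>s v. 0 < s \<Longrightarrow> s \<le> s0 \<Longrightarrow> R \<le> norm v \<Longrightarrow> norm v \<le> M \<Longrightarrow>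
      exp (- l * (norm v)\<^sup>2) + c0 * s \<le> integral\<^sup>L (gauss_measure s) (\<lambda>z. exp (- l * (norm (v + increment \<mu> \<sigma> s z))\<^sup>2))"
    using gauss_barrier_step[OF m R, of M \<mu>] B0 by (auto simp: M_def)
  define W where "W c y = exp (- l * R\<^sup>2) - exp (- l * (dist y c)\<^sup>2)" for c y :: "real^'d"
  define \<Phi> where "\<Phi> y = (INF c\<in>Cs. W c y)" for y
  define L where "L = sqrt l"
  define c1 where "c1 = 2 * l * R * exp (- l * M\<^sup>2)"
  have ne: "Cs \<noteq> {}"
  proof -
    obtain y where "y \<in> D" using D by blast
    then obtain q where "q \<in> frontier D" using frontier_point_within_infdist D by metis
    with ext[of q] show ?thesis by (auto simp: Cs_def)
  qed
  have e1: "exp (- l * a) \<le> 1" "exp (- l * a) > 0" if "a \<ge> 0" for a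
    using l that by auto
  have Wb: "\<bar>W c y\<bar> \<le> 1" for c y
    unfolding W_def using e1[OF zero_le_power2, of R] e1[OF zero_le_power2, of "dist y c"] by linarith
  have bdd: "bdd_below ((\<lambda>c. W c y) ` Cs)" for y
  proof (rule bdd_belowI)
    fix a assume "a \<in> (\<lambda>c. W c y) ` Cs"
    then obtain c where "a = W c y" by blast
    then show "- 1 \<le> a" using Wb[of c y] by linarith
  qed
  have le: "\<Phi> y \<le> W c y" if "c \<in> Cs" for c y
    unfolding \<Phi>_def by (rule cINF_lower[OF bdd that])
  have ge: "a \<le> \<Phi> y" if "\<And>c. c \<in> Cs \<Longrightarrow> a \<le> W c y" for a y
    unfolding \<Phi>_def by (rule cINF_greatest[OF ne that])
  have Wl: "\<bar>W c y - W c y'\<bar> \<le> L * dist y y'" for c y y'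
  proof -
    have "\<bar>W c y - W c y'\<bar> \<le> sqrt l * \<bar>dist y' c - dist y c\<bar>"
      unfolding W_def using exp_neg_square_lipschitz[OF l, of "dist y' c" "dist y c"] by simp
    also have "\<dots> \<le> sqrt l * dist y y'"
      using l abs_dist_diff_le[of y' c y] by (intro mult_left_mono) (simp_all add: dist_commute)
    finally show ?thesis by (simp add: L_def)
  qed
  have lip1: "\<Phi> y - L * dist y y' \<le> \<Phi> y'" for y y'
  proof (rule ge)
    fix c assume "c \<in> Cs"
    from le[OF this, of y] Wl[of c y y'] show "\<Phi> y - L * dist y y' \<le> W c y'" by linarith
  qed
  have lip: "\<bar>\<Phi> y - \<Phi> y'\<bar> \<le> L * dist y y'" for y y'
    using lip1[of y y'] lip1[of y' y] by (simp add: dist_commute abs_le_iff)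
  have \<Phi>b: "\<bar>\<Phi> y\<bar> \<le> 1" for y
  proof -
    obtain c where c: "c \<in> Cs" using ne by blast
    have "- 1 \<le> \<Phi> y" by (rule ge) (smt (verit) Wb)
    with le[OF c, of y] Wb[of c y] show ?thesis by linarith
  qed
  have L0: "L > 0" using l by (simp add: L_def)
  have "L-lipschitz_on UNIV \<Phi>"
    using lip L0 by (auto simp: lipschitz_on_def dist_real_def)
  then have [measurable]: "\<Phi> \<in> borel_measurable borel"
    by (intro borel_measurable_continuous_onI lipschitz_on_continuous_on)
  have lower: "c1 * infdist y (- D) \<le> \<Phi> y" if y: "y \<in> D" for y
  proof (rule ge)
    fix c assume c: "c \<in> Cs"
    then have bc: "ball c R \<inter> D = {}" by (simp add: Cs_def)
    note * = infdist_compl_le_exterior_ball[OF D(1) y R bc]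
    have "c1 * infdist y (- D) \<le> c1 * (dist y c - R)"
      using *(2) l R by (intro mult_left_mono) (auto simp: c1_def)
    also have "\<dots> \<le> W c y"
      unfolding c1_def W_def by (rule exp_neg_square_diff_ge[OF l R *(1) M[OF y c]])
    finally show "c1 * infdist y (- D) \<le> W c y" .
  qed
  have upper: "\<Phi> y \<le> L * infdist y (- D)" if y: "y \<in> D" for y
  proof -
    obtain q where q: "q \<in> frontier D" "dist y q \<le> infdist y (- D)"
      using frontier_point_within_infdist[OF D(1,2) y] by blast
    obtain c where c: "dist q c = R" "ball c R \<inter> D = {}" using ext[OF q(1)] by blast
    then have "\<Phi> y \<le> W c y" using q by (intro le) (auto simp: Cs_def)
    also have "\<dots> \<le> W c q + L * dist y q" using Wl[of c y q] by linarith
    also have "W c q = 0" using c by (simp add: W_def)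
    finally show ?thesis using mult_left_mono[OF q(2), of L] L0 by linarith
  qed
  have drift: "integral\<^sup>L (gauss_measure s) (\<lambda>z. \<Phi> (y + increment \<mu> \<sigma> s z)) + c0 * s \<le> \<Phi> y"
    if s: "0 < s" "s \<le> s0" and y: "y \<in> D" for s y
  proof (rule ge)
    fix c assume c: "c \<in> Cs"
    interpret prob_space "gauss_measure s :: (real^'d) measure" by (rule prob_space_gauss_measure[OF s(1)])
    let ?E = "integral\<^sup>L (gauss_measure s)"
    let ?e = "\<lambda>z. increment \<mu> \<sigma> s z"
    have Wm: "(\<lambda>y. W c y) \<in> borel_measurable borel" unfolding W_def by measurable
    have iW: "integrable (gauss_measure s) (\<lambda>z. W c (y + ?e z))"
      by (rule integrable_const_bound[of _ 1]) (use Wb Wm in \<open>auto intro!: measurable_compose[OF _ Wm]\<close>)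
    have i\<Phi>: "integrable (gauss_measure s) (\<lambda>z. \<Phi> (y + ?e z))"
      by (rule integrable_const_bound[of _ 1]) (use \<Phi>b in auto)
    have iX: "integrable (gauss_measure s) (\<lambda>z. exp (- l * (norm ((y - c) + ?e z))\<^sup>2))"
      by (rule integrable_const_bound[of _ 1]) (use l in auto)
    have "?E (\<lambda>z. \<Phi> (y + ?e z)) \<le> ?E (\<lambda>z. W c (y + ?e z))"
      by (rule integral_mono[OF i\<Phi> iW]) (rule le[OF c])
    also have "(\<lambda>z. W c (y + ?e z)) = (\<lambda>z. exp (- l * R\<^sup>2) - exp (- l * (norm ((y - c) + ?e z))\<^sup>2))"
      by (simp add: W_def dist_norm algebra_simps)
    also have "?E \<dots> = exp (- l * R\<^sup>2) - ?E (\<lambda>z. exp (- l * (norm ((y - c) + ?e z))\<^sup>2))"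
      using iX prob_space by simp
    also have "\<dots> \<le> exp (- l * R\<^sup>2) - (exp (- l * (norm (y - c))\<^sup>2) + c0 * s)"
    proof -
      have "R \<le> norm (y - c)" "norm (y - c) \<le> M"
        using infdist_compl_le_exterior_ball(1)[OF D(1) y R, of c] M[OF y c] c by (auto simp: Cs_def dist_norm)
      from step[OF s this] show ?thesis by linarith
    qed
    also have "\<dots> = W c y - c0 * s" by (simp add: W_def dist_norm)
    finally show "?E (\<lambda>z. \<Phi> (y + ?e z)) + c0 * s \<le> W c y" by simp
  qed
  have c1: "c1 > 0" using l R by (simp add: c1_def)
  show thesis
    by (rule that[of L c0 c1 s0 \<Phi>]) (use L0 c0 c1 s0 lip \<Phi>b lower upper drift in auto)
qed

section \<open>From smooth boundary charts to exterior balls of one radius\<close>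

definition grad :: "(real^'d::finite \<Rightarrow> real) \<Rightarrow> real^'d \<Rightarrow> real^'d" where
  "grad g z = (\<chi> i. partial_deriv i g z)"

text \<open>A linear map is determined by its values on the axis vectors, which here are the partial
  derivatives by definition.\<close>

lemma has_derivative_grad:
  fixes g :: "real^'d::finite \<Rightarrow> real"
  assumes "g differentiable (at z)"
  shows "(g has_derivative (\<lambda>v. grad g z \<bullet> v)) (at z)"
proof -
  have d: "(g has_derivative frechet_derivative g (at z)) (at z)"
    using assms by (simp add: frechet_derivative_works)
  interpret linear "frechet_derivative g (at z)"
    using has_derivative_linear[OF d] .
  have "frechet_derivative g (at z) v = grad g z \<bullet> v" for v
  proof -
    have "frechet_derivative g (at z) v = frechet_derivative g (at z) (\<Sum>i\<in>UNIV. v $ i *\<^sub>R axis i 1)"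
      by (simp add: basis_expansion scalar_mult_eq_scaleR[symmetric])
    also have "\<dots> = (\<Sum>i\<in>UNIV. v $ i *\<^sub>R partial_deriv i g z)"
      by (simp add: sum scaleR partial_deriv_def)
    finally show ?thesis by (simp add: grad_def inner_vec_def mult.commute)
  qed
  then have "frechet_derivative g (at z) = (\<lambda>v. grad g z \<bullet> v)" by (rule ext)
  with d show ?thesis by simp
qed

lemma C_k_on_mono: "C_k_on k U g \<Longrightarrow> j \<le> k \<Longrightarrow> C_k_on j U g"
  by (auto simp: C_k_on_def)

text \<open>The second partials are bounded on a compact ball, so the gradient is Lipschitz there,
  and the mean value theorem along a segment gives a quadratic error whose constant K is the same
  for all base points z.\<close>

lemma C_2_on_taylor_upper:
  fixes g :: "real^'d::finite \<Rightarrow> real"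
  assumes C2: "C_k_on 2 (ball z0 r) g" and r: "r > 0"
  obtains K where "K > 0"
    "\<And>z v. dist z0 z \<le> r / 3 \<Longrightarrow> norm v \<le> r / 3 \<Longrightarrow> g (z + v) \<le> g z + grad g z \<bullet> v + K * (norm v)\<^sup>2"
proof -
  \<comment> \<open>r/3 for the base point plus r/3 for v: all segments stay in this compact
    ball.\<close>
  let ?B = "cball z0 (2 * r / 3)"
  have sub: "?B \<subseteq> ball z0 r" using r by auto
  have d0: "g differentiable (at z)" if "z \<in> ball z0 r" for z
  proof -
    have "\<forall>\<beta>. length \<beta> < 2 \<longrightarrow> (\<forall>z\<in>ball z0 r. iter_partial \<beta> g differentiable (at z))"
      using C2 unfolding C_k_on_def by blast
    from this[rule_format, of "[]" z] have "iter_partial [] g differentiable (at z)" using that by simp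
    then show ?thesis by simp
  qed
  have d1: "partial_deriv i g differentiable (at z)" if "z \<in> ball z0 r" for i z
  proof -
    have "\<forall>\<beta>. length \<beta> < 2 \<longrightarrow> (\<forall>z\<in>ball z0 r. iter_partial \<beta> g differentiable (at z))"
      using C2 unfolding C_k_on_def by blast
    from this[rule_format, of "[i]" z] have "iter_partial [i] g differentiable (at z)" using that by simp
    then show ?thesis by simp
  qed
  have c2: "continuous_on ?B (partial_deriv j (partial_deriv i g))" for i j
  proof -
    have "\<forall>\<beta>. length \<beta> \<le> 2 \<longrightarrow> continuous_on (ball z0 r) (iter_partial \<beta> g)"
      using C2 unfolding C_k_on_def by blast
    from this[rule_format, of "[j, i]"] have "continuous_on (ball z0 r) (iter_partial [j, i] g)" by simp
    then show ?thesis using sub by (auto intro: continuous_on_subset)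
  qed
  have "\<exists>H>0. \<forall>z\<in>?B. norm (grad (partial_deriv i g) z) \<le> H" for i
  proof -
    have "continuous_on ?B (grad (partial_deriv i g))"
      unfolding grad_def by (intro continuous_on_vec_lambda c2)
    then have "bounded (grad (partial_deriv i g) ` ?B)"
      by (intro compact_imp_bounded compact_continuous_image) auto
    then show ?thesis unfolding bounded_pos by auto
  qed
  then obtain H where H: "\<And>i. H i > 0" "\<And>i z. z \<in> ?B \<Longrightarrow> norm (grad (partial_deriv i g) z) \<le> H i"
    by metis
  define K where "K = (\<Sum>i\<in>UNIV. H i)"
  have K0: "K > 0" unfolding K_def by (intro sum_pos) (use H in auto)
  have lip: "\<bar>partial_deriv i g a - partial_deriv i g b\<bar> \<le> H i * norm (a - b)" if "a \<in> ?B" "b \<in> ?B" for a b i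
  proof -
    have "norm (partial_deriv i g a - partial_deriv i g b) \<le> H i * norm (a - b)"
    proof (rule differentiable_bound[of ?B])
      fix z assume z: "z \<in> ?B"
      show "(partial_deriv i g has_derivative (\<lambda>v. grad (partial_deriv i g) z \<bullet> v)) (at z within ?B)"
        by (rule has_derivative_at_withinI[OF has_derivative_grad[OF d1[OF subsetD[OF sub z]]]])
      show "onorm (\<lambda>v. grad (partial_deriv i g) z \<bullet> v) \<le> H i"
      proof (rule onorm_le)
        fix v
        have "norm (grad (partial_deriv i g) z \<bullet> v) \<le> norm (grad (partial_deriv i g) z) * norm v"
          using Cauchy_Schwarz_ineq2 by simp
        also have "\<dots> \<le> H i * norm v" by (rule mult_right_mono[OF H(2)[OF z] norm_ge_zero])
        finally show "norm (grad (partial_deriv i g) z \<bullet> v) \<le> H i * norm v" .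
      qed
    qed (use that in auto)
    then show ?thesis by simp
  qed
  show thesis
  proof (rule that[OF K0])
    fix z v :: "real^'d" assume z: "dist z0 z \<le> r / 3" and v: "norm v \<le> r / 3"
    have seg: "z + t *\<^sub>R v \<in> ?B" if "0 \<le> t" "t \<le> 1" for t
    proof -
      have "dist z0 (z + t *\<^sub>R v) \<le> dist z0 z + norm (t *\<^sub>R v)"
        using norm_triangle_ineq4[of "z0 - z" "t *\<^sub>R v"] by (simp add: dist_norm algebra_simps)
      also have "norm (t *\<^sub>R v) \<le> norm v" using that by (simp add: mult_left_le_one_le)
      finally show ?thesis using z v by simp
    qed
    have "\<exists>t>0. t < 1 \<and> g (z + 1 *\<^sub>R v) - g (z + 0 *\<^sub>R v) = (1 - 0) * (grad g (z + t *\<^sub>R v) \<bullet> v)"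
    proof (rule MVT2)
      fix t :: real assume t: "0 \<le> t" "t \<le> 1"
      have "(g has_derivative (\<lambda>w. grad g (z + t *\<^sub>R v) \<bullet> w)) (at (z + t *\<^sub>R v))"
        by (rule has_derivative_grad[OF d0[OF subsetD[OF sub seg[OF t]]]])
      then have "((\<lambda>t. g (z + t *\<^sub>R v)) has_derivative (\<lambda>w. grad g (z + t *\<^sub>R v) \<bullet> (w *\<^sub>R v))) (at t)"
        by (rule has_derivative_compose[rotated]) (auto intro!: derivative_eq_intros)
      then show "((\<lambda>t. g (z + t *\<^sub>R v)) has_real_derivative grad g (z + t *\<^sub>R v) \<bullet> v) (at t)"
        by (simp add: has_field_derivative_def mult_commute_abs)
    qed simp
    then obtain t where t: "0 < t" "t < 1" "g (z + v) - g z = grad g (z + t *\<^sub>R v) \<bullet> v" by auto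
    have *: "(grad g (z + t *\<^sub>R v) - grad g z) \<bullet> v \<le> norm (grad g (z + t *\<^sub>R v) - grad g z) * norm v"
      by (rule norm_cauchy_schwarz)
    have "norm (grad g (z + t *\<^sub>R v) - grad g z) \<le> (\<Sum>i\<in>UNIV. \<bar>(grad g (z + t *\<^sub>R v) - grad g z) $ i\<bar>)"
      by (rule norm_le_l1_cart)
    also have "\<dots> \<le> (\<Sum>i\<in>UNIV. H i * norm v)"
    proof (rule sum_mono)
      fix i
      have "\<bar>partial_deriv i g (z + t *\<^sub>R v) - partial_deriv i g (z + 0 *\<^sub>R v)\<bar> \<le> H i * norm ((z + t *\<^sub>R v) - (z + 0 *\<^sub>R v))"
        by (rule lip) (use seg[of t] seg[of 0] t in auto)
      also have "\<dots> \<le> H i * norm v"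
        using t H(1)[of i] by (intro mult_left_mono) (auto simp: mult_left_le_one_le)
      finally show "\<bar>(grad g (z + t *\<^sub>R v) - grad g z) $ i\<bar> \<le> H i * norm v" by (simp add: grad_def)
    qed
    also have "\<dots> = K * norm v" by (simp add: K_def sum_distrib_right)
    finally have "norm (grad g (z + t *\<^sub>R v) - grad g z) * norm v \<le> K * norm v * norm v"
      by (rule mult_right_mono) simp
    with * have "(grad g (z + t *\<^sub>R v) - grad g z) \<bullet> v \<le> K * (norm v)\<^sup>2"
      by (simp add: power2_eq_square mult.assoc)
    then show "g (z + v) \<le> g z + grad g z \<bullet> v + K * (norm v)\<^sup>2"
      using t(3) by (simp add: inner_diff_left)
  qed
qed

text \<open>A differentiable inverse makes the derivative of \<Psi> injective, hence onto in finite
  dimension, and no coordinate of a surjective linear map is zero.\<close>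

lemma diffeo_component_grad_nonzero:
  fixes \<Psi> :: "real^'d::finite \<Rightarrow> real^'d"
  assumes U: "open U" "z \<in> U" and inj: "inj_on \<Psi> U"
    and d: "\<And>i. (\<lambda>y. \<Psi> y $ i) differentiable (at z)"
    and di: "\<And>i. (\<lambda>y. inv_into U \<Psi> y $ i) differentiable (at (\<Psi> z))"
  shows "grad (\<lambda>y. \<Psi> y $ j) z \<noteq> 0"
proof
  assume 0: "grad (\<lambda>y. \<Psi> y $ j) z = 0"
  have vec: "F differentiable (at a)" if "\<And>i. (\<lambda>y. F y $ i) differentiable (at a)" for F :: "real^'d \<Rightarrow> real^'d" and a
    using that by (subst differentiable_componentwise_within) (auto simp: Basis_vec_eq_range_axis inner_axis)
  obtain A where A: "(\<Psi> has_derivative A) (at z)" using vec[OF d] by (auto simp: differentiable_def)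
  obtain B where B: "(inv_into U \<Psi> has_derivative B) (at (\<Psi> z))" using vec[OF di] by (auto simp: differentiable_def)
  have "((\<lambda>y. inv_into U \<Psi> (\<Psi> y)) has_derivative (\<lambda>v. B (A v))) (at z)"
    by (rule has_derivative_compose[OF A B])
  moreover have "((\<lambda>y. inv_into U \<Psi> (\<Psi> y)) has_derivative (\<lambda>v. v)) (at z)"
    by (rule has_derivative_transform_within_open[OF has_derivative_ident U]) (use inj in auto)
  ultimately have BA: "(\<lambda>v. B (A v)) = (\<lambda>v. v)" by (rule has_derivative_unique)
  have lin: "linear A" using A by (rule has_derivative_linear)
  have "inj A" using BA by (metis injI)
  then have "surj A" using lin by (simp add: linear_inj_imp_surj)
  then obtain w where w: "A w = axis j 1" by (metis surjD)
  have "((\<lambda>y. \<Psi> y $ j) has_derivative (\<lambda>v. A v $ j)) (at z)"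
    using has_derivative_inner_left[OF A, of "axis j 1"] by (simp add: inner_axis)
  with has_derivative_grad[OF d[of j]] have "(\<lambda>v. grad (\<lambda>y. \<Psi> y $ j) z \<bullet> v) = (\<lambda>v. A v $ j)"
    by (rule has_derivative_unique)
  then have "A w $ j = 0" using 0 by (metis inner_zero_left)
  then show False using w by simp
qed

text \<open>Let n be the unit vector at z against the gradient. A point z + v of the ball of radius
  R' touching at z in direction n satisfies |v|^2 < 2 R' v.n, so the Taylor bound gives g <= (2 K R'
  - |grad g z|) v.n <= 0 there, whereas g > 0 in D. All smaller radii are included so that a common
  one can be picked later.\<close>

lemma local_exterior_ball:
  fixes g :: "real^'d::finite \<Rightarrow> real"
  assumes C2: "C_k_on 2 (ball z0 r) g" and r: "r > 0"
    and pos: "\<And>y. y \<in> ball z0 r \<inter> D \<Longrightarrow> g y > 0"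
    and zero: "\<And>y. y \<in> ball z0 r \<inter> frontier D \<Longrightarrow> g y = 0"
    and nz: "grad g z0 \<noteq> 0"
  obtains \<rho> R where "\<rho> > 0" "R > 0"
    "\<And>z R'. z \<in> frontier D \<Longrightarrow> z \<in> ball z0 \<rho> \<Longrightarrow> 0 < R' \<Longrightarrow> R' \<le> R \<Longrightarrow> \<exists>c. dist z c = R' \<and> ball c R' \<inter> D = {}"
proof -
  obtain K where K: "K > 0"
    "\<And>z v. dist z0 z \<le> r / 3 \<Longrightarrow> norm v \<le> r / 3 \<Longrightarrow> g (z + v) \<le> g z + grad g z \<bullet> v + K * (norm v)\<^sup>2"
    using C_2_on_taylor_upper[OF C2 r] by blast
  have cont: "continuous_on (ball z0 r) (grad g)"
  proof -
    have "\<forall>\<beta>. length \<beta> \<le> 2 \<longrightarrow> continuous_on (ball z0 r) (iter_partial \<beta> g)"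
      using C2 unfolding C_k_on_def by blast
    from this[rule_format, of "[_]"] have "continuous_on (ball z0 r) (partial_deriv i g)" for i by simp
    then show ?thesis unfolding grad_def by (intro continuous_on_vec_lambda)
  qed
  \<comment> \<open>Half of the gradient at z0 bounds the gradient from below at all nearby
    z.\<close>
  define m where "m = norm (grad g z0) / 2"
  have m: "m > 0" using nz by (simp add: m_def)
  have "isCont (grad g) z0" using cont r by (simp add: continuous_on_eq_continuous_at)
  then obtain \<rho>0 where \<rho>0: "\<rho>0 > 0" "\<And>z. dist z z0 < \<rho>0 \<Longrightarrow> dist (grad g z) (grad g z0) < m"
    using m unfolding continuous_at_eps_delta by blast
  define \<rho> where "\<rho> = min \<rho>0 (r / 3)"
  \<comment> \<open>Points of the ball are within 2 R' of z, so r / 6 keeps them in the range r / 3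
    of the Taylor bound; m / (2 K) makes the linear term win.\<close>
  define R where "R = min (r / 6) (m / (2 * K))"
  show thesis
  proof (rule that[of \<rho> R])
    show "\<rho> > 0" "R > 0" using \<rho>0 r m K by (auto simp: \<rho>_def R_def)
    fix z R' assume z: "z \<in> frontier D" "z \<in> ball z0 \<rho>" and R': "0 < R'" "R' \<le> R"
    have zd: "dist z0 z < \<rho>" "dist z0 z \<le> r / 3" "z \<in> ball z0 r" using z r by (auto simp: \<rho>_def)
    have "norm (grad g z) \<ge> m"
    proof -
      have "dist (grad g z) (grad g z0) < m" using \<rho>0(2)[of z] zd by (simp add: \<rho>_def dist_commute)
      then have "norm (grad g z0) - norm (grad g z) < m"
        using norm_triangle_ineq2[of "grad g z0" "grad g z"] by (simp add: dist_norm norm_minus_commute)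
      then show ?thesis by (simp add: m_def)
    qed
    then have G: "norm (grad g z) \<ge> m" "norm (grad g z) > 0" using m by auto
    define n where "n = - ((1 / norm (grad g z)) *\<^sub>R grad g z)"
    have n1: "norm n = 1" using G by (simp add: n_def)
    have gn: "grad g z = - (norm (grad g z) *\<^sub>R n)" using G by (simp add: n_def)
    define c where "c = z + R' *\<^sub>R n"
    have "dist z c = R'" using R' n1 by (simp add: c_def dist_norm)
    moreover have "ball c R' \<inter> D = {}"
    proof (rule ccontr)
      assume "ball c R' \<inter> D \<noteq> {}"
      then obtain y where y: "dist c y < R'" "y \<in> D" by auto
      define v where "v = y - z"
      have "norm v \<le> dist z c + dist c y" unfolding v_def using dist_triangle[of z y c] by (simp add: dist_norm norm_minus_commute)
      then have v: "norm v < 2 * R'" using y \<open>dist z c = R'\<close> by simp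
      then have v3: "norm v \<le> r / 3" using R' by (simp add: R_def)
      have "dist z0 y \<le> dist z0 z + dist z y" by (rule dist_triangle)
      also have "dist z y = norm v" by (simp add: v_def dist_norm norm_minus_commute)
      finally have yb: "y \<in> ball z0 r" using zd v3 r by simp
      \<comment> \<open>Membership in the ball, expanded below with |n| = 1.\<close>
      have "(norm (v - R' *\<^sub>R n))\<^sup>2 < R'\<^sup>2"
        using y R' by (intro power_strict_mono) (auto simp: v_def c_def dist_norm norm_minus_commute algebra_simps)
      moreover have "(norm (v - R' *\<^sub>R n))\<^sup>2 = (norm v)\<^sup>2 - 2 * R' * (v \<bullet> n) + R'\<^sup>2"
        using n1 by (simp add: power2_norm_eq_inner inner_diff_left inner_diff_right inner_commute norm_eq_1)
          (simp add: power2_eq_square)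
      ultimately have vn: "(norm v)\<^sup>2 < 2 * R' * (v \<bullet> n)" by simp
      then have "0 < 2 * R' * (v \<bullet> n)" by (rule le_less_trans[OF zero_le_power2])
      then have vn0: "v \<bullet> n > 0" using R' by (simp add: zero_less_mult_iff)
      have "g y \<le> g z + grad g z \<bullet> v + K * (norm v)\<^sup>2"
        using K(2)[OF zd(2) v3] by (simp add: v_def)
      also have "g z = 0" using zero z zd by blast
      also have "grad g z \<bullet> v = - (norm (grad g z) * (v \<bullet> n))"
        by (subst gn) (simp add: inner_commute)
      also have "K * (norm v)\<^sup>2 \<le> K * (2 * R' * (v \<bullet> n))" using vn K by simp
      also have "K * (2 * R' * (v \<bullet> n)) = (2 * K * R') * (v \<bullet> n)" by simp
      also have "\<dots> \<le> m * (v \<bullet> n)"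
      proof (rule mult_right_mono)
        have "R' \<le> m / (2 * K)" using R' by (simp add: R_def)
        then show "2 * K * R' \<le> m" using K by (simp add: field_simps)
      qed (use vn0 in simp)
      also have "m * (v \<bullet> n) \<le> norm (grad g z) * (v \<bullet> n)"
        using G vn0 by (intro mult_right_mono) auto
      finally have "g y \<le> 0" by simp
      moreover have "g y > 0" using pos y yb by blast
      ultimately show False by simp
    qed
    ultimately show "\<exists>c. dist z c = R' \<and> ball c R' \<inter> D = {}" by blast
  qed
qed

text \<open>The local radii belong to the points of a finite subcover of the compact frontier; the
  least of them works everywhere because each local statement holds for all smaller radii.\<close>

lemma C_k_alpha_bounded_domain_exterior_ball:
  fixes D :: "(real^'d::finite) set"
  assumes dom: "C_k_alpha_bounded_domain k \<alpha> D" and k: "k \<ge> 2"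
  obtains R where "R > 0" "\<And>z. z \<in> frontier D \<Longrightarrow> \<exists>c. dist z c = R \<and> ball c R \<inter> D = {}"
proof -
  have D: "open D" "bounded D" using dom by (auto simp: C_k_alpha_bounded_domain_def)
  have "\<exists>\<rho> R. \<rho> > 0 \<and> R > 0 \<and> (\<forall>z R'. z \<in> frontier D \<longrightarrow> z \<in> ball z0 \<rho> \<longrightarrow> 0 < R' \<longrightarrow> R' \<le> R \<longrightarrow>
       (\<exists>c. dist z c = R' \<and> ball c R' \<inter> D = {}))" if z0: "z0 \<in> frontier D" for z0
  proof -
    obtain r and \<Psi> :: "real^'d \<Rightarrow> real^'d" and j where r: "r > 0" and inj: "inj_on \<Psi> (ball z0 r)"
      and pos: "\<Psi> ` (ball z0 r \<inter> D) \<subseteq> {y. y $ j > 0}"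
      and zero: "\<Psi> ` (ball z0 r \<inter> frontier D) \<subseteq> {y. y $ j = 0}"
      and C': "\<forall>i. C_k_alpha_on k \<alpha> (ball z0 r) (\<lambda>y. \<Psi> y $ i)"
      and Ci': "\<forall>i. C_k_alpha_on k \<alpha> (\<Psi> ` ball z0 r) (\<lambda>y. inv_into (ball z0 r) \<Psi> y $ i)"
      using bspec[OF dom[unfolded C_k_alpha_bounded_domain_def, THEN conjunct2, THEN conjunct2, THEN conjunct2, THEN conjunct2] z0]
      by (elim exE conjE) (rule that, assumption+)
    note C = C'[rule_format] and Ci = Ci'[rule_format]
    have d: "F differentiable (at z)" if "C_k_alpha_on k \<alpha> U F" "z \<in> U" for F :: "real^'d \<Rightarrow> real" and U z
    proof -
      have "\<forall>\<beta>. length \<beta> < k \<longrightarrow> (\<forall>z\<in>U. iter_partial \<beta> F differentiable (at z))"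
        using that(1) unfolding C_k_alpha_on_def C_k_on_def by blast
      from this[rule_format, of "[]" z] show ?thesis using that(2) k by simp
    qed
    have nz: "grad (\<lambda>y. \<Psi> y $ j) z0 \<noteq> 0"
      by (rule diffeo_component_grad_nonzero[of "ball z0 r"]) (use r inj d[OF C] d[OF Ci] in auto)
    have C2: "C_k_on 2 (ball z0 r) (\<lambda>y. \<Psi> y $ j)"
      using C[of j] k by (auto simp: C_k_alpha_on_def intro: C_k_on_mono)
    have pos': "\<Psi> y $ j > 0" if "y \<in> ball z0 r \<inter> D" for y using pos that by blast
    have zero': "\<Psi> y $ j = 0" if "y \<in> ball z0 r \<inter> frontier D" for y using zero that by blast
    show ?thesis
      by (rule local_exterior_ball[OF C2 r pos' zero' nz]) blast+
  qed
  then obtain \<rho> R where \<rho>R: "\<And>z0. z0 \<in> frontier D \<Longrightarrow> \<rho> z0 > 0 \<and> R z0 > 0 \<and>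
      (\<forall>z R'. z \<in> frontier D \<longrightarrow> z \<in> ball z0 (\<rho> z0) \<longrightarrow> 0 < R' \<longrightarrow> R' \<le> R z0 \<longrightarrow>
       (\<exists>c. dist z c = R' \<and> ball c R' \<inter> D = {}))"
    by metis
  have "compact (frontier D)" using D by (rule_tac compact_frontier_bounded)
  then obtain T where T: "T \<subseteq> frontier D" "finite T" "frontier D \<subseteq> (\<Union>z\<in>T. ball z (\<rho> z))"
    by (rule compactE_image[of _ "frontier D" "\<lambda>z. ball z (\<rho> z)"]) (use \<rho>R in force)+
  \<comment> \<open>The extra element 1 keeps \<open>Min\<close> meaningful should T be
    empty.\<close>
  define R0 where "R0 = Min (insert 1 (R ` T))"
  have R0: "R0 > 0" "\<And>z. z \<in> T \<Longrightarrow> R0 \<le> R z"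
    unfolding R0_def using T \<rho>R by (auto simp: subset_iff)
  show thesis
  proof (rule that[OF R0(1)])
    fix z assume z: "z \<in> frontier D"
    then obtain z0 where z0: "z0 \<in> T" "z \<in> ball z0 (\<rho> z0)" using T by auto
    then show "\<exists>c. dist z c = R0 \<and> ball c R0 \<inter> D = {}"
      using \<rho>R[of z0] T R0 z by blast
  qed
qed

section \<open>Freezing and Markov steps\<close>

text \<open>Independence says that the joint law of \<omega>, seen through F, and \<xi> is a
  product; comparing on rectangles suffices, and Tonelli then applies in both orders. The first form
  serves for a Markov step, the second for fixing the random horizon.\<close>

lemma (in prob_space) nn_integral_freeze:
  assumes sub: "subalgebra M F" and \<xi>[measurable]: "\<xi> \<in> M \<rightarrow>\<^sub>M N"
    and ind: "\<And>A B. A \<in> sets F \<Longrightarrow> B \<in> sets N \<Longrightarrow>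
      prob (A \<inter> (\<xi> -` B \<inter> space M)) = prob A * prob (\<xi> -` B \<inter> space M)"
    and H[measurable]: "H \<in> borel_measurable (F \<Otimes>\<^sub>M N)"
  shows "(\<integral>\<^sup>+\<omega>. H (\<omega>, \<xi> \<omega>) \<partial>M) = (\<integral>\<^sup>+\<omega>. (\<integral>\<^sup>+z. H (\<omega>, z) \<partial>distr M N \<xi>) \<partial>M)"
    and "(\<integral>\<^sup>+\<omega>. H (\<omega>, \<xi> \<omega>) \<partial>M) = (\<integral>\<^sup>+z. (\<integral>\<^sup>+\<omega>. H (\<omega>, z) \<partial>M) \<partial>distr M N \<xi>)"
proof -
  let ?F = "restr_to_subalg M F" and ?N = "distr M N \<xi>"
  have spF: "space F = space M" using sub by (simp add: subalgebra_def)
  have setsF: "sets ?F = sets F" by (rule sets_restr_to_subalg[OF sub])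
  have spF': "space ?F = space M" by (simp add: space_restr_to_subalg)
  have inM: "A \<in> sets M" if "A \<in> sets F" for A using sub that by (auto simp: subalgebra_def)
  have pF: "prob_space ?F"
    by (rule prob_spaceI) (use emeasure_space_1 in \<open>simp add: spF' emeasure_restr_to_subalg[OF sub] spF[symmetric] sets.top\<close>)
  have pN: "prob_space ?N" by (rule prob_space_distr) simp
  interpret F: prob_space ?F by (rule pF)
  interpret N: prob_space ?N by (rule pN)
  interpret P: pair_prob_space ?F ?N ..
  have id: "(\<lambda>\<omega>. \<omega>) \<in> M \<rightarrow>\<^sub>M F"
    using sub by (intro measurableI) (auto simp: subalgebra_def spF Int_absorb2 dest: sets.sets_into_space)
  have pm: "(\<lambda>\<omega>. (\<omega>, \<xi> \<omega>)) \<in> M \<rightarrow>\<^sub>M F \<Otimes>\<^sub>M N"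
    using id by (intro measurable_Pair) auto
  have eq: "?F \<Otimes>\<^sub>M ?N = distr M (F \<Otimes>\<^sub>M N) (\<lambda>\<omega>. (\<omega>, \<xi> \<omega>))"
  proof (rule pair_measure_eqI)
    show "sigma_finite_measure ?F" "sigma_finite_measure ?N" ..
    show "sets (?F \<Otimes>\<^sub>M ?N) = sets (distr M (F \<Otimes>\<^sub>M N) (\<lambda>\<omega>. (\<omega>, \<xi> \<omega>)))"
      by (simp add: setsF cong: sets_pair_measure_cong)
    fix A B assume A: "A \<in> sets ?F" and B: "B \<in> sets ?N"
    then have A': "A \<in> sets F" "A \<in> sets M" and B': "B \<in> sets N" using setsF inM by auto
    have "emeasure ?F A * emeasure ?N B = emeasure M A * emeasure M (\<xi> -` B \<inter> space M)"
      using A' B' by (simp add: emeasure_restr_to_subalg[OF sub] emeasure_distr)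
    also have "\<dots> = emeasure M (A \<inter> (\<xi> -` B \<inter> space M))"
      using ind[OF A'(1) B'] by (simp add: emeasure_eq_measure ennreal_mult)
    also have "A \<inter> (\<xi> -` B \<inter> space M) = (\<lambda>\<omega>. (\<omega>, \<xi> \<omega>)) -` (A \<times> B) \<inter> space M"
      by auto
    also have "emeasure M \<dots> = emeasure (distr M (F \<Otimes>\<^sub>M N) (\<lambda>\<omega>. (\<omega>, \<xi> \<omega>))) (A \<times> B)"
      using A' B' pm by (simp add: emeasure_distr)
    finally show "emeasure ?F A * emeasure ?N B = emeasure (distr M (F \<Otimes>\<^sub>M N) (\<lambda>\<omega>. (\<omega>, \<xi> \<omega>))) (A \<times> B)" .
  qed
  have sets_eq: "sets (?F \<Otimes>\<^sub>M ?N) = sets (F \<Otimes>\<^sub>M N)"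
    by (rule sets_pair_measure_cong) (simp_all add: setsF)
  have Hm: "H \<in> borel_measurable (?F \<Otimes>\<^sub>M ?N)"
    using H unfolding measurable_cong_sets[OF sets_eq refl] .
  have 0: "(\<integral>\<^sup>+\<omega>. H (\<omega>, \<xi> \<omega>) \<partial>M) = (\<integral>\<^sup>+p. H p \<partial>(?F \<Otimes>\<^sub>M ?N))"
    unfolding eq by (simp add: nn_integral_distr[OF pm])
  have m1: "(\<lambda>\<omega>. \<integral>\<^sup>+z. H (\<omega>, z) \<partial>?N) \<in> borel_measurable F"
    by measurable
  have "(\<integral>\<^sup>+p. H p \<partial>(?F \<Otimes>\<^sub>M ?N)) = (\<integral>\<^sup>+\<omega>. (\<integral>\<^sup>+z. H (\<omega>, z) \<partial>?N) \<partial>?F)"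
    using N.nn_integral_fst[OF Hm] by simp
  also have "\<dots> = (\<integral>\<^sup>+\<omega>. (\<integral>\<^sup>+z. H (\<omega>, z) \<partial>?N) \<partial>M)"
    by (rule nn_integral_subalgebra2[OF sub m1])
  finally show "(\<integral>\<^sup>+\<omega>. H (\<omega>, \<xi> \<omega>) \<partial>M) = (\<integral>\<^sup>+\<omega>. (\<integral>\<^sup>+z. H (\<omega>, z) \<partial>?N) \<partial>M)" using 0 by simp
  have "(\<integral>\<^sup>+p. H p \<partial>(?F \<Otimes>\<^sub>M ?N)) = (\<integral>\<^sup>+z. (\<integral>\<^sup>+\<omega>. H (\<omega>, z) \<partial>?F) \<partial>?N)"
    using P.nn_integral_snd[OF Hm] by simp
  also have "\<dots> = (\<integral>\<^sup>+z. (\<integral>\<^sup>+\<omega>. H (\<omega>, z) \<partial>M) \<partial>?N)"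
  proof (rule nn_integral_cong)
    fix z assume "z \<in> space ?N"
    then have "(\<lambda>\<omega>. H (\<omega>, z)) \<in> borel_measurable F" by simp
    then show "(\<integral>\<^sup>+\<omega>. H (\<omega>, z) \<partial>?F) = (\<integral>\<^sup>+\<omega>. H (\<omega>, z) \<partial>M)"
      by (rule nn_integral_subalgebra2[OF sub])
  qed
  finally show "(\<integral>\<^sup>+\<omega>. H (\<omega>, \<xi> \<omega>) \<partial>M) = (\<integral>\<^sup>+z. (\<integral>\<^sup>+\<omega>. H (\<omega>, z) \<partial>M) \<partial>?N)" using 0 by simp
qed

text \<open>The history of W at the times \<open>\<tau> 0\<close>, ..., \<open>\<tau> j\<close>. It
  is generated by one finite tuple, so each of its events is the preimage of a single set in a
  finite product.\<close>

definition past_algebra :: "'a measure \<Rightarrow> (real \<Rightarrow> 'a \<Rightarrow> 'b::euclidean_space) \<Rightarrow> (nat \<Rightarrow> real) \<Rightarrow> nat \<Rightarrow> 'a measure" where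
  "past_algebra M W \<tau> j = vimage_algebra (space M) (\<lambda>\<omega>. \<lambda>l\<in>{..j}. W (\<tau> l) \<omega>) (\<Pi>\<^sub>M l\<in>{..j}. borel)"

lemma space_past_algebra [simp]: "space (past_algebra M W \<tau> j) = space M"
  by (simp add: past_algebra_def)

lemma past_algebra_tuple:
  "j \<le> k \<Longrightarrow> (\<lambda>\<omega>. \<lambda>l\<in>{..j}. W (\<tau> l) \<omega>) \<in> past_algebra M W \<tau> k \<rightarrow>\<^sub>M (\<Pi>\<^sub>M l\<in>{..j}. borel)"
proof -
  assume "j \<le> k"
  have "(\<lambda>\<omega>. \<lambda>l\<in>{..k}. W (\<tau> l) \<omega>) \<in> past_algebra M W \<tau> k \<rightarrow>\<^sub>M (\<Pi>\<^sub>M l\<in>{..k}. borel)"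
    unfolding past_algebra_def by (rule measurable_vimage_algebra1) (auto simp: space_PiM)
  from measurable_compose[OF this measurable_restrict_subset[of "{..j}" "{..k}"]] \<open>j \<le> k\<close>
  have "(\<lambda>\<omega>. restrict (\<lambda>l\<in>{..k}. W (\<tau> l) \<omega>) {..j}) \<in> past_algebra M W \<tau> k \<rightarrow>\<^sub>M (\<Pi>\<^sub>M l\<in>{..j}. borel)"
    by auto
  moreover have "restrict (\<lambda>l\<in>{..k}. W (\<tau> l) \<omega>) {..j} = (\<lambda>l\<in>{..j}. W (\<tau> l) \<omega>)" for \<omega>
    using \<open>j \<le> k\<close> by (auto simp: restrict_def)
  ultimately show ?thesis by simp
qed

lemma past_algebra_measurable:
  assumes "l \<le> j"
  shows "W (\<tau> l) \<in> borel_measurable (past_algebra M W \<tau> j)"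
proof -
  have "(\<lambda>\<omega>. (\<lambda>l\<in>{..j}. W (\<tau> l) \<omega>) l) \<in> borel_measurable (past_algebra M W \<tau> j)"
    by (rule measurable_compose[OF past_algebra_tuple[OF order_refl] measurable_component_singleton])
      (use assms in simp)
  then show ?thesis using assms by simp
qed

lemma sets_past_algebra:
  "sets (past_algebra M W \<tau> j) = {(\<lambda>\<omega>. \<lambda>l\<in>{..j}. W (\<tau> l) \<omega>) -` A \<inter> space M | A. A \<in> sets (\<Pi>\<^sub>M l\<in>{..j}. borel)}"
  unfolding past_algebra_def by (rule sets_vimage_algebra2) (auto simp: space_PiM)

lemma past_algebra_mono:
  assumes "j \<le> k" shows "sets (past_algebra M W \<tau> j) \<subseteq> sets (past_algebra M W \<tau> k)"
  using measurable_sets[OF past_algebra_tuple[OF assms, of W \<tau> M]] by (auto simp: sets_past_algebra[of M W \<tau> j])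

lemma subalgebra_past_algebra:
  assumes "\<And>l. l \<le> j \<Longrightarrow> W (\<tau> l) \<in> borel_measurable M"
  shows "subalgebra M (past_algebra M W \<tau> j)"
proof -
  have "(\<lambda>\<omega>. \<lambda>l\<in>{..j}. W (\<tau> l) \<omega>) \<in> M \<rightarrow>\<^sub>M (\<Pi>\<^sub>M l\<in>{..j}. borel)"
    by (rule measurable_restrict) (use assms in auto)
  from measurable_sets[OF this] show ?thesis
    by (auto simp: subalgebra_def sets_past_algebra)
qed

text \<open>As W starts at 0, its values at the sample times are partial sums of increments, and
  these increments are jointly independent of the one from \<open>\<tau> j\<close> to b.\<close>

lemma (in prob_space) indep_increments_past:
  fixes W :: "real \<Rightarrow> 'a \<Rightarrow> 'b::euclidean_space"
  assumes inc: "indep_increments M W" and W0: "\<And>\<omega>. \<omega> \<in> space M \<Longrightarrow> W 0 \<omega> = 0"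
    and \<tau>: "mono \<tau>" "0 \<le> \<tau> 0" and b: "\<tau> j \<le> b"
    and A: "A \<in> sets (past_algebra M W \<tau> j)" and B: "B \<in> sets borel"
  shows "prob (A \<inter> ((\<lambda>\<omega>. W b \<omega> - W (\<tau> j) \<omega>) -` B \<inter> space M)) =
    prob A * prob ((\<lambda>\<omega>. W b \<omega> - W (\<tau> j) \<omega>) -` B \<inter> space M)"
proof -
  \<comment> \<open>The times 0, \<open>\<tau> 0\<close>, ..., \<open>\<tau> j\<close>, b: with 0
    put in front the increment of index i ends at \<open>\<tau> i\<close> for i <= j, and index j +
    1 is the step from \<open>\<tau> j\<close> to b.\<close>
  define \<rho> where "\<rho> i = (if i = 0 then 0 else if i \<le> Suc j then \<tau> (i - 1) else b)" for i
  define Y where "Y i \<omega> = W (\<rho> (Suc i)) \<omega> - W (\<rho> i) \<omega>" for i \<omega>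
  have "\<rho> i \<le> \<rho> (Suc i)" for i
    using \<tau> b by (auto simp: \<rho>_def mono_def intro: order_trans[of 0 "\<tau> 0"] order_trans[of "\<tau> _" "\<tau> j" b])
  moreover have "0 \<le> \<rho> 0" by (simp add: \<rho>_def)
  ultimately have "indep_vars (\<lambda>_. borel) Y {..<j + 2}"
    using inc unfolding indep_increments_def Y_def[abs_def] by blast
  then have iv: "indep_var (PiM {..j} (\<lambda>_. borel)) (\<lambda>\<omega>. restrict (\<lambda>i. Y i \<omega>) {..j})
      (PiM {Suc j} (\<lambda>_. borel)) (\<lambda>\<omega>. restrict (\<lambda>i. Y i \<omega>) {Suc j})"
    by (rule indep_var_restrict) auto
  let ?Y1 = "\<lambda>y. \<lambda>l\<in>{..j}. \<Sum>i\<le>l. y i :: 'b" and ?Y2 = "\<lambda>y::nat \<Rightarrow> 'b. y"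
  have Y1: "?Y1 \<in> PiM {..j} (\<lambda>_. borel) \<rightarrow>\<^sub>M PiM {..j} (\<lambda>_. borel)"
    by (intro measurable_restrict borel_measurable_sum measurable_component_singleton) auto
  have Y2: "?Y2 \<in> PiM {Suc j} (\<lambda>_. borel) \<rightarrow>\<^sub>M PiM {Suc j} (\<lambda>_. borel)"
    by simp
  define B' where "B' = (\<lambda>y. y (Suc j)) -` B \<inter> space (PiM {Suc j} (\<lambda>_. borel :: 'b measure))"
  have B': "B' \<in> sets (PiM {Suc j} (\<lambda>_. borel))"
  proof -
    have "(\<lambda>y. y (Suc j)) \<in> borel_measurable (PiM {Suc j} (\<lambda>_. borel :: 'b measure))"
      by (rule measurable_component_singleton) simp
    from measurable_sets[OF this B] show ?thesis unfolding B'_def .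
  qed
  note iv2 = indep_var_compose[OF iv Y1 Y2]
  obtain S where S: "S \<in> sets (PiM {..j} (\<lambda>_. borel))" "A = (\<lambda>\<omega>. \<lambda>l\<in>{..j}. W (\<tau> l) \<omega>) -` S \<inter> space M"
    using A by (auto simp: sets_past_algebra)
  have sumY: "(\<Sum>i\<le>l. Y i \<omega>) = W (\<tau> l) \<omega>" if "l \<le> j" "\<omega> \<in> space M" for l \<omega>
  proof -
    have "(\<Sum>i<Suc l. Y i \<omega>) = W (\<rho> (Suc l)) \<omega> - W (\<rho> 0) \<omega>"
      unfolding Y_def by (rule sum_lessThan_telescope)
    then show ?thesis using that W0 by (simp add: \<rho>_def lessThan_Suc_atMost)
  qed
  have e1: "(?Y1 \<circ> (\<lambda>\<omega>. restrict (\<lambda>i. Y i \<omega>) {..j})) \<omega> = (\<lambda>l\<in>{..j}. W (\<tau> l) \<omega>)" if "\<omega> \<in> space M" for \<omega>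
    using sumY[OF _ that] by (auto simp: restrict_def intro!: ext)
  have e2: "(?Y2 \<circ> (\<lambda>\<omega>. restrict (\<lambda>i. Y i \<omega>) {Suc j})) \<omega> \<in> B' \<longleftrightarrow> W b \<omega> - W (\<tau> j) \<omega> \<in> B" for \<omega>
    by (simp add: Y_def \<rho>_def B'_def space_PiM)
  let ?f = "?Y1 \<circ> (\<lambda>\<omega>. restrict (\<lambda>i. Y i \<omega>) {..j})" and ?g = "?Y2 \<circ> (\<lambda>\<omega>. restrict (\<lambda>i. Y i \<omega>) {Suc j})"
  have "prob ((\<lambda>\<omega>. (?f \<omega>, ?g \<omega>)) -` (S \<times> B') \<inter> space M) = prob (?f -` S \<inter> space M) * prob (?g -` B' \<inter> space M)"
    by (rule indep_varD[OF iv2 S(1) B'])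
  moreover have "(\<lambda>\<omega>. (?f \<omega>, ?g \<omega>)) -` (S \<times> B') \<inter> space M = A \<inter> ((\<lambda>\<omega>. W b \<omega> - W (\<tau> j) \<omega>) -` B \<inter> space M)"
    unfolding S(2) using e1 e2 by auto
  moreover have "?f -` S \<inter> space M = A"
    unfolding S(2) using e1 by auto
  moreover have "?g -` B' \<inter> space M = (\<lambda>\<omega>. W b \<omega> - W (\<tau> j) \<omega>) -` B \<inter> space M"
    using e2 by auto
  ultimately show ?thesis by simp
qed

section \<open>Discretely killed walks near the boundary\<close>

text \<open>What the argument needs of the barrier, with U = 1_D (\<Phi> + \<rho>) in mind:
  \<open>U_step\<close> is the supermartingale inequality for one step started in D, and \<kappa>
  bounds the mean length of a step.\<close>

locale barrier_walk = prob_space M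
  for M :: "'a measure" +
  fixes W :: "real \<Rightarrow> 'a \<Rightarrow> real^'d::finite" and \<mu> :: "real^'d" and \<sigma> :: "real^'d^'d"
    and D :: "(real^'d) set" and U :: "real^'d \<Rightarrow> real" and x :: "real^'d"
    and h L \<rho> \<kappa> :: real
  assumes bm: "standard_brownian_motion M W"
    and D: "open D"
    and U_measurable [measurable]: "U \<in> borel_measurable borel"
    and U_step: "\<And>s y. 0 < s \<Longrightarrow> s \<le> h \<Longrightarrow> y \<in> D \<Longrightarrow>
      (\<integral>\<^sup>+z. ennreal (U (y + increment \<mu> \<sigma> s z)) \<partial>gauss_measure s) \<le> ennreal (U y)"
    and U_le: "\<And>y. U y \<le> L * infdist y (- D) + \<rho>"
    and first_moment: "\<And>s. 0 < s \<Longrightarrow> s \<le> h \<Longrightarrow>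
      (\<integral>\<^sup>+z. ennreal (norm (increment \<mu> \<sigma> s z)) \<partial>gauss_measure s) \<le> ennreal \<kappa>"
    and h: "h > 0" and L: "L \<ge> 0" and \<rho>: "\<rho> \<ge> 0" and \<kappa>: "\<kappa> \<ge> 0"
begin

definition X :: "real \<Rightarrow> 'a \<Rightarrow> real^'d" where
  "X s \<omega> = diffusion \<mu> \<sigma> x (\<lambda>s. W s \<omega>) s"

lemma W_measurable [measurable]: "0 \<le> s \<Longrightarrow> W s \<in> borel_measurable M"
  using bm by (auto simp: standard_brownian_motion_def)

lemma X_eq: "X s \<omega> = x + s *\<^sub>R \<mu> + \<sigma> *v W s \<omega>"
  by (simp add: X_def diffusion_def)

lemma X_measurable: "0 \<le> s \<Longrightarrow> X s \<in> borel_measurable M"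
  unfolding X_eq[abs_def] by measurable

lemma X_increment: "X b \<omega> = X a \<omega> + increment \<mu> \<sigma> (b - a) (W b \<omega> - W a \<omega>)"
  by (simp add: X_eq increment_def matrix_vector_mult_diff_distrib scaleR_diff_left)

lemma X_continuous: "\<omega> \<in> space M \<Longrightarrow> continuous_on {0..} (\<lambda>s. X s \<omega>)"
proof -
  assume "\<omega> \<in> space M"
  then have "continuous_on {0..} (\<lambda>s. W s \<omega>)" using bm by (auto simp: standard_brownian_motion_def)
  then have "continuous_on {0..} (\<lambda>s. \<sigma> *v W s \<omega>)"
    by (rule linear_continuous_on_compose) (rule matrix_vector_mul_linear)
  then show ?thesis unfolding X_eq by (intro continuous_intros)
qed

lemma distr_W_increment:
  assumes "0 \<le> a" "a < b"
  shows "distr M borel (\<lambda>\<omega>. W b \<omega> - W a \<omega>) = gauss_measure (b - a)"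
proof -
  have "distributed M lborel (\<lambda>\<omega>. W b \<omega> - W a \<omega>)
          (\<lambda>y. ennreal (\<Prod>i\<in>UNIV. normal_density 0 (sqrt (b - a)) (y $ i)))"
    using bm assms by (auto simp: standard_brownian_motion_def)
  then have "distr M lborel (\<lambda>\<omega>. W b \<omega> - W a \<omega>) = gauss_measure (b - a)"
    unfolding gauss_measure_def by (rule distributed_distr_eq_density)
  moreover have "distr M borel (\<lambda>\<omega>. W b \<omega> - W a \<omega>) = distr M lborel (\<lambda>\<omega>. W b \<omega> - W a \<omega>)"
    by (rule distr_cong) auto
  ultimately show ?thesis by simp
qed

section \<open>Markov steps along a deterministic sequence of times\<close>

context
  fixes \<tau> :: "nat \<Rightarrow> real"
  assumes \<tau>: "mono \<tau>" "0 \<le> \<tau> 0"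
begin

abbreviation past :: "nat \<Rightarrow> 'a measure" where
  "past j \<equiv> past_algebra M W \<tau> j"

lemma \<tau>_nonneg: "0 \<le> \<tau> j"
  using \<tau> by (metis monoD order_trans zero_le)

lemma subalgebra_past: "subalgebra M (past j)"
  by (rule subalgebra_past_algebra) (simp add: \<tau>_nonneg)

lemma past_sets: "A \<in> sets (past j) \<Longrightarrow> A \<in> sets M"
  using subalgebra_past[of j] by (auto simp: subalgebra_def)

lemma X_past [measurable]: "l \<le> j \<Longrightarrow> X (\<tau> l) \<in> borel_measurable (past j)"
proof -
  assume "l \<le> j"
  then have [measurable]: "W (\<tau> l) \<in> borel_measurable (past j)"
    by (rule past_algebra_measurable)
  show ?thesis unfolding X_eq[abs_def] by measurable
qed

text \<open>The Markov property at \<open>\<tau> j\<close> as an instance of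
  \<open>nn_integral_freeze\<close>: the later increment is integrated out while the history is held
  fixed.\<close>

lemma freeze_increment:
  assumes b: "\<tau> j < b" and A[measurable]: "A \<in> sets (past j)"
    and G[measurable]: "G \<in> borel_measurable (borel \<Otimes>\<^sub>M borel)"
  shows "(\<integral>\<^sup>+\<omega>. indicator A \<omega> * G (X (\<tau> j) \<omega>, W b \<omega> - W (\<tau> j) \<omega>) \<partial>M) =
    (\<integral>\<^sup>+\<omega>. indicator A \<omega> * (\<integral>\<^sup>+z. G (X (\<tau> j) \<omega>, z) \<partial>gauss_measure (b - \<tau> j)) \<partial>M)"
proof -
  let ?\<xi> = "\<lambda>\<omega>. W b \<omega> - W (\<tau> j) \<omega>"
  let ?H = "\<lambda>p. indicator A (fst p) * G (X (\<tau> j) (fst p), snd p)"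
  have b0: "0 \<le> b" using b \<tau>_nonneg[of j] by simp
  have m1: "?\<xi> \<in> borel_measurable M" using b0 \<tau>_nonneg[of j] by measurable
  have W0: "\<omega> \<in> space M \<Longrightarrow> W 0 \<omega> = 0" for \<omega> using bm by (auto simp: standard_brownian_motion_def)
  have inc: "indep_increments M W" using bm by (simp add: standard_brownian_motion_def)
  have ind: "prob (A \<inter> (?\<xi> -` B \<inter> space M)) = prob A * prob (?\<xi> -` B \<inter> space M)"
    if "A \<in> sets (past j)" "B \<in> sets borel" for A B
    by (rule indep_increments_past[OF inc W0 \<tau>]) (use b that in auto)
  have [measurable]: "(\<lambda>p. X (\<tau> j) (fst p)) \<in> borel_measurable (past j \<Otimes>\<^sub>M borel)"
    by (rule measurable_compose[OF measurable_fst X_past]) simp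
  have m2: "?H \<in> borel_measurable (past j \<Otimes>\<^sub>M borel)"
    by measurable
  have "(\<integral>\<^sup>+\<omega>. ?H (\<omega>, ?\<xi> \<omega>) \<partial>M) = (\<integral>\<^sup>+\<omega>. (\<integral>\<^sup>+z. ?H (\<omega>, z) \<partial>distr M borel ?\<xi>) \<partial>M)"
    by (rule nn_integral_freeze(1)[OF subalgebra_past m1 ind m2])
  also have "\<dots> = (\<integral>\<^sup>+\<omega>. indicator A \<omega> * (\<integral>\<^sup>+z. G (X (\<tau> j) \<omega>, z) \<partial>gauss_measure (b - \<tau> j)) \<partial>M)"
    unfolding distr_W_increment[OF \<tau>_nonneg b]
    by (intro nn_integral_cong) (simp add: nn_integral_cmult)
  finally show ?thesis by simp
qed

text \<open>The supermartingale inequality localized to an event A of the past; mass outside D at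
  \<open>\<tau> j\<close> is discarded on the left. Equal times are split off, because
  \<open>gauss_measure 0\<close> is not a point mass.\<close>

lemma one_step:
  assumes jk: "j \<le> k" and step: "\<tau> k - \<tau> j \<le> h" and A: "A \<in> sets (past j)"
  shows "(\<integral>\<^sup>+\<omega>. indicator (A \<inter> {\<omega>\<in>space M. X (\<tau> j) \<omega> \<in> D}) \<omega> * ennreal (U (X (\<tau> k) \<omega>)) \<partial>M)
    \<le> (\<integral>\<^sup>+\<omega>. indicator A \<omega> * ennreal (U (X (\<tau> j) \<omega>)) \<partial>M)"
proof (cases "\<tau> j = \<tau> k")
  case True
  then show ?thesis by (intro nn_integral_mono) (auto simp: indicator_def)
next
  case False
  then have lt: "\<tau> j < \<tau> k" using monoD[OF \<tau>(1) jk] by simp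
  let ?A = "A \<inter> {\<omega>\<in>space M. X (\<tau> j) \<omega> \<in> D}"
  have [measurable]: "D \<in> sets borel" using D by simp
  have "{\<omega>\<in>space (past j). X (\<tau> j) \<omega> \<in> D} \<in> sets (past j)" by measurable
  then have A': "?A \<in> sets (past j)" using A by simp
  have G: "(\<lambda>p. ennreal (U (fst p + increment \<mu> \<sigma> (\<tau> k - \<tau> j) (snd p)))) \<in> borel_measurable (borel \<Otimes>\<^sub>M borel)"
    by measurable
  have "(\<integral>\<^sup>+\<omega>. indicator ?A \<omega> * ennreal (U (X (\<tau> k) \<omega>)) \<partial>M) =
    (\<integral>\<^sup>+\<omega>. indicator ?A \<omega> * (\<integral>\<^sup>+z. ennreal (U (X (\<tau> j) \<omega> + increment \<mu> \<sigma> (\<tau> k - \<tau> j) z)) \<partial>gauss_measure (\<tau> k - \<tau> j)) \<partial>M)"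
    using freeze_increment[OF lt A' G] by (simp add: X_increment[of "\<tau> k" _ "\<tau> j"])
  also have "\<dots> \<le> (\<integral>\<^sup>+\<omega>. indicator A \<omega> * ennreal (U (X (\<tau> j) \<omega>)) \<partial>M)"
    by (intro nn_integral_mono) (use lt step in \<open>auto simp: indicator_def intro!: U_step\<close>)
  finally show ?thesis .
qed

text \<open>The distance to the complement is 1-Lipschitz, so it grows in mean by at most \<kappa>
  over one step, and \<open>U_le\<close> turns this into a bound on U.\<close>

lemma near_boundary_step:
  assumes jk: "j \<le> k" and step: "\<tau> k - \<tau> j \<le> h" and A: "A \<in> sets (past j)" and \<delta>: "\<delta> > 0"
    and near: "\<And>\<omega>. \<omega> \<in> A \<Longrightarrow> infdist (X (\<tau> j) \<omega>) (- D) \<le> \<delta>"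
  shows "(\<integral>\<^sup>+\<omega>. indicator A \<omega> * ennreal (U (X (\<tau> k) \<omega>)) \<partial>M) \<le> ennreal (L * \<delta> + L * \<kappa> + \<rho>) * emeasure M A"
proof -
  have AM: "A \<in> sets M" using A by (rule past_sets)
  show ?thesis
  proof (cases "\<tau> j = \<tau> k")
    case True
    have "(\<integral>\<^sup>+\<omega>. indicator A \<omega> * ennreal (U (X (\<tau> k) \<omega>)) \<partial>M) \<le> (\<integral>\<^sup>+\<omega>. ennreal (L * \<delta> + L * \<kappa> + \<rho>) * indicator A \<omega> \<partial>M)"
    proof (intro nn_integral_mono)
      fix \<omega>
      have "U (X (\<tau> k) \<omega>) \<le> L * \<delta> + L * \<kappa> + \<rho>" if "\<omega> \<in> A"
        using U_le[of "X (\<tau> j) \<omega>"] mult_left_mono[OF near[OF that] L] mult_nonneg_nonneg[OF L \<kappa>]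
        unfolding True[symmetric] by linarith
      then show "indicator A \<omega> * ennreal (U (X (\<tau> k) \<omega>)) \<le> ennreal (L * \<delta> + L * \<kappa> + \<rho>) * indicator A \<omega>"
        by (auto simp: indicator_def intro!: ennreal_leI)
    qed
    then show ?thesis using AM by (simp add: nn_integral_cmult_indicator)
  next
    case False
    then have lt: "\<tau> j < \<tau> k" using monoD[OF \<tau>(1) jk] by simp
    let ?s = "\<tau> k - \<tau> j"
    have s: "0 < ?s" "?s \<le> h" using lt step by auto
    interpret g: prob_space "gauss_measure ?s :: (real^'d) measure" by (rule prob_space_gauss_measure[OF s(1)])
    let ?G = "\<lambda>p::(real^'d) \<times> (real^'d). ennreal (L * \<delta> + \<rho>) + ennreal L * ennreal (norm (increment \<mu> \<sigma> ?s (snd p)))"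
    have G: "?G \<in> borel_measurable (borel \<Otimes>\<^sub>M borel)"
      by measurable
    have "(\<integral>\<^sup>+\<omega>. indicator A \<omega> * ennreal (U (X (\<tau> k) \<omega>)) \<partial>M) \<le>
      (\<integral>\<^sup>+\<omega>. indicator A \<omega> * ?G (X (\<tau> j) \<omega>, W (\<tau> k) \<omega> - W (\<tau> j) \<omega>) \<partial>M)"
    proof (intro nn_integral_mono)
      fix \<omega>
      let ?i = "increment \<mu> \<sigma> ?s (W (\<tau> k) \<omega> - W (\<tau> j) \<omega>)"
      have "U (X (\<tau> k) \<omega>) \<le> (L * \<delta> + \<rho>) + L * norm ?i" if "\<omega> \<in> A"
      proof -
        have "infdist (X (\<tau> k) \<omega>) (- D) \<le> infdist (X (\<tau> j) \<omega>) (- D) + dist (X (\<tau> k) \<omega>) (X (\<tau> j) \<omega>)"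
          by (rule infdist_triangle)
        also have "dist (X (\<tau> k) \<omega>) (X (\<tau> j) \<omega>) = norm ?i"
          by (simp add: X_increment[of "\<tau> k" _ "\<tau> j"] dist_norm)
        finally have "infdist (X (\<tau> k) \<omega>) (- D) \<le> \<delta> + norm ?i" using near[OF that] by simp
        from mult_left_mono[OF this L] U_le[of "X (\<tau> k) \<omega>"] show ?thesis by (simp add: algebra_simps)
      qed
      then have "ennreal (U (X (\<tau> k) \<omega>)) \<le> ennreal ((L * \<delta> + \<rho>) + L * norm ?i)" if "\<omega> \<in> A"
        using that by (intro ennreal_leI)
      then show "indicator A \<omega> * ennreal (U (X (\<tau> k) \<omega>)) \<le> indicator A \<omega> * ?G (X (\<tau> j) \<omega>, W (\<tau> k) \<omega> - W (\<tau> j) \<omega>)"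
        using L \<rho> \<delta> by (auto simp: indicator_def ennreal_mult ennreal_plus)
    qed
    also have "\<dots> = (\<integral>\<^sup>+\<omega>. indicator A \<omega> * (\<integral>\<^sup>+z. ?G (X (\<tau> j) \<omega>, z) \<partial>gauss_measure ?s) \<partial>M)"
      by (rule freeze_increment[OF lt A G])
    also have "\<dots> \<le> (\<integral>\<^sup>+\<omega>. ennreal (L * \<delta> + L * \<kappa> + \<rho>) * indicator A \<omega> \<partial>M)"
    proof (intro nn_integral_mono)
      fix \<omega>
      have "(\<integral>\<^sup>+z. ?G (X (\<tau> j) \<omega>, z) \<partial>gauss_measure ?s) =
          ennreal (L * \<delta> + \<rho>) + ennreal L * (\<integral>\<^sup>+z. ennreal (norm (increment \<mu> \<sigma> ?s z)) \<partial>gauss_measure ?s)"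
        by (simp add: nn_integral_add nn_integral_cmult g.emeasure_space_1[simplified])
      also have "\<dots> \<le> ennreal (L * \<delta> + \<rho>) + ennreal L * ennreal \<kappa>"
        by (intro add_left_mono mult_left_mono first_moment[OF s]) simp
      also have "\<dots> = ennreal (L * \<delta> + L * \<kappa> + \<rho>)"
        using L \<rho> \<delta> \<kappa> by (simp add: ennreal_mult[symmetric] ennreal_plus[symmetric] algebra_simps del: ennreal_plus)
      finally show "indicator A \<omega> * (\<integral>\<^sup>+z. ?G (X (\<tau> j) \<omega>, z) \<partial>gauss_measure ?s)
          \<le> ennreal (L * \<delta> + L * \<kappa> + \<rho>) * indicator A \<omega>"
        by (auto simp: indicator_def)
    qed
    finally show ?thesis using AM by (simp add: nn_integral_cmult_indicator)
  qed
qed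

text \<open>Here \<^term>\<open>\<tau>\<close> runs through a fine grid, on which closeness to the boundary is monitored, and
  \<^term>\<open>n i\<close> is the index in it of the \<^term>\<open>i\<close>-th point of the grid on which the walk is killed.\<close>

lemma survival_chain:
  assumes n: "mono n" and step: "\<And>i. \<tau> (n (Suc i)) - \<tau> (n i) \<le> h"
    and A: "A \<in> sets (past (n i))" and "i \<le> I"
  shows "A \<inter> {\<omega>\<in>space M. \<forall>l\<in>{i..<I}. X (\<tau> (n l)) \<omega> \<in> D} \<in> sets (past (n I)) \<and>
    (\<integral>\<^sup>+\<omega>. indicator (A \<inter> {\<omega>\<in>space M. \<forall>l\<in>{i..<I}. X (\<tau> (n l)) \<omega> \<in> D}) \<omega> * ennreal (U (X (\<tau> (n I)) \<omega>)) \<partial>M)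
    \<le> (\<integral>\<^sup>+\<omega>. indicator A \<omega> * ennreal (U (X (\<tau> (n i)) \<omega>)) \<partial>M)"
  using \<open>i \<le> I\<close>
proof (induction I rule: dec_induct)
  case base
  have "A \<subseteq> space M" using A sets.sets_into_space by force
  then have "A \<inter> {\<omega>\<in>space M. \<forall>l\<in>{i..<i}. X (\<tau> (n l)) \<omega> \<in> D} = A" by auto
  then show ?case using A by simp
next
  case (step I)
  let ?A = "\<lambda>I. A \<inter> {\<omega>\<in>space M. \<forall>l\<in>{i..<I}. X (\<tau> (n l)) \<omega> \<in> D}"
  have nI: "n I \<le> n (Suc I)" using n by (simp add: monoD)
  have eq: "?A (Suc I) = ?A I \<inter> {\<omega>\<in>space M. X (\<tau> (n I)) \<omega> \<in> D}"
    using step by (auto simp: less_Suc_eq)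
  have [measurable]: "D \<in> sets borel" using D by simp
  have "{\<omega>\<in>space (past (n I)). X (\<tau> (n I)) \<omega> \<in> D} \<in> sets (past (n I))" by measurable
  then have "?A (Suc I) \<in> sets (past (n I))"
    unfolding eq using sets.Int[OF conjunct1[OF step.IH]] by simp
  then have 1: "?A (Suc I) \<in> sets (past (n (Suc I)))"
    using past_algebra_mono[OF nI] by blast
  have "(\<integral>\<^sup>+\<omega>. indicator (?A (Suc I)) \<omega> * ennreal (U (X (\<tau> (n (Suc I))) \<omega>)) \<partial>M)
    \<le> (\<integral>\<^sup>+\<omega>. indicator (?A I) \<omega> * ennreal (U (X (\<tau> (n I)) \<omega>)) \<partial>M)"
    \<comment> \<open>Applied to the event of survival before index I; survival at index I is the
      condition that \<open>one_step\<close> allows to add.\<close>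
    unfolding eq by (rule one_step[OF nI assms(2)]) (use step.IH in simp)
  from order_trans[OF this conjunct2[OF step.IH]] 1 show ?case by blast
qed

text \<open>Up to a killing time at most h later, U is controlled by closeness to the boundary; from
  there on it does not increase in mean along the killed walk. So each k contributes at most a
  constant times the probability that k is the first close time, and these events are
  disjoint.\<close>

lemma crossing_bound:
  assumes n: "mono n" and step: "\<And>i. \<tau> (n (Suc i)) - \<tau> (n i) \<le> h"
    and cover: "\<And>k. k \<le> n I \<Longrightarrow> \<exists>i\<le>I. k \<le> n i \<and> \<tau> (n i) - \<tau> k \<le> h" and \<delta>: "\<delta> > 0"
  shows "(\<integral>\<^sup>+\<omega>. indicator {\<omega>\<in>space M. (\<forall>i<I. X (\<tau> (n i)) \<omega> \<in> D) \<and> (\<exists>k\<le>n I. infdist (X (\<tau> k) \<omega>) (- D) < \<delta>)} \<omega>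
      * ennreal (U (X (\<tau> (n I)) \<omega>)) \<partial>M) \<le> ennreal (L * \<delta> + L * \<kappa> + \<rho>)"
proof -
  \<comment> \<open>decompose by the first fine grid time \<^term>\<open>k\<close> at which the walk is close to the boundary\<close>
  define B where "B k = {\<omega>\<in>space M. infdist (X (\<tau> k) \<omega>) (- D) < \<delta> \<and> (\<forall>l<k. \<not> infdist (X (\<tau> l) \<omega>) (- D) < \<delta>)}" for k
  obtain c where c: "\<And>k. k \<le> n I \<Longrightarrow> c k \<le> I \<and> k \<le> n (c k) \<and> \<tau> (n (c k)) - \<tau> k \<le> h"
    using cover by metis
  \<comment> \<open>Survival before the index \<open>c k\<close> is dropped: this enlarges the event
    and gives it the form treated by \<open>survival_chain\<close>.\<close>
  define A where "A k = B k \<inter> {\<omega>\<in>space M. \<forall>l\<in>{c k..<I}. X (\<tau> (n l)) \<omega> \<in> D}" for k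
  let ?K = "ennreal (L * \<delta> + L * \<kappa> + \<rho>)"
  let ?U = "\<lambda>\<omega>. ennreal (U (X (\<tau> (n I)) \<omega>))"
  have [measurable]: "X (\<tau> k) \<in> borel_measurable M" for k
    by (rule X_measurable[OF \<tau>_nonneg])
  have Bp: "B k \<in> sets (past k)" for k
  proof -
    have m: "(\<lambda>\<omega>. infdist (X (\<tau> l) \<omega>) (- D)) \<in> borel_measurable (past k)" if "l \<le> k" for l
      by (rule measurable_compose[OF X_past[OF that]]) (simp add: borel_measurable_continuous_onI continuous_on_infdist)
    have 1: "{\<omega>\<in>space (past k). infdist (X (\<tau> l) \<omega>) (- D) < \<delta>} \<in> sets (past k)" if "l \<le> k" for l
      using m[OF that] by measurable
    have "B k = {\<omega>\<in>space (past k). infdist (X (\<tau> k) \<omega>) (- D) < \<delta>} -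
        (\<Union>l\<in>{..<k}. {\<omega>\<in>space (past k). infdist (X (\<tau> l) \<omega>) (- D) < \<delta>})"
      by (auto simp: B_def)
    also have "\<dots> \<in> sets (past k)"
      by (intro sets.Diff sets.finite_UN 1) auto
    finally show ?thesis .
  qed
  have bound: "A k \<in> sets M \<and> (\<integral>\<^sup>+\<omega>. indicator (A k) \<omega> * ?U \<omega> \<partial>M) \<le> ?K * emeasure M (B k)" if k: "k \<le> n I" for k
  proof -
    note ck = c[OF k]
    have Bc: "B k \<in> sets (past (n (c k)))" using Bp past_algebra_mono ck by blast
    note ch = survival_chain[OF n step Bc conjunct1[OF ck]]
    have "A k \<in> sets M" unfolding A_def using ch past_sets by blast
    moreover have "(\<integral>\<^sup>+\<omega>. indicator (A k) \<omega> * ?U \<omega> \<partial>M) \<le> (\<integral>\<^sup>+\<omega>. indicator (B k) \<omega> * ennreal (U (X (\<tau> (n (c k))) \<omega>)) \<partial>M)"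
      unfolding A_def using ch by blast
    moreover have "\<dots> \<le> ?K * emeasure M (B k)"
      by (rule near_boundary_step[OF _ _ Bp \<delta>]) (use ck in \<open>auto simp: B_def\<close>)
    ultimately show ?thesis by (meson order_trans)
  qed
  have "(\<integral>\<^sup>+\<omega>. indicator {\<omega>\<in>space M. (\<forall>i<I. X (\<tau> (n i)) \<omega> \<in> D) \<and> (\<exists>k\<le>n I. infdist (X (\<tau> k) \<omega>) (- D) < \<delta>)} \<omega>
      * ?U \<omega> \<partial>M) \<le> (\<integral>\<^sup>+\<omega>. (\<Sum>k\<le>n I. indicator (A k) \<omega> * ?U \<omega>) \<partial>M)"
  proof (intro nn_integral_mono)
    fix \<omega> assume \<omega>: "\<omega> \<in> space M"
    show "indicator {\<omega>\<in>space M. (\<forall>i<I. X (\<tau> (n i)) \<omega> \<in> D) \<and> (\<exists>k\<le>n I. infdist (X (\<tau> k) \<omega>) (- D) < \<delta>)} \<omega>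
      * ?U \<omega> \<le> (\<Sum>k\<le>n I. indicator (A k) \<omega> * ?U \<omega>)"
    proof (cases "(\<forall>i<I. X (\<tau> (n i)) \<omega> \<in> D) \<and> (\<exists>k\<le>n I. infdist (X (\<tau> k) \<omega>) (- D) < \<delta>)")
      case True
      then obtain k0 where k0: "k0 \<le> n I" "infdist (X (\<tau> k0) \<omega>) (- D) < \<delta>" by blast
      define k where "k = (LEAST k. infdist (X (\<tau> k) \<omega>) (- D) < \<delta>)"
      have "k \<le> k0" unfolding k_def by (rule Least_le) (rule k0)
      then have kI: "k \<le> n I" using k0 by simp
      have "\<omega> \<in> B k"
        unfolding B_def k_def using \<omega> LeastI[of "\<lambda>k. infdist (X (\<tau> k) \<omega>) (- D) < \<delta>", OF k0(2)] not_less_Least by blast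
      then have "\<omega> \<in> A k" using True \<omega> by (auto simp: A_def)
      then have "?U \<omega> = indicator (A k) \<omega> * ?U \<omega>" by simp
      also have "\<dots> \<le> (\<Sum>k\<le>n I. indicator (A k) \<omega> * ?U \<omega>)"
        using kI by (intro member_le_sum) auto
      finally show ?thesis by (auto simp: indicator_def)
    qed (auto simp: indicator_def)
  qed
  also have "\<dots> = (\<Sum>k\<le>n I. \<integral>\<^sup>+\<omega>. indicator (A k) \<omega> * ?U \<omega> \<partial>M)"
  proof (rule nn_integral_sum)
    fix k assume "k \<in> {..n I}"
    then have [measurable]: "A k \<in> sets M" using bound by simp
    show "(\<lambda>\<omega>. indicator (A k) \<omega> * ?U \<omega>) \<in> borel_measurable M" by measurable
  qed
  also have "\<dots> \<le> (\<Sum>k\<le>n I. ?K * emeasure M (B k))"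
    by (intro sum_mono) (use bound in simp)
  also have "\<dots> = ?K * (\<Sum>k\<le>n I. emeasure M (B k))" by (simp add: sum_distrib_left)
  also have "(\<Sum>k\<le>n I. emeasure M (B k)) = emeasure M (\<Union>k\<le>n I. B k)"
  proof (rule sum_emeasure)
    show "B ` {..n I} \<subseteq> sets M" using Bp past_sets by blast
    show "disjoint_family_on B {..n I}"
      unfolding disjoint_family_on_def B_def by (auto, metis linorder_neqE_nat)
  qed simp
  also have "?K * emeasure M (\<Union>k\<le>n I. B k) \<le> ?K * 1"
    using emeasure_space[of M "\<Union>k\<le>n I. B k"] emeasure_space_1 by (intro mult_left_mono) auto
  finally show ?thesis by simp
qed

end

text \<open>The fine grid has mesh h / m and is frozen at q; every m-th of its points is a killing
  time. The bound does not depend on m, which is what the passage to continuous monitoring rests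
  on.\<close>

lemma grid_crossing_bound:
  assumes q: "q \<ge> 0" and m: "m \<ge> (1::nat)" and \<delta>: "\<delta> > 0"
  shows "(\<integral>\<^sup>+\<omega>. indicator {\<omega>\<in>space M. (\<forall>i. real i * h \<le> q \<longrightarrow> X (real i * h) \<omega> \<in> D) \<and>
        (\<exists>k. infdist (X (min (real k * h / real m) q) \<omega>) (- D) < \<delta>)} \<omega>
      * ennreal (U (X q \<omega>)) \<partial>M) \<le> ennreal (L * \<delta> + L * \<kappa> + \<rho>)"
proof -
  define \<tau> where "\<tau> j = min (real j * h / real m) q" for j
  define n where "n i = i * m" for i
  \<comment> \<open>The least index with q <= I h: killing times of smaller index are at most q, and
    the I-th one, after freezing, is q itself.\<close>
  define I where "I = nat \<lceil>q / h\<rceil>"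
  have mon: "mono \<tau>"
    unfolding \<tau>_def using h
    by (intro monoI min.mono divide_right_mono mult_right_mono) auto
  have \<tau>0: "0 \<le> \<tau> 0" using q by (simp add: \<tau>_def)
  have \<tau>n: "\<tau> (n i) = min (real i * h) q" for i
    using m by (simp add: \<tau>_def n_def)
  have "q / h \<le> real I" unfolding I_def by linarith
  then have qI: "q \<le> real I * h" using h by (simp add: divide_le_eq)
  have Iq: "real i * h \<le> q" if "i < I" for i
  proof -
    have "real i < q / h" using that unfolding I_def by linarith
    then show ?thesis using h by (simp add: less_divide_eq)
  qed
  have nm: "mono n" by (simp add: n_def mono_def)
  have step: "\<tau> (n (Suc i)) - \<tau> (n i) \<le> h" for i
    unfolding \<tau>n using h by (auto simp: min_def algebra_simps)
  have cover: "\<exists>i\<le>I. k \<le> n i \<and> \<tau> (n i) - \<tau> k \<le> h" if k: "k \<le> n I" for k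
  proof -
    \<comment> \<open>k / m rounded up, the index of the first killing time at or after the fine
      index k.\<close>
    define i where "i = (k + m - 1) div m"
    have "k + m - 1 < m + i * m"
      unfolding i_def by (rule dividend_less_div_times) (use m in simp)
    then have i: "i * m \<le> k + m - 1" "k + m - 1 < i * m + m"
      by (simp_all add: i_def)
    have "i * m < (I + 1) * m" using i k m unfolding n_def by simp
    then have "i < I + 1" by (rule mult_less_cancel2[THEN iffD1, THEN conjunct2])
    then have 1: "i \<le> I" by simp
    have 2: "k \<le> n i" using i m by (simp add: n_def)
    have "real (i * m) \<le> real k + real m" using i m by linarith
    then have "real i * h \<le> real k * h / m + h" using m h
      by (simp add: field_simps) (metis distrib_left mult.assoc mult.commute mult_right_mono less_imp_le)
    then have "\<tau> (n i) - \<tau> k \<le> h"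
      unfolding \<tau>n unfolding \<tau>_def using h by (auto simp: min_def)
    with 1 2 show ?thesis by blast
  qed
  have "(\<integral>\<^sup>+\<omega>. indicator {\<omega>\<in>space M. (\<forall>i. real i * h \<le> q \<longrightarrow> X (real i * h) \<omega> \<in> D) \<and>
        (\<exists>k. infdist (X (min (real k * h / real m) q) \<omega>) (- D) < \<delta>)} \<omega>
      * ennreal (U (X q \<omega>)) \<partial>M) \<le>
      (\<integral>\<^sup>+\<omega>. indicator {\<omega>\<in>space M. (\<forall>i<I. X (\<tau> (n i)) \<omega> \<in> D) \<and> (\<exists>k\<le>n I. infdist (X (\<tau> k) \<omega>) (- D) < \<delta>)} \<omega>
      * ennreal (U (X (\<tau> (n I)) \<omega>)) \<partial>M)"
  proof (intro nn_integral_mono mult_mono)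
    fix \<omega>
    show "ennreal (U (X q \<omega>)) \<le> ennreal (U (X (\<tau> (n I)) \<omega>))" unfolding \<tau>n using qI by (simp add: min_absorb2)
    \<comment> \<open>Beyond the index \<open>n I\<close> the fine grid rests at q, so larger k add
      no new points.\<close>
    have "\<exists>k\<le>n I. infdist (X (\<tau> k) \<omega>) (- D) < \<delta>" if "infdist (X (min (real k * h / real m) q) \<omega>) (- D) < \<delta>" for k
    proof (cases "k \<le> n I")
      case True then show ?thesis using that by (auto simp: \<tau>_def)
    next
      case False
      then have "\<tau> (n I) \<le> \<tau> k" using monoD[OF mon] by simp
      moreover have "\<tau> (n I) = q" unfolding \<tau>n using qI by simp
      moreover have "\<tau> k \<le> q" by (simp add: \<tau>_def)
      ultimately have "\<tau> k = \<tau> (n I)" by simp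
      then show ?thesis using that by (auto simp: \<tau>_def)
    qed
    moreover have "X (\<tau> (n i)) \<omega> \<in> D" if "\<forall>i. real i * h \<le> q \<longrightarrow> X (real i * h) \<omega> \<in> D" "i < I" for i
      using that Iq[OF that(2)] unfolding \<tau>n by (simp add: min_absorb1)
    ultimately show "indicator {\<omega>\<in>space M. (\<forall>i. real i * h \<le> q \<longrightarrow> X (real i * h) \<omega> \<in> D) \<and>
        (\<exists>k. infdist (X (min (real k * h / real m) q) \<omega>) (- D) < \<delta>)} \<omega> \<le>
      (indicator {\<omega>\<in>space M. (\<forall>i<I. X (\<tau> (n i)) \<omega> \<in> D) \<and> (\<exists>k\<le>n I. infdist (X (\<tau> k) \<omega>) (- D) < \<delta>)} \<omega> :: ennreal)"
      by (auto simp: indicator_def)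
  qed auto
  also have "\<dots> \<le> ennreal (L * \<delta> + L * \<kappa> + \<rho>)"
    by (rule crossing_bound[OF mon \<tau>0 nm step cover \<delta>])
  finally show ?thesis .
qed

text \<open>The time s rounded up to the fine grid converges to s; by continuity the path there
  approaches the point X s, which lies in the complement.\<close>

lemma eventually_grid_near:
  assumes q: "q \<ge> 0" and \<omega>: "\<omega> \<in> space M" and s: "s \<in> {0..q}" "X s \<omega> \<notin> D" and \<delta>: "\<delta> > 0"
  shows "\<forall>\<^sub>F m in sequentially. \<exists>k. infdist (X (min (real k * h / real m) q) \<omega>) (- D) < \<delta>"
proof -
  define r where "r m = min (real (nat \<lceil>s * real m / h\<rceil>) * h / real m) q" for m
  have bnd: "s \<le> r m \<and> r m \<le> s + h / real m" if "m \<ge> 1" for m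
  proof -
    have m: "real m > 0" using that by simp
    have s0: "s * real m / h \<ge> 0" using s h by simp
    have 1: "s * real m / h \<le> real (nat \<lceil>s * real m / h\<rceil>)" by linarith
    have 2: "real (nat \<lceil>s * real m / h\<rceil>) \<le> s * real m / h + 1" using s0 by linarith
    have "s \<le> real (nat \<lceil>s * real m / h\<rceil>) * h / real m"
      using 1 m h by (simp add: field_simps)
    moreover have "real (nat \<lceil>s * real m / h\<rceil>) * h / real m \<le> s + h / real m"
      using 2 m h by (simp add: field_simps)
    ultimately show ?thesis using s by (auto simp: r_def min_def)
  qed
  have rs: "r \<longlonglongrightarrow> s"
  proof (rule tendsto_sandwich[of "\<lambda>_. s" _ _ "\<lambda>m. s + h / real m"])
    have "(\<lambda>m. s + h / real m) \<longlonglongrightarrow> s + 0" by (intro tendsto_intros lim_const_over_n)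
    then show "(\<lambda>m. s + h / real m) \<longlonglongrightarrow> s" by simp
  qed (use bnd in \<open>auto simp: eventually_sequentially intro!: exI[of _ 1]\<close>)
  have "(\<lambda>m. X (r m) \<omega>) \<longlonglongrightarrow> X s \<omega>"
  proof (rule continuous_on_tendsto_compose[OF X_continuous[OF \<omega>] rs])
    show "s \<in> {0..}" using s by simp
    show "\<forall>\<^sub>F m in sequentially. r m \<in> {0..}" using q h by (simp add: r_def)
  qed
  then have "(\<lambda>m. infdist (X (r m) \<omega>) (- D)) \<longlonglongrightarrow> infdist (X s \<omega>) (- D)"
    by (rule tendsto_infdist)
  moreover have "infdist (X s \<omega>) (- D) = 0" using s by simp
  ultimately have "\<forall>\<^sub>F m in sequentially. infdist (X (r m) \<omega>) (- D) < \<delta>"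
    using \<delta> by (simp add: order_tendstoD(2))
  then show ?thesis by eventually_elim (auto simp: r_def)
qed

text \<open>The fine grids for different m need not be nested, so the crossing event is reached
  through \<open>liminf\<close> and Fatou's lemma rather than by a monotone limit; \<delta> is sent
  to 0 afterwards.\<close>

theorem crossing_estimate:
  assumes q: "q \<ge> 0"
  shows "(\<integral>\<^sup>+\<omega>. indicator {\<omega>\<in>space M. (\<forall>i. real i * h \<le> q \<longrightarrow> X (real i * h) \<omega> \<in> D) \<and> (\<exists>s\<in>{0..q}. X s \<omega> \<notin> D)} \<omega>
      * ennreal (U (X q \<omega>)) \<partial>M) \<le> ennreal (L * \<kappa> + \<rho>)"
    (is "?I \<le> _")
proof -
  have bound: "?I \<le> ennreal (L * \<delta> + L * \<kappa> + \<rho>)" if \<delta>: "\<delta> > 0" for \<delta>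
  proof -
    define E where "E m = {\<omega>\<in>space M. (\<forall>i. real i * h \<le> q \<longrightarrow> X (real i * h) \<omega> \<in> D) \<and>
        (\<exists>k. infdist (X (min (real k * h / real m) q) \<omega>) (- D) < \<delta>)}" for m
    let ?f = "\<lambda>m \<omega>. indicator (E m) \<omega> * ennreal (U (X q \<omega>))"
    have [measurable]: "D \<in> sets borel" using D by simp
    have [measurable]: "X (real i * h) \<in> borel_measurable M" "X (min (real k * h / real m) q) \<in> borel_measurable M"
       "X q \<in> borel_measurable M" for i k m
      using q h by (auto intro!: X_measurable)
    have [measurable]: "(\<lambda>\<omega>. infdist (X (min (real k * h / real m) q) \<omega>) (- D)) \<in> borel_measurable M" for k m
      by (rule measurable_compose[of "X (min (real k * h / real m) q)" M borel])
        (auto intro!: borel_measurable_continuous_onI continuous_on_infdist)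
    have E[measurable]: "E m \<in> sets M" for m
      unfolding E_def by measurable
    have "?I \<le> (\<integral>\<^sup>+\<omega>. liminf (\<lambda>m. ?f m \<omega>) \<partial>M)"
    proof (intro nn_integral_mono)
      fix \<omega> assume \<omega>: "\<omega> \<in> space M"
      show "indicator {\<omega>\<in>space M. (\<forall>i. real i * h \<le> q \<longrightarrow> X (real i * h) \<omega> \<in> D) \<and> (\<exists>s\<in>{0..q}. X s \<omega> \<notin> D)} \<omega>
        * ennreal (U (X q \<omega>)) \<le> liminf (\<lambda>m. ?f m \<omega>)"
      proof (cases "(\<forall>i. real i * h \<le> q \<longrightarrow> X (real i * h) \<omega> \<in> D) \<and> (\<exists>s\<in>{0..q}. X s \<omega> \<notin> D)")
        case True
        then obtain s where s: "s \<in> {0..q}" "X s \<omega> \<notin> D" by blast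
        from eventually_grid_near[OF q \<omega> s \<delta>]
        have "\<forall>\<^sub>F m in sequentially. ennreal (U (X q \<omega>)) \<le> ?f m \<omega>"
          by eventually_elim (use True \<omega> in \<open>simp add: E_def\<close>)
        then have "ennreal (U (X q \<omega>)) \<le> liminf (\<lambda>m. ?f m \<omega>)" by (rule Liminf_bounded)
        then show ?thesis by (auto simp: indicator_def)
      qed (auto simp: indicator_def)
    qed
    also have "\<dots> \<le> liminf (\<lambda>m. \<integral>\<^sup>+\<omega>. ?f m \<omega> \<partial>M)"
      by (rule nn_integral_liminf) measurable
    also have "\<dots> \<le> ennreal (L * \<delta> + L * \<kappa> + \<rho>)"
    proof (rule Liminf_le)
      show "\<forall>\<^sub>F m in sequentially. (\<integral>\<^sup>+\<omega>. ?f m \<omega> \<partial>M) \<le> ennreal (L * \<delta> + L * \<kappa> + \<rho>)"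
        unfolding eventually_sequentially E_def
        by (intro exI[of _ 1] allI impI grid_crossing_bound[OF q _ \<delta>])
    qed simp
    finally show ?thesis .
  qed
  show ?thesis
  proof (rule ennreal_le_epsilon)
    fix e :: real assume e: "0 < e"
    \<comment> \<open>L + 1 in place of L, which may be 0.\<close>
    define \<delta> where "\<delta> = e / (L + 1)"
    have "\<delta> > 0" using e L by (simp add: \<delta>_def)
    have "L * \<delta> \<le> e" using e L by (simp add: \<delta>_def field_simps)
    have "?I \<le> ennreal (L * \<delta> + L * \<kappa> + \<rho>)" by (rule bound[OF \<open>\<delta> > 0\<close>])
    also have "\<dots> \<le> ennreal ((L * \<kappa> + \<rho>) + e)" using \<open>L * \<delta> \<le> e\<close> by (intro ennreal_leI) simp
    also have "\<dots> = ennreal (L * \<kappa> + \<rho>) + ennreal e"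
      using L \<kappa> \<rho> e by (intro ennreal_plus) auto
    finally show "?I \<le> ennreal (L * \<kappa> + \<rho>) + ennreal e" .
  qed
qed

end

section \<open>The bias of discrete killing\<close>

text \<open>Below \<rho> the left side is not positive; above it a <= a (a / \<rho>)^(p-1). This
  trades the excess of an overshoot for a high moment.\<close>

lemma excess_le_power:
  fixes a \<rho> :: real
  assumes "a \<ge> 0" "\<rho> > 0" "p \<ge> 1"
  shows "a - \<rho> \<le> a ^ p / \<rho> ^ (p - 1)"
proof (cases "a \<le> \<rho>")
  case True
  then have "a - \<rho> \<le> 0" by simp
  also have "0 \<le> a ^ p / \<rho> ^ (p - 1)" using assms by simp
  finally show ?thesis .
next
  case False
  have "a * \<rho> ^ (p - 1) \<le> a * a ^ (p - 1)"
    using False assms by (intro mult_left_mono power_mono) auto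
  also have "\<dots> = a ^ p" using assms by (simp add: power_eq_if)
  finally have "a \<le> a ^ p / \<rho> ^ (p - 1)" using assms by (simp add: le_divide_eq)
  then show ?thesis using assms by simp
qed

text \<open>Follows from the second moment by n <= q + n^2 / q with q = sqrt h, both terms having
  mean of order sqrt h. The bound is in terms of h rather than s because one constant has to serve
  all steps of length at most h.\<close>

lemma increment_first_moment:
  fixes \<mu> :: "real^'d::finite" and \<sigma> :: "real^'d^'d"
  obtains C where "C \<ge> 0" "\<And>s h. 0 < s \<Longrightarrow> s \<le> h \<Longrightarrow> h \<le> 1 \<Longrightarrow>
    (\<integral>\<^sup>+z. ennreal (norm (increment \<mu> \<sigma> s z)) \<partial>gauss_measure s) \<le> ennreal (C * sqrt h)"
proof -
  obtain C where C: "C \<ge> 0"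
    "\<And>s. 0 < s \<Longrightarrow> s \<le> 1 \<Longrightarrow> integrable (gauss_measure s) (\<lambda>z. norm (increment \<mu> \<sigma> s z) ^ (2*1))"
    "\<And>s. 0 < s \<Longrightarrow> s \<le> 1 \<Longrightarrow> integral\<^sup>L (gauss_measure s) (\<lambda>z. norm (increment \<mu> \<sigma> s z) ^ (2*1)) \<le> C * s ^ 1"
    by (rule increment_even_moment[of 1]) auto
  show thesis
  proof (rule that[of "1 + C"])
    show "0 \<le> 1 + C" using C by simp
    fix s h :: real assume s: "0 < s" "s \<le> h" "h \<le> 1"
    interpret prob_space "gauss_measure s :: (real^'d) measure" by (rule prob_space_gauss_measure[OF s(1)])
    let ?n = "\<lambda>z. norm (increment \<mu> \<sigma> s z)"
    define q where "q = sqrt h"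
    have q: "q > 0" "q * q = h" using s by (auto simp: q_def)
    have I: "integrable (gauss_measure s) (\<lambda>z. ?n z ^ 2)" using C(2)[of s] s by simp
    have "(\<integral>\<^sup>+z. ennreal (?n z) \<partial>gauss_measure s) \<le> (\<integral>\<^sup>+z. ennreal (q + ?n z ^ 2 / q) \<partial>gauss_measure s)"
    proof (intro nn_integral_mono ennreal_leI)
      fix z
      have "0 \<le> (q - ?n z)\<^sup>2" by simp
      then have "2 * (q * ?n z) \<le> q * q + ?n z ^ 2" by (simp add: power2_eq_square algebra_simps)
      moreover have "0 \<le> q * ?n z" using q by simp
      ultimately have "q * ?n z \<le> q * q + ?n z ^ 2" by linarith
      then show "?n z \<le> q + ?n z ^ 2 / q" using q by (simp add: field_simps)
    qed
    also have "\<dots> = ennreal (integral\<^sup>L (gauss_measure s) (\<lambda>z. q + ?n z ^ 2 / q))"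
      using I q by (intro nn_integral_eq_integral) auto
    also have "integral\<^sup>L (gauss_measure s) (\<lambda>z. q + ?n z ^ 2 / q) = q + integral\<^sup>L (gauss_measure s) (\<lambda>z. ?n z ^ 2) / q"
      using I prob_space by simp
    also have "\<dots> \<le> (1 + C) * sqrt h"
    proof -
      have "integral\<^sup>L (gauss_measure s) (\<lambda>z. ?n z ^ 2) \<le> C * s" using C(3)[of s] s by simp
      also have "\<dots> \<le> C * (q * q)" using C s q by (simp add: mult_left_mono)
      finally have "integral\<^sup>L (gauss_measure s) (\<lambda>z. ?n z ^ 2) / q \<le> C * q" using q by (simp add: divide_le_eq mult.assoc)
      then show ?thesis by (simp add: q_def algebra_simps)
    qed
    finally show "(\<integral>\<^sup>+z. ennreal (?n z) \<partial>gauss_measure s) \<le> ennreal ((1 + C) * sqrt h)" by (simp add: ennreal_leI)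
  qed
qed

text \<open>For s <= h the moment of order 2k is at most C s h^(k-1), so division by
  h^(\<gamma>(2k-1)) leaves s h^e with e = k - 1 - \<gamma>(2k-1). For e > 0 the factor h^e is small
  and the excess fits under the drift c0 s, even when s is much shorter than h.\<close>

lemma excess_moment_le_drift:
  fixes \<mu> :: "real^'d::finite" and \<sigma> :: "real^'d^'d"
  assumes \<gamma>: "0 < \<gamma>" "\<gamma> < 1/2" and L: "L > 0" and c0: "c0 > 0"
  obtains k h0 where "k > 0" "0 < h0" "h0 \<le> 1"
    "\<And>s. 0 < s \<Longrightarrow> s \<le> 1 \<Longrightarrow> integrable (gauss_measure s) (\<lambda>z. norm (increment \<mu> \<sigma> s z) ^ (2*k))"
    "\<And>s h. 0 < s \<Longrightarrow> s \<le> h \<Longrightarrow> h \<le> h0 \<Longrightarrow>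
      integral\<^sup>L (gauss_measure s) (\<lambda>z. (L * norm (increment \<mu> \<sigma> s z)) ^ (2*k) / (h powr \<gamma>) ^ (2*k-1)) \<le> c0 * s"
proof -
  \<comment> \<open>Solves k (1 - 2 \<gamma>) > 1 - \<gamma>, which is e > 0; the successor makes
    the inequality strict.\<close>
  define k where "k = Suc (nat \<lceil>(1 - \<gamma>) / (1 - 2 * \<gamma>)\<rceil>)"
  define e where "e = real k - 1 - \<gamma> * (2 * real k - 1)"
  have "(1 - \<gamma>) / (1 - 2 * \<gamma>) < real k" unfolding k_def by linarith
  then have "1 - \<gamma> < real k * (1 - 2 * \<gamma>)" using \<gamma> by (simp add: divide_less_eq)
  then have e: "e > 0" by (simp add: e_def algebra_simps)
  have k: "k > 0" by (simp add: k_def)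
  obtain C where C: "C \<ge> 0"
    "\<And>s. 0 < s \<Longrightarrow> s \<le> 1 \<Longrightarrow> integrable (gauss_measure s) (\<lambda>z. norm (increment \<mu> \<sigma> s z) ^ (2*k))"
    "\<And>s. 0 < s \<Longrightarrow> s \<le> 1 \<Longrightarrow> integral\<^sup>L (gauss_measure s) (\<lambda>z. norm (increment \<mu> \<sigma> s z) ^ (2*k)) \<le> C * s ^ k"
    by (rule increment_even_moment[OF k]) auto
  \<comment> \<open>The summand 1 keeps A positive if C = 0, so that c0 / A makes sense.\<close>
  define A where "A = L ^ (2*k) * C + 1"
  have A: "A > 0" using L C by (simp add: A_def add_nonneg_pos)
  define h0 where "h0 = min 1 ((c0 / A) powr (1 / e))"
  have h0: "0 < h0" "h0 \<le> 1" using c0 A by (auto simp: h0_def)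
  show thesis
  proof (rule that[OF k h0 C(2)])
    fix s h :: real assume s: "0 < s" "s \<le> h" "h \<le> h0"
    have h: "h > 0" "s \<le> 1" using s h0 by auto
    define r where "r = (h powr \<gamma>) ^ (2*k-1)"
    have r: "r > 0" using h by (simp add: r_def)
    have "h powr e \<le> h0 powr e" using s h e by (intro powr_mono2) auto
    also have "\<dots> \<le> ((c0 / A) powr (1 / e)) powr e" using h0 e by (intro powr_mono2) (auto simp: h0_def)
    also have "\<dots> = c0 / A" using e c0 A by (simp add: powr_powr)
    finally have he: "A * h powr e \<le> c0" using A by (simp add: field_simps)
    have hr: "h ^ (k - 1) = h powr e * r"
    proof -
      have "h powr e * r = h powr (e + \<gamma> * (2 * real k - 1))"
        using h k by (simp add: r_def powr_power powr_add[symmetric] of_nat_diff mult.commute)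
      also have "e + \<gamma> * (2 * real k - 1) = real (k - 1)" using k by (simp add: e_def of_nat_diff)
      finally show ?thesis using h by (simp add: powr_realpow)
    qed
    have "integral\<^sup>L (gauss_measure s) (\<lambda>z. (L * norm (increment \<mu> \<sigma> s z)) ^ (2*k) / r)
      = L ^ (2*k) / r * integral\<^sup>L (gauss_measure s) (\<lambda>z. norm (increment \<mu> \<sigma> s z) ^ (2*k))"
      by (simp add: power_mult_distrib)
    also have "\<dots> \<le> L ^ (2*k) / r * (C * s ^ k)"
      using C(3)[OF s(1) h(2)] r by (intro mult_left_mono) auto
    also have "s ^ k = s * s ^ (k - 1)" using k by (simp add: power_eq_if)
    also have "L ^ (2*k) / r * (C * (s * s ^ (k - 1))) \<le> L ^ (2*k) / r * (C * (s * h ^ (k - 1)))"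
      using s C r by (intro mult_left_mono power_mono) auto
    also have "\<dots> = (L ^ (2*k) * C) * h powr e * s"
      unfolding hr using r by simp
    also have "\<dots> \<le> A * h powr e * s"
      using s by (intro mult_right_mono) (auto simp: A_def)
    also have "\<dots> \<le> c0 * s" using he s by (intro mult_right_mono) auto
    finally show "integral\<^sup>L (gauss_measure s) (\<lambda>z. (L * norm (increment \<mu> \<sigma> s z)) ^ (2*k) / (h powr \<gamma>) ^ (2*k-1)) \<le> c0 * s"
      by (simp add: r_def)
  qed
qed

text \<open>Uniformity in the horizon and the starting point comes from the supermartingale
  inequality: it holds exactly at every step, so no errors accumulate along the grid.\<close>

lemma discrete_exit_bias:
  fixes W :: "real \<Rightarrow> 'a \<Rightarrow> real^'d::finite" and \<sigma> :: "real^'d^'d"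
  assumes bm: "standard_brownian_motion M W"
    and m: "m > 0" "\<And>v. m * (v \<bullet> v) \<le> v \<bullet> ((\<sigma> ** transpose \<sigma>) *v v)"
    and D: "open D" "bounded D" "D \<noteq> {}" and R: "R > 0"
    and ext: "\<And>z. z \<in> frontier D \<Longrightarrow> \<exists>c. dist z c = R \<and> ball c R \<inter> D = {}"
    and \<gamma>: "0 < \<gamma>" "\<gamma> < 1/2"
  obtains C h0 where "C > 0" "0 < h0"
    "\<And>h q x. 0 < h \<Longrightarrow> h \<le> h0 \<Longrightarrow> 0 \<le> q \<Longrightarrow>
      (\<integral>\<^sup>+\<omega>. indicator {\<omega>\<in>space M. (\<forall>i. real i * h \<le> q \<longrightarrow> diffusion \<mu> \<sigma> x (\<lambda>s. W s \<omega>) (real i * h) \<in> D) \<and>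
          (\<exists>s\<in>{0..q}. diffusion \<mu> \<sigma> x (\<lambda>s. W s \<omega>) s \<notin> D)} \<omega>
        * ennreal (infdist (diffusion \<mu> \<sigma> x (\<lambda>s. W s \<omega>) q) (- D)) \<partial>M) \<le> ennreal (C * h powr \<gamma>)"
proof -
  obtain \<Phi>0 :: "real^'d \<Rightarrow> real" and L0 c00 c1 s0 where L0: "L0 > 0" and c00: "c00 > 0" and c1: "c1 > 0" and s0: "s0 > 0" "s0 \<le> 1"
    and lip0: "\<And>y y'. \<bar>\<Phi>0 y - \<Phi>0 y'\<bar> \<le> L0 * dist y y'" and \<Phi>0b: "\<And>y. \<bar>\<Phi>0 y\<bar> \<le> 1"
    and lower0: "\<And>y. y \<in> D \<Longrightarrow> c1 * infdist y (- D) \<le> \<Phi>0 y" and upper0: "\<And>y. y \<in> D \<Longrightarrow> \<Phi>0 y \<le> L0 * infdist y (- D)"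
    and drift0: "\<And>s y. 0 < s \<Longrightarrow> s \<le> s0 \<Longrightarrow> y \<in> D \<Longrightarrow>
       integral\<^sup>L (gauss_measure s) (\<lambda>z. \<Phi>0 (y + increment \<mu> \<sigma> s z)) + c00 * s \<le> \<Phi>0 y"
    by (rule exterior_ball_barrier[OF m D R ext, of \<mu>]) (assumption, rule that[rotated 5], assumption+)
  \<comment> \<open>Rescaled so that \<Phi> dominates the distance itself on D.\<close>
  define \<Phi> where "\<Phi> y = \<Phi>0 y / c1" for y
  define L where "L = L0 / c1"
  define c0 where "c0 = c00 / c1"
  have L: "L > 0" and c0: "c0 > 0" using L0 c00 c1 by (simp_all add: L_def c0_def)
  have lip: "\<bar>\<Phi> y - \<Phi> y'\<bar> \<le> L * dist y y'" for y y'
    using lip0[of y y'] c1 by (simp add: \<Phi>_def L_def diff_divide_distrib[symmetric] divide_right_mono)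
  have \<Phi>b: "\<bar>\<Phi> y\<bar> \<le> 1 / c1" for y
    using \<Phi>0b[of y] c1 by (simp add: \<Phi>_def divide_right_mono)
  have lower: "infdist y (- D) \<le> \<Phi> y" if "y \<in> D" for y
    using lower0[OF that] c1 by (simp add: \<Phi>_def le_divide_eq mult.commute)
  have upper: "\<Phi> y \<le> L * infdist y (- D)" if "y \<in> D" for y
    using upper0[OF that] c1 by (simp add: \<Phi>_def L_def divide_right_mono)
  have drift: "integral\<^sup>L (gauss_measure s) (\<lambda>z. \<Phi> (y + increment \<mu> \<sigma> s z)) + c0 * s \<le> \<Phi> y"
    if "0 < s" "s \<le> s0" "y \<in> D" for s y
    using divide_right_mono[OF drift0[OF that], of c1] c1 by (simp add: \<Phi>_def c0_def add_divide_distrib)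
  have "L-lipschitz_on UNIV \<Phi>"
    using lip L by (auto simp: lipschitz_on_def dist_real_def)
  then have \<Phi>m[measurable]: "\<Phi> \<in> borel_measurable borel"
    by (intro borel_measurable_continuous_onI lipschitz_on_continuous_on)
  have [measurable]: "D \<in> sets borel" using D by simp
  obtain C1 where C1: "C1 \<ge> 0" "\<And>s h. 0 < s \<Longrightarrow> s \<le> h \<Longrightarrow> h \<le> 1 \<Longrightarrow>
    (\<integral>\<^sup>+z. ennreal (norm (increment \<mu> \<sigma> s z)) \<partial>gauss_measure s) \<le> ennreal (C1 * sqrt h)"
    using increment_first_moment[of \<mu> \<sigma>] by blast
  obtain k h1 where k: "k > 0" and h1: "0 < h1" "h1 \<le> 1"
    and int: "\<And>s. 0 < s \<Longrightarrow> s \<le> 1 \<Longrightarrow> integrable (gauss_measure s) (\<lambda>z. norm (increment \<mu> \<sigma> s z) ^ (2*k))"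
    and excess: "\<And>s h. 0 < s \<Longrightarrow> s \<le> h \<Longrightarrow> h \<le> h1 \<Longrightarrow>
      integral\<^sup>L (gauss_measure s) (\<lambda>z. (L * norm (increment \<mu> \<sigma> s z)) ^ (2*k) / (h powr \<gamma>) ^ (2*k-1)) \<le> c0 * s"
    using excess_moment_le_drift[OF \<gamma> L c0, of \<mu> \<sigma>] by blast
  have ps: "prob_space M" using bm by (simp add: standard_brownian_motion_def)
  define C where "C = L * C1 + 1"
  define h0 where "h0 = min s0 h1"
  show thesis
  proof (rule that[of C h0])
    show "C > 0" using L C1 c1 by (simp add: C_def add_nonneg_pos)
    show "h0 > 0" using s0 h1 by (simp add: h0_def)
    fix h q :: real and x :: "real^'d" assume h: "0 < h" "h \<le> h0" and q: "0 \<le> q"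
    have hs: "h \<le> s0" "h \<le> h1" "h \<le> 1" using h h1 by (auto simp: h0_def)
    define \<rho> where "\<rho> = h powr \<gamma>"
    have \<rho>: "\<rho> > 0" using h by (simp add: \<rho>_def)
    define U where "U y = (if y \<in> D then \<Phi> y + \<rho> else 0)" for y
    have \<Phi>0: "\<Phi> y \<ge> 0" if "y \<in> D" for y
      using lower[OF that] infdist_nonneg[of y "- D"] by linarith
    have U0: "U y \<ge> 0" for y using \<Phi>0[of y] \<rho> by (auto simp: U_def)
    interpret barrier_walk M W \<mu> \<sigma> D U x h L \<rho> "C1 * sqrt h"
    proof (intro barrier_walk.intro barrier_walk_axioms.intro)
      show "prob_space M" by (rule ps)
      show "standard_brownian_motion M W" by (rule bm)
      show "open D" by (rule D)
      show "U \<in> borel_measurable borel" unfolding U_def by measurable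
      show "h > 0" "L \<ge> 0" "\<rho> \<ge> 0" using h L \<rho> by auto
      show "0 \<le> C1 * sqrt h" using C1 h by simp
      show "(\<integral>\<^sup>+z. ennreal (norm (increment \<mu> \<sigma> s z)) \<partial>gauss_measure s) \<le> ennreal (C1 * sqrt h)" if "0 < s" "s \<le> h" for s
        using C1 that hs by simp
      show "U y \<le> L * infdist y (- D) + \<rho>" for y
        using upper[of y] \<rho> by (auto simp: U_def)
      fix s y assume s: "0 < s" "s \<le> h" and y: "y \<in> D"
      interpret g: prob_space "gauss_measure s :: (real^'d) measure" by (rule prob_space_gauss_measure[OF s(1)])
      let ?e = "\<lambda>z. increment \<mu> \<sigma> s z"
      let ?P = "\<lambda>z. (L * norm (?e z)) ^ (2*k) / \<rho> ^ (2*k-1)"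
      have iP: "integrable (gauss_measure s) ?P"
        using int[of s] s hs by (simp add: power_mult_distrib)
      have i\<Phi>: "integrable (gauss_measure s) (\<lambda>z. \<Phi> (y + ?e z))"
        by (rule g.integrable_const_bound[of _ "1 / c1"]) (use \<Phi>b in auto)
      \<comment> \<open>Inside D this holds because \<open>?P\<close> is nonnegative. Outside, U is
        0 while \<Phi> is at least -L |e|, where e is the step; \<rho> covers this drop except for
        the excess, which is at most \<open>?P\<close>.\<close>
      have le: "U (y + ?e z) \<le> \<Phi> (y + ?e z) + \<rho> + ?P z" for z
      proof -
        have P0: "?P z \<ge> 0" using L \<rho> by simp
        have ex: "L * norm (?e z) - \<rho> \<le> ?P z"
          by (rule excess_le_power) (use L \<rho> k in auto)
        have "\<Phi> y - \<Phi> (y + ?e z) \<le> L * norm (?e z)"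
          using lip[of y "y + ?e z"] by (simp add: dist_norm abs_le_iff)
        with \<Phi>0[OF y] ex P0 show ?thesis by (auto simp: U_def)
      qed
      have "(\<integral>\<^sup>+z. ennreal (U (y + ?e z)) \<partial>gauss_measure s) \<le> (\<integral>\<^sup>+z. ennreal (\<Phi> (y + ?e z) + \<rho> + ?P z) \<partial>gauss_measure s)"
        by (intro nn_integral_mono ennreal_leI le)
      also have "\<dots> = ennreal (integral\<^sup>L (gauss_measure s) (\<lambda>z. \<Phi> (y + ?e z) + \<rho> + ?P z))"
      proof (rule nn_integral_eq_integral)
        show "integrable (gauss_measure s) (\<lambda>z. \<Phi> (y + ?e z) + \<rho> + ?P z)"
          using iP i\<Phi> by (intro Bochner_Integration.integrable_add) auto
        show "AE z in gauss_measure s. 0 \<le> \<Phi> (y + ?e z) + \<rho> + ?P z"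
          using le U0 by (intro AE_I2) (meson order_trans)
      qed
      also have "integral\<^sup>L (gauss_measure s) (\<lambda>z. \<Phi> (y + ?e z) + \<rho> + ?P z) =
          integral\<^sup>L (gauss_measure s) (\<lambda>z. \<Phi> (y + ?e z)) + \<rho> + integral\<^sup>L (gauss_measure s) ?P"
        using iP i\<Phi> g.prob_space by (subst Bochner_Integration.integral_add) auto
      \<comment> \<open>The drift pays c0 s and the mean excess costs at most c0 s.\<close>
      also have "\<dots> \<le> U y"
        using drift[of s y] excess[of s h] s hs y by (simp add: U_def \<rho>_def)
      finally show "(\<integral>\<^sup>+z. ennreal (U (y + ?e z)) \<partial>gauss_measure s) \<le> ennreal (U y)"
        by (simp add: ennreal_leI)
    qed
    let ?S = "{\<omega>\<in>space M. (\<forall>i. real i * h \<le> q \<longrightarrow> X (real i * h) \<omega> \<in> D) \<and> (\<exists>s\<in>{0..q}. X s \<omega> \<notin> D)}"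
    have inf: "infdist y (- D) \<le> U y" for y
      using lower[of y] \<rho> by (cases "y \<in> D") (auto simp: U_def)
    have "(\<integral>\<^sup>+\<omega>. indicator ?S \<omega> * ennreal (infdist (X q \<omega>) (- D)) \<partial>M)
      \<le> (\<integral>\<^sup>+\<omega>. indicator ?S \<omega> * ennreal (U (X q \<omega>)) \<partial>M)"
      by (intro nn_integral_mono mult_left_mono ennreal_leI inf) simp
    also have "\<dots> \<le> ennreal (L * (C1 * sqrt h) + \<rho>)"
      by (rule crossing_estimate[OF q])
    also have "\<dots> \<le> ennreal (C * h powr \<gamma>)"
    proof (rule ennreal_leI)
      \<comment> \<open>The mean length of a step is of order sqrt h <= h^\<gamma>, so the jump
        h^\<gamma> sets the rate.\<close>
      have "sqrt h = h powr (1/2)" using h by (simp add: powr_half_sqrt)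
      also have "\<dots> \<le> h powr \<gamma>" using h hs \<gamma> by (intro powr_mono') auto
      finally have "L * (C1 * sqrt h) \<le> L * (C1 * h powr \<gamma>)" using L C1 by (intro mult_left_mono) auto
      then show "L * (C1 * sqrt h) + \<rho> \<le> C * h powr \<gamma>" by (simp add: C_def \<rho>_def algebra_simps)
    qed
    finally show "(\<integral>\<^sup>+\<omega>. indicator {\<omega>\<in>space M. (\<forall>i. real i * h \<le> q \<longrightarrow> diffusion \<mu> \<sigma> x (\<lambda>s. W s \<omega>) (real i * h) \<in> D) \<and>
          (\<exists>s\<in>{0..q}. diffusion \<mu> \<sigma> x (\<lambda>s. W s \<omega>) s \<notin> D)} \<omega>
        * ennreal (infdist (diffusion \<mu> \<sigma> x (\<lambda>s. W s \<omega>) q) (- D)) \<partial>M) \<le> ennreal (C * h powr \<gamma>)"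
      unfolding X_def .
  qed
qed

section \<open>Killing at an independent random time\<close>

lemma inverse_time_nonneg: "0 \<le> inverse_time \<xi> t"
  unfolding inverse_time_def by (intro Inf_greatest) auto

text \<open>Strictness leaves room for a rational between a witness s and a, and monotonicity
  carries \<open>t < \<xi> s\<close> over to it. Countably many times thus decide the event.\<close>

lemma inverse_time_less_iff:
  assumes mono: "mono_on {0..} \<xi>"
  shows "inverse_time \<xi> t < ereal a \<longleftrightarrow> (\<exists>r\<in>\<rat>. 0 < r \<and> r < a \<and> t < \<xi> r)"
proof
  assume "inverse_time \<xi> t < ereal a"
  then obtain s where s: "0 < s" "t < \<xi> s" "s < a"
    unfolding inverse_time_def Inf_less_iff by auto
  from Rats_dense_in_real[OF s(3)] obtain r where r: "r \<in> \<rat>" "s < r" "r < a" by blast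
  have "\<xi> s \<le> \<xi> r" using mono_onD[OF mono, of s r] s r by simp
  then show "\<exists>r\<in>\<rat>. 0 < r \<and> r < a \<and> t < \<xi> r" using s r by (intro bexI[of _ r]) auto
next
  assume "\<exists>r\<in>\<rat>. 0 < r \<and> r < a \<and> t < \<xi> r"
  then show "inverse_time \<xi> t < ereal a"
    unfolding inverse_time_def Inf_less_iff by auto
qed

text \<open>Stated for any F that makes S measurable, since it is applied to the sigma-algebra
  generated by the subordinator alone; this is how L_t becomes independent of W.\<close>

lemma measurable_inverse_time:
  assumes S: "\<And>s. s \<ge> 0 \<Longrightarrow> S s \<in> borel_measurable F"
    and mono: "\<And>\<omega>. \<omega> \<in> space F \<Longrightarrow> mono_on {0..} (\<lambda>s. S s \<omega>)"
  shows "(\<lambda>\<omega>. inverse_time (\<lambda>s. S s \<omega>) t) \<in> borel_measurable F"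
proof -
  let ?L = "\<lambda>\<omega>. inverse_time (\<lambda>s. S s \<omega>) t"
  have lt: "{\<omega> \<in> space F. ?L \<omega> < ereal a} \<in> sets F" for a
  proof -
    have "{\<omega> \<in> space F. ?L \<omega> < ereal a} = (\<Union>r\<in>{r\<in>\<rat>. 0 < r \<and> r < a}. {\<omega> \<in> space F. t < S r \<omega>})"
      using inverse_time_less_iff[OF mono, of _ t a] by auto
    also have "\<dots> \<in> sets F"
    proof (rule sets.countable_UN'')
      show "countable {r\<in>\<rat>. 0 < r \<and> r < a}"
        by (rule countable_subset[OF _ countable_rat]) auto
      fix r assume "r \<in> {r\<in>\<rat>. 0 < r \<and> r < a}"
      then have "S r \<in> borel_measurable F" using S by simp
      then show "{\<omega> \<in> space F. t < S r \<omega>} \<in> sets F" by measurable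
    qed
    finally show ?thesis .
  qed
  have "{\<omega> \<in> space F. ?L \<omega> < y} \<in> sets F" for y
  proof (cases y)
    case (real a)
    then show ?thesis using lt[of a] by simp
  next
    case PInf
    \<comment> \<open>Finiteness is boundedness by some integer, which reduces the case to countably
      many real levels.\<close>
    have "?L \<omega> < \<infinity> \<longleftrightarrow> (\<exists>n::nat. ?L \<omega> < ereal (real n))" for \<omega>
      by (cases "?L \<omega>") (auto intro: reals_Archimedean2)
    then have "{\<omega> \<in> space F. ?L \<omega> < y} = (\<Union>n::nat. {\<omega> \<in> space F. ?L \<omega> < ereal (real n)})"
      using PInf by auto
    then show ?thesis using lt by auto
  next
    case MInf
    then show ?thesis by simp
  qed
  then show ?thesis by (rule borel_measurableI_less)
qed

text \<open>The exit time looks at s > 0 only, and time 0 is covered by X 0 in D. Conversely,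
  survival on the closed interval persists for some d > 0 beyond q, because D is open and the path
  continuous, so the infimum exceeds q strictly.\<close>

lemma less_exit_time_iff:
  fixes X :: "real \<Rightarrow> 'b::metric_space"
  assumes D: "open D" and X0: "X 0 \<in> D" and cont: "continuous_on {0..} X" and l: "0 \<le> l"
  shows "l < exit_time D X \<longleftrightarrow> (\<exists>q. l = ereal q \<and> (\<forall>s\<in>{0..q}. X s \<in> D))"
proof
  assume L: "l < exit_time D X"
  then obtain q where q: "l = ereal q" using l by (cases l) auto
  have "X s \<in> D" if s: "s \<in> {0..q}" for s
  proof (rule ccontr)
    assume "X s \<notin> D"
    with X0 s have "0 < s" by (cases "s = 0") auto
    then have "exit_time D X \<le> ereal s"
      unfolding exit_time_def using \<open>X s \<notin> D\<close> by (intro Inf_lower) auto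
    with L q s show False by (simp add: order.strict_trans2) (meson atLeastAtMost_iff ereal_less_eq(3) leD order_trans)
  qed
  with q show "\<exists>q. l = ereal q \<and> (\<forall>s\<in>{0..q}. X s \<in> D)" by blast
next
  assume "\<exists>q. l = ereal q \<and> (\<forall>s\<in>{0..q}. X s \<in> D)"
  then obtain q where q: "l = ereal q" "\<forall>s\<in>{0..q}. X s \<in> D" by blast
  have q0: "q \<ge> 0" using l q by simp
  then have "X q \<in> D" using q by simp
  then obtain e where e: "e > 0" "ball (X q) e \<subseteq> D" using D openE by blast
  have "\<exists>d>0. \<forall>s\<in>{0..}. dist s q < d \<longrightarrow> dist (X s) (X q) < e"
    using cont e q0 unfolding continuous_on_iff by simp
  then obtain d where d: "d > 0" "\<And>s. s \<ge> 0 \<Longrightarrow> dist s q < d \<Longrightarrow> dist (X s) (X q) < e" by auto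
  have "ereal (q + d) \<le> exit_time D X"
    unfolding exit_time_def
  proof (rule Inf_greatest)
    fix y assume "y \<in> {ereal s |s. 0 < s \<and> X s \<notin> D}"
    then obtain s where s: "y = ereal s" "0 < s" "X s \<notin> D" by auto
    have "q + d \<le> s"
    proof (rule ccontr)
      assume "\<not> q + d \<le> s"
      moreover have "s > q" using q(2) s by (meson atLeastAtMost_iff less_imp_le not_le)
      ultimately have "dist (X s) (X q) < e" using d(2)[of s] s by (simp add: dist_real_def)
      then show False using e s(3) by (metis dist_commute mem_ball subsetD)
    qed
    then show "ereal (q + d) \<le> y" by (simp add: s)
  qed
  then show "l < exit_time D X" using q d(1) by (metis ereal_less(2) less_ereal.simps(1) less_add_same_cancel1 order_less_le_trans)
qed

section \<open>Discrete exit and exactness of the Euler scheme\<close>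

lemma grid_point_image:
  assumes h: "h > 0" and q: "q \<ge> 0"
  shows "grid_point h q ` {1..Suc (nat \<lfloor>q / h\<rfloor>)} = insert q {real i * h | i. 1 \<le> i \<and> real i * h \<le> q}"
proof -
  have iff: "i \<le> nat \<lfloor>q / h\<rfloor> \<longleftrightarrow> real i * h \<le> q" for i
  proof -
    have "i \<le> nat \<lfloor>q / h\<rfloor> \<longleftrightarrow> real i \<le> q / h" using h q by (simp add: le_nat_iff le_floor_iff)
    then show ?thesis using h by (simp add: le_divide_eq)
  qed
  let ?n = "nat \<lfloor>q / h\<rfloor>"
  have "{1..Suc ?n} = insert (Suc ?n) {i. 1 \<le> i \<and> i \<le> ?n}" by auto
  then have "grid_point h q ` {1..Suc ?n} = insert (grid_point h q (Suc ?n)) (grid_point h q ` {i. 1 \<le> i \<and> i \<le> ?n})"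
    by (simp only: image_insert)
  also have "grid_point h q (Suc ?n) = q" by (simp add: grid_point_def)
  also have "grid_point h q ` {i. 1 \<le> i \<and> i \<le> ?n} = (\<lambda>i. real i * h) ` {i. 1 \<le> i \<and> i \<le> ?n}"
    by (rule image_cong) (auto simp: grid_point_def)
  also have "\<dots> = {real i * h | i. 1 \<le> i \<and> real i * h \<le> q}"
    unfolding iff by blast
  finally show ?thesis .
qed

text \<open>No grid point lies beyond q, so an exit later than q means that no exit is observed at
  all and the infimum is that of the empty set. Index 0, which is not monitored, comes for free from
  X 0.\<close>

lemma less_discrete_exit_time_iff:
  assumes h: "h > 0" and q: "q \<ge> 0" and X0: "X 0 \<in> D"
  shows "ereal q < discrete_exit_time h q D X \<longleftrightarrow> (\<forall>i. real i * h \<le> q \<longrightarrow> X (real i * h) \<in> D) \<and> X q \<in> D"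
proof
  assume L: "ereal q < discrete_exit_time h q D X"
  have *: "X s \<in> D" if "s \<in> grid_point h q ` {1..Suc (nat \<lfloor>q / h\<rfloor>)}" "s \<le> q" for s
  proof (rule ccontr)
    assume "X s \<notin> D"
    then have "discrete_exit_time h q D X \<le> ereal s"
      unfolding discrete_exit_time_def using that by (intro Inf_lower) auto
    also have "\<dots> \<le> ereal q" using that by simp
    finally show False using L by simp
  qed
  have "X (real i * h) \<in> D" if "real i * h \<le> q" for i
  proof (cases "i = 0")
    case False
    then have "real i * h \<in> grid_point h q ` {1..Suc (nat \<lfloor>q / h\<rfloor>)}"
      unfolding grid_point_image[OF h q] using that by auto
    then show ?thesis using * that by blast
  qed (use X0 in simp)
  moreover have "X q \<in> D" using *[of q] unfolding grid_point_image[OF h q] by auto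
  ultimately show "(\<forall>i. real i * h \<le> q \<longrightarrow> X (real i * h) \<in> D) \<and> X q \<in> D" by blast
next
  assume A: "(\<forall>i. real i * h \<le> q \<longrightarrow> X (real i * h) \<in> D) \<and> X q \<in> D"
  then have "{ereal s | s. s \<in> grid_point h q ` {1..Suc (nat \<lfloor>q / h\<rfloor>)} \<and> X s \<notin> D} = {}"
    unfolding grid_point_image[OF h q] by auto
  then have "discrete_exit_time h q D X = Inf {}"
    unfolding discrete_exit_time_def by (rule arg_cong)
  then show "ereal q < discrete_exit_time h q D X" by (simp add: top_ereal_def)
qed

lemma euler_grid_eq_diffusion:
  assumes "w 0 = 0"
  shows "euler_grid \<mu> \<sigma> x h q w i = diffusion \<mu> \<sigma> x w (grid_point h q i)"
proof (induction i)
  case 0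
  then show ?case using assms by (simp add: grid_point_def diffusion_def)
next
  case (Suc i)
  then show ?case by (simp add: diffusion_def matrix_vector_mult_diff_distrib scaleR_diff_left)
qed

text \<open>The interpolation adds exactly what the telescoping sum leaves out, whatever grid index
  is taken as left neighbour, so the identity holds at all times and for every h and q.\<close>

lemma euler_scheme_eq_diffusion:
  assumes "w 0 = 0"
  shows "euler_scheme \<mu> \<sigma> x h q w = diffusion \<mu> \<sigma> x w"
  unfolding euler_scheme_def euler_grid_eq_diffusion[where w=w, OF assms]
  by (simp add: fun_eq_iff Let_def diffusion_def matrix_vector_mult_diff_distrib scaleR_diff_left)

text \<open>The extension of the payoff by 0 is a total function that can be bounded and measured on
  the whole space; it also absorbs the condition that the final point lies in D.\<close>

definition restrict_zero :: "'b set \<Rightarrow> ('b \<Rightarrow> real) \<Rightarrow> 'b \<Rightarrow> real" where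
  "restrict_zero D f y = (if y \<in> D then f y else 0)"

definition cont_survival :: "'b set \<Rightarrow> (real \<Rightarrow> 'b) \<Rightarrow> real \<Rightarrow> bool" where
  "cont_survival D X q \<longleftrightarrow> (\<forall>s\<in>{0..q}. X s \<in> D)"

text \<open>The final grid point q is left out, because \<open>restrict_zero\<close> already
  vanishes if X q is not in D.\<close>

definition grid_survival :: "real \<Rightarrow> 'b set \<Rightarrow> (real \<Rightarrow> 'b) \<Rightarrow> real \<Rightarrow> bool" where
  "grid_survival h D X q \<longleftrightarrow> (\<forall>i. real i * h \<le> q \<longrightarrow> X (real i * h) \<in> D)"

lemma cont_survival_imp_grid_survival: "h > 0 \<Longrightarrow> cont_survival D X q \<Longrightarrow> grid_survival h D X q"
  by (simp add: cont_survival_def grid_survival_def)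

lemma killed_value_eq:
  fixes \<mu> :: "real^'d::finite"
  assumes D: "open D" and x: "x \<in> D" and w0: "w 0 = 0" and w: "continuous_on {0..} (diffusion \<mu> \<sigma> x w)"
  shows "killed_value \<mu> \<sigma> D f t x w \<xi> =
    (if inverse_time \<xi> t \<noteq> \<infinity> \<and> cont_survival D (diffusion \<mu> \<sigma> x w) (real_of_ereal (inverse_time \<xi> t))
     then restrict_zero D f (diffusion \<mu> \<sigma> x w (real_of_ereal (inverse_time \<xi> t))) else 0)"
proof -
  have X0: "diffusion \<mu> \<sigma> x w 0 \<in> D" using x w0 by (simp add: diffusion_def)
  have L0: "0 \<le> inverse_time \<xi> t" by (rule inverse_time_nonneg)
  show ?thesis
  proof (cases "inverse_time \<xi> t")
    case (real q)
    have q: "0 \<le> q" using L0 real by simp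
    show ?thesis
      unfolding killed_value_def Let_def less_exit_time_iff[OF D X0 w L0]
      using real q by (auto simp: restrict_zero_def cont_survival_def)
  qed (use L0 in \<open>auto simp: killed_value_def\<close>)
qed

lemma euler_killed_value_eq:
  fixes \<mu> :: "real^'d::finite"
  assumes h: "h > 0" and x: "x \<in> D" and w0: "w 0 = 0"
  shows "euler_killed_value \<mu> \<sigma> D f t x h w \<xi> =
    (if inverse_time \<xi> t \<noteq> \<infinity> \<and> grid_survival h D (diffusion \<mu> \<sigma> x w) (real_of_ereal (inverse_time \<xi> t))
     then restrict_zero D f (diffusion \<mu> \<sigma> x w (real_of_ereal (inverse_time \<xi> t))) else 0)"
proof -
  have X0: "diffusion \<mu> \<sigma> x w 0 \<in> D" using x w0 by (simp add: diffusion_def)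
  have L0: "0 \<le> inverse_time \<xi> t" by (rule inverse_time_nonneg)
  show ?thesis
  proof (cases "inverse_time \<xi> t")
    case (real q)
    have q: "0 \<le> q" using L0 real by simp
    show ?thesis
      using real by (auto simp: euler_killed_value_def Let_def restrict_zero_def grid_survival_def
          euler_scheme_eq_diffusion[where w=w, OF w0] less_discrete_exit_time_iff[where X="diffusion \<mu> \<sigma> x w", OF h q X0])
  qed (use L0 in \<open>auto simp: euler_killed_value_def\<close>)
qed

section \<open>Joint measurability in the path and the horizon\<close>

lemma tendsto_floor_grid: "(\<lambda>n. real (nat \<lfloor>q * real n\<rfloor>) / real n) \<longlonglongrightarrow> max 0 q"
proof (cases "q \<ge> 0")
  case True
  show ?thesis
  proof (rule tendsto_sandwich[of "\<lambda>n. q - 1 / real n" _ _ "\<lambda>n. q"])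
    have b: "q - 1 / real n \<le> real (nat \<lfloor>q * real n\<rfloor>) / real n \<and> real (nat \<lfloor>q * real n\<rfloor>) / real n \<le> q" if "n \<ge> 1" for n
    proof -
      have "0 \<le> q * real n" using True by simp
      then have "real (nat \<lfloor>q * real n\<rfloor>) \<le> q * real n" "q * real n - 1 \<le> real (nat \<lfloor>q * real n\<rfloor>)" by linarith+
      moreover have "(q - 1 / real n) * real n = q * real n - 1" using that by (simp add: left_diff_distrib)
      ultimately show ?thesis using that by (simp only: pos_le_divide_eq pos_divide_le_eq of_nat_0_less_iff)
    qed
    show "\<forall>\<^sub>F n in sequentially. q - 1 / real n \<le> real (nat \<lfloor>q * real n\<rfloor>) / real n"
      "\<forall>\<^sub>F n in sequentially. real (nat \<lfloor>q * real n\<rfloor>) / real n \<le> q"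
      using b by (auto simp: eventually_sequentially intro!: exI[of _ 1])
    have "(\<lambda>n. q - 1 / real n) \<longlonglongrightarrow> q - 0" by (intro tendsto_intros lim_const_over_n)
    then show "(\<lambda>n. q - 1 / real n) \<longlonglongrightarrow> max 0 q" using True by simp
    show "(\<lambda>n. q) \<longlonglongrightarrow> max 0 q" using True by simp
  qed
next
  case False
  \<comment> \<open>\<open>nat\<close> cuts negative floors to 0, hence the limit
    \<open>max 0 q\<close>.\<close>
  then have "nat \<lfloor>q * real n\<rfloor> = 0" for n
    by (simp add: mult_nonpos_nonneg floor_le_zero) (smt (verit) mult_nonneg_nonpos2 of_nat_0_le_iff)
  then show ?thesis using False by simp
qed

text \<open>Discretized times take countably many values, for which measurability is immediate, and
  continuity of the paths gives the limit. Continuity is known for times >= 0 only, hence the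
  \<open>max\<close>.\<close>

lemma measurable_continuous_process:
  fixes X :: "real \<Rightarrow> 'a \<Rightarrow> 'b::euclidean_space"
  assumes X: "\<And>s. s \<ge> 0 \<Longrightarrow> X s \<in> borel_measurable F"
    and cont: "\<And>\<omega>. \<omega> \<in> space F \<Longrightarrow> continuous_on {0..} (\<lambda>s. X s \<omega>)"
  shows "(\<lambda>p. X (max 0 (snd p)) (fst p)) \<in> borel_measurable (F \<Otimes>\<^sub>M borel)"
proof (rule borel_measurable_LIMSEQ_metric)
  fix n :: nat
  show "(\<lambda>p. X (real (nat \<lfloor>snd p * real n\<rfloor>) / real n) (fst p)) \<in> borel_measurable (F \<Otimes>\<^sub>M borel)"
  proof (rule measurable_compose_countable[where f="\<lambda>j p. X (real j / real n) (fst p)"])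
    show "(\<lambda>p. X (real j / real n) (fst p)) \<in> borel_measurable (F \<Otimes>\<^sub>M borel)" for j
      by (rule measurable_compose[OF measurable_fst X]) simp
    show "(\<lambda>p. nat \<lfloor>snd p * real n\<rfloor>) \<in> F \<Otimes>\<^sub>M borel \<rightarrow>\<^sub>M count_space UNIV"
      by measurable
  qed
next
  fix p :: "'a \<times> real" assume "p \<in> space (F \<Otimes>\<^sub>M borel)"
  then have p: "fst p \<in> space F" by (auto simp: space_pair_measure)
  show "(\<lambda>n. X (real (nat \<lfloor>snd p * real n\<rfloor>) / real n) (fst p)) \<longlonglongrightarrow> X (max 0 (snd p)) (fst p)"
    by (rule continuous_on_tendsto_compose[OF cont[OF p] tendsto_floor_grid]) auto
qed

text \<open>A path in the open set D over a compact interval keeps a positive distance to the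
  complement; conversely such a distance at the dense times j q / k extends to all times by
  continuity. Fractions of q instead of fixed rationals make the condition jointly measurable in the
  path and q.\<close>

lemma cont_survival_iff_countable:
  fixes X :: "real \<Rightarrow> 'b::euclidean_space"
  assumes D: "open D" "D \<noteq> UNIV" and cont: "continuous_on {0..} X" and q: "q \<ge> 0"
  shows "cont_survival D X q \<longleftrightarrow> (\<exists>n::nat. \<forall>k j::nat. j \<le> k \<longrightarrow>
    1 / real (Suc n) \<le> infdist (X (max 0 (real j / real k * q))) (- D))"
proof
  assume S: "cont_survival D X q"
  have "continuous_on {0..q} (\<lambda>s. infdist (X s) (- D))"
    by (intro continuous_on_infdist continuous_on_subset[OF cont]) auto
  then obtain s where s: "s \<in> {0..q}" "\<forall>y\<in>{0..q}. infdist (X s) (- D) \<le> infdist (X y) (- D)"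
    using continuous_attains_inf[of "{0..q}" "\<lambda>s. infdist (X s) (- D)"] q by auto
  have "X s \<notin> - D" using S s by (simp add: cont_survival_def)
  then have "infdist (X s) (- D) \<noteq> 0"
    using in_closed_iff_infdist_zero[of "- D" "X s"] D by auto
  then have "infdist (X s) (- D) > 0" using infdist_nonneg[of "X s" "- D"] by linarith
  then obtain n where n: "1 / real (Suc n) < infdist (X s) (- D)" using nat_approx_posE by blast
  have "max 0 (real j / real k * q) \<in> {0..q}" if "j \<le> k" for j k
    using that q by (cases "k = 0") (auto simp: field_simps mult_left_mono)
  then show "\<exists>n::nat. \<forall>k j::nat. j \<le> k \<longrightarrow> 1 / real (Suc n) \<le> infdist (X (max 0 (real j / real k * q))) (- D)"
    using n s by (intro exI[of _ n]) (meson less_imp_le order_trans)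
next
  assume "\<exists>n::nat. \<forall>k j::nat. j \<le> k \<longrightarrow> 1 / real (Suc n) \<le> infdist (X (max 0 (real j / real k * q))) (- D)"
  then obtain n :: nat where n: "\<And>k j::nat. j \<le> k \<Longrightarrow> 1 / real (Suc n) \<le> infdist (X (max 0 (real j / real k * q))) (- D)"
    by blast
  show "cont_survival D X q"
    unfolding cont_survival_def
  proof
    fix s assume s: "s \<in> {0..q}"
    define r where "r = (if q = 0 then 0 else s / q)"
    have r: "0 \<le> r" "r \<le> 1" "r * q = s" using s by (auto simp: r_def)
    have "(\<lambda>k. max 0 (real (nat \<lfloor>r * real k\<rfloor>) / real k * q)) \<longlonglongrightarrow> max 0 (max 0 r * q)"
      by (intro tendsto_intros tendsto_floor_grid)
    then have lim: "(\<lambda>k. max 0 (real (nat \<lfloor>r * real k\<rfloor>) / real k * q)) \<longlonglongrightarrow> s"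
      using r s by simp
    have lim1: "(\<lambda>k. infdist (X (max 0 (real (nat \<lfloor>r * real k\<rfloor>) / real k * q))) (- D)) \<longlonglongrightarrow> infdist (X s) (- D)"
      by (intro tendsto_infdist continuous_on_tendsto_compose[OF cont lim]) (use s in auto)
    have ge: "1 / real (Suc n) \<le> infdist (X (max 0 (real (nat \<lfloor>r * real k\<rfloor>) / real k * q))) (- D)" for k
    proof (rule n)
      have "r * real k \<le> 1 * real k" using r by (intro mult_right_mono) auto
      then have "\<lfloor>r * real k\<rfloor> \<le> int k" by (simp add: floor_le_iff)
      then show "nat \<lfloor>r * real k\<rfloor> \<le> k" by simp
    qed
    have "1 / real (Suc n) \<le> infdist (X s) (- D)"
      using LIMSEQ_le_const[OF lim1, of "1 / real (Suc n)"] ge by blast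
    then have "infdist (X s) (- D) \<noteq> 0" by (smt (verit) divide_pos_pos of_nat_0_less_iff zero_less_Suc)
    then show "X s \<in> D" by (metis ComplI infdist_zero)
  qed
qed

lemma pred_cont_survival:
  fixes X :: "real \<Rightarrow> 'a \<Rightarrow> 'b::euclidean_space"
  assumes X: "\<And>s. s \<ge> 0 \<Longrightarrow> X s \<in> borel_measurable F"
    and cont: "\<And>\<omega>. \<omega> \<in> space F \<Longrightarrow> continuous_on {0..} (\<lambda>s. X s \<omega>)"
    and D: "open D" "D \<noteq> UNIV"
  shows "Measurable.pred (F \<Otimes>\<^sub>M borel) (\<lambda>p. 0 \<le> snd p \<and> cont_survival D (\<lambda>s. X s (fst p)) (snd p))"
proof -
  have m: "(\<lambda>p. infdist (X (max 0 (c * snd p)) (fst p)) (- D)) \<in> borel_measurable (F \<Otimes>\<^sub>M borel)" for c :: real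
  proof -
    have "(\<lambda>p. (fst p, c * snd p)) \<in> F \<Otimes>\<^sub>M borel \<rightarrow>\<^sub>M F \<Otimes>\<^sub>M borel" by measurable
    from measurable_compose[OF this measurable_continuous_process[OF X cont]]
    have "(\<lambda>p. X (max 0 (c * snd p)) (fst p)) \<in> borel_measurable (F \<Otimes>\<^sub>M borel)" by simp
    then show ?thesis
      by (rule measurable_compose) (auto intro!: borel_measurable_continuous_onI continuous_on_infdist)
  qed
  note [measurable] = m[of "real _ / real _"]
  have pm: "Measurable.pred (F \<Otimes>\<^sub>M borel) (\<lambda>p. 0 \<le> snd p \<and> (\<exists>n::nat. \<forall>k j::nat. j \<le> k \<longrightarrow>
    1 / real (Suc n) \<le> infdist (X (max 0 (real j / real k * snd p)) (fst p)) (- D)))"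
    by measurable
  have eq: "0 \<le> snd p \<and> (\<exists>n::nat. \<forall>k j::nat. j \<le> k \<longrightarrow>
      1 / real (Suc n) \<le> infdist (X (max 0 (real j / real k * snd p)) (fst p)) (- D))
    \<longleftrightarrow> 0 \<le> snd p \<and> cont_survival D (\<lambda>s. X s (fst p)) (snd p)" if "p \<in> space (F \<Otimes>\<^sub>M borel)" for p
  proof (cases "0 \<le> snd p")
    case True
    have "fst p \<in> space F" using that by (auto simp: space_pair_measure)
    from cont_survival_iff_countable[OF D cont[OF this] True] show ?thesis by (simp only: True simp_thms)
  qed simp
  show ?thesis by (rule measurable_cong[THEN iffD1, OF eq pm])
qed

lemma pred_grid_survival:
  fixes X :: "real \<Rightarrow> 'a \<Rightarrow> 'b::euclidean_space"
  assumes X: "\<And>s. s \<ge> 0 \<Longrightarrow> X s \<in> borel_measurable F"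
    and D: "open D" and h: "h > 0"
  shows "Measurable.pred (F \<Otimes>\<^sub>M borel) (\<lambda>p. grid_survival h D (\<lambda>s. X s (fst p)) (snd p))"
proof -
  have [measurable]: "D \<in> sets borel" using D by simp
  have [measurable]: "(\<lambda>p. X (real i * h) (fst p)) \<in> borel_measurable (F \<Otimes>\<^sub>M (borel :: real measure))" for i
    by (rule measurable_compose[OF measurable_fst X]) (use h in simp)
  show ?thesis unfolding grid_survival_def by measurable
qed

text \<open>The common form of Z and Z_h, which differ in the survival condition only. The time is
  an arbitrary extended real, as L_t is so typed; the guards give the value 0 at negative and
  infinite times.\<close>

definition killed_at :: "'b set \<Rightarrow> ('b \<Rightarrow> real) \<Rightarrow> ((real \<Rightarrow> 'b) \<Rightarrow> real \<Rightarrow> bool) \<Rightarrow> (real \<Rightarrow> 'b) \<Rightarrow> ereal \<Rightarrow> real" where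
  "killed_at D f surv X l =
     (if 0 \<le> l \<and> l \<noteq> \<infinity> \<and> surv X (real_of_ereal l) then restrict_zero D f (X (real_of_ereal l)) else 0)"

lemma measurable_killed_at:
  fixes X :: "real \<Rightarrow> 'a \<Rightarrow> 'b::euclidean_space"
  assumes X: "\<And>s. s \<ge> 0 \<Longrightarrow> X s \<in> borel_measurable F"
    and cont: "\<And>\<omega>. \<omega> \<in> space F \<Longrightarrow> continuous_on {0..} (\<lambda>s. X s \<omega>)"
    and surv: "Measurable.pred (F \<Otimes>\<^sub>M borel) (\<lambda>p. 0 \<le> snd p \<and> surv (\<lambda>s. X s (fst p)) (snd p))"
    and f: "restrict_zero D f \<in> borel_measurable borel"
  shows "(\<lambda>p. killed_at D f surv (\<lambda>s. X s (fst p)) (snd p)) \<in> borel_measurable (F \<Otimes>\<^sub>M borel)"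
proof -
  have T: "(\<lambda>p. (fst p, real_of_ereal (snd p))) \<in> F \<Otimes>\<^sub>M borel \<rightarrow>\<^sub>M F \<Otimes>\<^sub>M borel" by measurable
  have [measurable]: "Measurable.pred (F \<Otimes>\<^sub>M borel) (\<lambda>p. 0 \<le> real_of_ereal (snd p) \<and> surv (\<lambda>s. X s (fst p)) (real_of_ereal (snd p)))"
    using measurable_compose[OF T surv] by simp
  have [measurable]: "(\<lambda>p. restrict_zero D f (X (max 0 (real_of_ereal (snd p))) (fst p))) \<in> borel_measurable (F \<Otimes>\<^sub>M borel)"
    using measurable_compose[OF measurable_compose[OF T measurable_continuous_process[OF X cont]] f] by simp
  have "(\<lambda>p. killed_at D f surv (\<lambda>s. X s (fst p)) (snd p)) =
    (\<lambda>p. if 0 \<le> snd p \<and> snd p \<noteq> \<infinity> \<and> (0 \<le> real_of_ereal (snd p) \<and> surv (\<lambda>s. X s (fst p)) (real_of_ereal (snd p)))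
      then restrict_zero D f (X (max 0 (real_of_ereal (snd p))) (fst p)) else 0)"
    by (auto simp: fun_eq_iff killed_at_def real_of_ereal_pos)
  also have "\<dots> \<in> borel_measurable (F \<Otimes>\<^sub>M borel)" by measurable
  finally show ?thesis .
qed

section \<open>Path sigma-algebras and fixing the horizon\<close>

abbreviation process_algebra :: "'a measure \<Rightarrow> (real \<Rightarrow> 'a \<Rightarrow> 'b::topological_space) \<Rightarrow> 'a measure" where
  "process_algebra M X \<equiv> vimage_algebra (space M) (\<lambda>\<omega>. \<lambda>s\<in>{0..}. X s \<omega>) (\<Pi>\<^sub>M s\<in>{0..}. borel)"

lemma measurable_process_algebra:
  assumes "s \<ge> 0"
  shows "X s \<in> borel_measurable (process_algebra M X)"
proof -
  have "(\<lambda>\<omega>. \<lambda>s\<in>{0..}. X s \<omega>) \<in> process_algebra M X \<rightarrow>\<^sub>M (\<Pi>\<^sub>M s\<in>{0..}. borel)"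
    by (rule measurable_vimage_algebra1) (auto simp: space_PiM)
  from measurable_compose[OF this measurable_component_singleton[of s]]
  have "(\<lambda>\<omega>. (\<lambda>s\<in>{0..}. X s \<omega>) s) \<in> borel_measurable (process_algebra M X)" using assms by simp
  then show ?thesis using assms by simp
qed

lemma subalgebra_process_algebra:
  assumes "\<And>s. s \<ge> 0 \<Longrightarrow> X s \<in> borel_measurable M"
  shows "subalgebra M (process_algebra M X)"
proof -
  have "(\<lambda>\<omega>. \<lambda>s\<in>{0..}. X s \<omega>) \<in> M \<rightarrow>\<^sub>M (\<Pi>\<^sub>M s\<in>{0..}. borel)"
    by (rule measurable_restrict) (use assms in auto)
  from measurable_sets[OF this] show ?thesis
    by (subst subalgebra_def, subst sets_vimage_algebra2) (auto simp: space_PiM)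
qed

text \<open>L_t is a function of the subordinator, hence independent of the path sigma-algebra of W,
  and the horizon can be fixed at l before integrating over W. For fixed l the two payoffs differ
  only if D is left unnoticed by the grid, and then by at most A times the distance of the endpoint
  to the complement. The bound is uniform in l and survives integration over the law of L_t.\<close>

theorem killed_euler_weak_error:
  fixes W :: "real \<Rightarrow> 'a \<Rightarrow> real^'d::finite" and \<sigma> :: "real^'d^'d" and f :: "real^'d \<Rightarrow> real"
    and \<mu> x :: "real^'d" and t :: real
  assumes bm: "standard_brownian_motion M W" and sub: "subordinator M S b \<nu>"
    and ind: "indep_processes M W S"
    and m: "m > 0" "\<And>v. m * (v \<bullet> v) \<le> v \<bullet> ((\<sigma> ** transpose \<sigma>) *v v)"
    and D: "open D" "bounded D" and x: "x \<in> D" and R: "R > 0"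
    and exterior: "\<forall>z\<in>frontier D. \<exists>c. dist z c = R \<and> ball c R \<inter> D = {}"
    and f: "restrict_zero D f \<in> borel_measurable borel" and f_bd: "\<And>y. \<bar>restrict_zero D f y\<bar> \<le> B"
    and f_dist: "\<And>y. \<bar>restrict_zero D f y\<bar> \<le> A * infdist y (- D)" and A: "A \<ge> 0"
    and \<gamma>: "0 < \<gamma>" "\<gamma> < 1/2"
    and Z_def: "\<And>\<omega>. Z \<omega> = killed_value \<mu> \<sigma> D f t x (\<lambda>s. W s \<omega>) (\<lambda>s. S s \<omega>)"
    and Zh_def: "\<And>h \<omega>. Zh h \<omega> = euler_killed_value \<mu> \<sigma> D f t x h (\<lambda>s. W s \<omega>) (\<lambda>s. S s \<omega>)"
  shows "Z \<in> borel_measurable M" "\<And>\<omega>. \<omega> \<in> space M \<Longrightarrow> \<bar>Z \<omega>\<bar> \<le> B"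
    "\<And>h. h > 0 \<Longrightarrow> Zh h \<in> borel_measurable M" "\<And>h \<omega>. h > 0 \<Longrightarrow> \<omega> \<in> space M \<Longrightarrow> \<bar>Zh h \<omega>\<bar> \<le> B"
    "\<exists>C h0. C > 0 \<and> h0 > 0 \<and> (\<forall>h. 0 < h \<longrightarrow> h \<le> h0 \<longrightarrow>
      (\<integral>\<^sup>+\<omega>. ennreal \<bar>Zh h \<omega> - Z \<omega>\<bar> \<partial>M) \<le> ennreal (C * h powr \<gamma>))"
proof -
  interpret prob_space M using bm by (simp add: standard_brownian_motion_def)
  define X where "X s \<omega> = diffusion \<mu> \<sigma> x (\<lambda>s. W s \<omega>) s" for s \<omega>
  define L where "L \<omega> = inverse_time (\<lambda>s. S s \<omega>) t" for \<omega>
  let ?F = "process_algebra M W" and ?G = "process_algebra M S"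
  have Wm: "W s \<in> borel_measurable M" if "s \<ge> 0" for s using bm that by (auto simp: standard_brownian_motion_def)
  have Sm: "S s \<in> borel_measurable M" if "s \<ge> 0" for s using sub that by (auto simp: subordinator_def)
  have W0: "W 0 \<omega> = 0" and Wc: "continuous_on {0..} (\<lambda>s. W s \<omega>)" if "\<omega> \<in> space M" for \<omega>
    using bm that by (auto simp: standard_brownian_motion_def)
  have smono: "mono_on {0..} (\<lambda>s. S s \<omega>)" if "\<omega> \<in> space M" for \<omega>
    using sub that by (auto simp: subordinator_def)
  have subF: "subalgebra M ?F" by (rule subalgebra_process_algebra[OF Wm])
  have subG: "subalgebra M ?G" by (rule subalgebra_process_algebra[OF Sm])
  have LG: "L \<in> borel_measurable ?G"
    unfolding L_def[abs_def] by (rule measurable_inverse_time) (auto intro: measurable_process_algebra smono)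
  have LM[measurable]: "L \<in> borel_measurable M" by (rule measurable_from_subalg[OF subG LG])
  have L0: "0 \<le> L \<omega>" for \<omega> unfolding L_def by (rule inverse_time_nonneg)
  have XF: "X s \<in> borel_measurable ?F" if "s \<ge> 0" for s
  proof -
    have [measurable]: "W s \<in> borel_measurable ?F" by (rule measurable_process_algebra[OF that])
    show ?thesis unfolding X_def[abs_def] diffusion_def by measurable
  qed
  have Xc: "continuous_on {0..} (\<lambda>s. X s \<omega>)" if "\<omega> \<in> space M" for \<omega>
  proof -
    have "continuous_on {0..} (\<lambda>s. \<sigma> *v W s \<omega>)"
      by (rule linear_continuous_on_compose[OF Wc[OF that]]) (rule matrix_vector_mul_linear)
    then show ?thesis unfolding X_def diffusion_def by (intro continuous_intros)
  qed
  have Xc': "continuous_on {0..} (\<lambda>s. X s \<omega>)" if "\<omega> \<in> space ?F" for \<omega> using Xc that by simp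
  have DU: "D \<noteq> UNIV" using D(2) not_bounded_UNIV by auto
  define Kc where "Kc \<omega> l = killed_at D f (cont_survival D) (\<lambda>s. X s \<omega>) l" for \<omega> l
  define Kh where "Kh h \<omega> l = killed_at D f (grid_survival h D) (\<lambda>s. X s \<omega>) l" for h \<omega> l
  have Xd: "diffusion \<mu> \<sigma> x (\<lambda>s. W s \<omega>) = (\<lambda>s. X s \<omega>)" for \<omega>
    by (simp add: X_def fun_eq_iff)
  have Z: "Z \<omega> = Kc \<omega> (L \<omega>)" if \<omega>: "\<omega> \<in> space M" for \<omega>
    unfolding Z_def using L0[of \<omega>]
    by (subst killed_value_eq[where w="\<lambda>s. W s \<omega>", OF D(1) x W0[OF \<omega>]])
       (use Xc[OF \<omega>] in \<open>simp_all add: Xd Kc_def killed_at_def L_def\<close>)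
  have Zh: "Zh h \<omega> = Kh h \<omega> (L \<omega>)" if h: "h > 0" and \<omega>: "\<omega> \<in> space M" for h \<omega>
    unfolding Zh_def using L0[of \<omega>]
    by (subst euler_killed_value_eq[where w="\<lambda>s. W s \<omega>", OF h x W0[OF \<omega>]])
       (simp_all add: Xd Kh_def killed_at_def L_def)
  have B0: "B \<ge> 0" using f_bd[of x] by linarith
  have Kb: "\<bar>killed_at D f surv Y l\<bar> \<le> B" for surv Y l
    using f_bd B0 by (auto simp: killed_at_def)
  have pc: "Measurable.pred (?F \<Otimes>\<^sub>M borel) (\<lambda>p. 0 \<le> snd p \<and> cont_survival D (\<lambda>s. X s (fst p)) (snd p))"
    by (rule pred_cont_survival[OF XF Xc' D(1) DU])
  have ph: "Measurable.pred (?F \<Otimes>\<^sub>M borel) (\<lambda>p. grid_survival h D (\<lambda>s. X s (fst p)) (snd p))" if "h > 0" for h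
    by (rule pred_grid_survival[OF XF D(1) that])
  have Kcm: "(\<lambda>p. Kc (fst p) (snd p)) \<in> borel_measurable (?F \<Otimes>\<^sub>M borel)"
    unfolding Kc_def by (rule measurable_killed_at[OF XF Xc' pc f])
  have Khm: "(\<lambda>p. Kh h (fst p) (snd p)) \<in> borel_measurable (?F \<Otimes>\<^sub>M borel)" if "h > 0" for h
  proof -
    have "Measurable.pred (?F \<Otimes>\<^sub>M borel) (\<lambda>p. 0 \<le> snd p \<and> grid_survival h D (\<lambda>s. X s (fst p)) (snd p))"
      using ph[OF that] by measurable
    from measurable_killed_at[where surv="grid_survival h D", OF XF Xc' this f]
    show ?thesis unfolding Kh_def .
  qed
  have idF: "(\<lambda>\<omega>. \<omega>) \<in> M \<rightarrow>\<^sub>M ?F"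
    by (rule measurable_from_subalg[OF subF]) simp
  have pairL: "(\<lambda>\<omega>. (\<omega>, L \<omega>)) \<in> M \<rightarrow>\<^sub>M ?F \<Otimes>\<^sub>M borel"
    by (rule measurable_Pair[OF idF LM])
  show "Z \<in> borel_measurable M"
    using measurable_compose[OF pairL Kcm] Z by (simp cong: measurable_cong)
  show "Zh h \<in> borel_measurable M" if "h > 0" for h
    using measurable_compose[OF pairL Khm[OF that]] Zh[OF that] by (simp cong: measurable_cong)
  show "\<bar>Z \<omega>\<bar> \<le> B" if "\<omega> \<in> space M" for \<omega>
    using Kb Z[OF that] by (simp add: Kc_def)
  show "\<bar>Zh h \<omega>\<bar> \<le> B" if "h > 0" "\<omega> \<in> space M" for h \<omega>
    using Kb Zh[OF that] by (simp add: Kh_def)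
  have indep: "prob (E \<inter> (L -` Q \<inter> space M)) = prob E * prob (L -` Q \<inter> space M)"
    if E: "E \<in> sets ?F" and Q: "Q \<in> sets borel" for E Q
  proof -
    have i: "indep_set (process_sets M W) (process_sets M S)" using ind by (simp add: indep_processes_def)
    have "L -` Q \<inter> space M \<in> process_sets M S"
      using measurable_sets[OF LG Q] by (simp add: process_sets_def)
    moreover have "E \<in> process_sets M W" using E by (simp add: process_sets_def)
    ultimately show ?thesis using indep_setD[OF i] by blast
  qed
  have Dne: "D \<noteq> {}" using x by blast
  obtain C h0 where C: "C > 0" "0 < h0"
    and bias: "\<And>h q x. 0 < h \<Longrightarrow> h \<le> h0 \<Longrightarrow> 0 \<le> q \<Longrightarrow>
      (\<integral>\<^sup>+\<omega>. indicator {\<omega>\<in>space M. (\<forall>i. real i * h \<le> q \<longrightarrow> diffusion \<mu> \<sigma> x (\<lambda>s. W s \<omega>) (real i * h) \<in> D) \<and>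
          (\<exists>s\<in>{0..q}. diffusion \<mu> \<sigma> x (\<lambda>s. W s \<omega>) s \<notin> D)} \<omega>
        * ennreal (infdist (diffusion \<mu> \<sigma> x (\<lambda>s. W s \<omega>) q) (- D)) \<partial>M) \<le> ennreal (C * h powr \<gamma>)"
    by (rule discrete_exit_bias[OF bm m D Dne R exterior[rule_format] \<gamma>, of \<mu>]) (assumption, rule that, assumption+)
  show "\<exists>C h0. C > 0 \<and> h0 > 0 \<and> (\<forall>h. 0 < h \<longrightarrow> h \<le> h0 \<longrightarrow>
      (\<integral>\<^sup>+\<omega>. ennreal \<bar>Zh h \<omega> - Z \<omega>\<bar> \<partial>M) \<le> ennreal (C * h powr \<gamma>))"
  \<comment> \<open>A + 1 keeps the constant positive when A = 0.\<close>
  proof (rule exI[of _ "(A + 1) * C"], rule exI[of _ h0], intro conjI allI impI)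
    show "(A + 1) * C > 0" "h0 > 0" using C A by auto
    fix h :: real assume h: "0 < h" "h \<le> h0"
    let ?H = "\<lambda>p. ennreal \<bar>Kh h (fst p) (snd p) - Kc (fst p) (snd p)\<bar>"
    have Hm: "?H \<in> borel_measurable (?F \<Otimes>\<^sub>M borel)"
      using Khm[OF h(1)] Kcm by measurable
    have "(\<integral>\<^sup>+\<omega>. ennreal \<bar>Zh h \<omega> - Z \<omega>\<bar> \<partial>M) = (\<integral>\<^sup>+\<omega>. ?H (\<omega>, L \<omega>) \<partial>M)"
      by (rule nn_integral_cong) (simp add: Zh[OF h(1)] Z)
    also have "\<dots> = (\<integral>\<^sup>+l. (\<integral>\<^sup>+\<omega>. ?H (\<omega>, l) \<partial>M) \<partial>distr M borel L)"
      by (rule nn_integral_freeze(2)[OF subF LM indep Hm])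
    also have "\<dots> \<le> (\<integral>\<^sup>+l. ennreal ((A + 1) * C * h powr \<gamma>) \<partial>distr M borel L)"
    proof (intro nn_integral_mono)
      fix l :: ereal
      show "(\<integral>\<^sup>+\<omega>. ?H (\<omega>, l) \<partial>M) \<le> ennreal ((A + 1) * C * h powr \<gamma>)"
      proof (cases "0 \<le> l \<and> l \<noteq> \<infinity>")
        case False
        then have "Kh h \<omega> l = 0" "Kc \<omega> l = 0" for \<omega> by (auto simp: Kh_def Kc_def killed_at_def)
        then show ?thesis by simp
      next
        case True
        then obtain q where q: "l = ereal q" "q \<ge> 0" by (cases l) auto
        \<comment> \<open>The event that the path leaves D up to time q unnoticed by the grid. Off
          this event the two survival conditions agree, as continuous survival always implies
          survival on the grid.\<close>
        define Sq where "Sq = {\<omega>\<in>space M. (\<forall>i. real i * h \<le> q \<longrightarrow> X (real i * h) \<omega> \<in> D) \<and> (\<exists>s\<in>{0..q}. X s \<omega> \<notin> D)}"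
        have slice: "(\<lambda>\<omega>. (\<omega>, q)) \<in> M \<rightarrow>\<^sub>M ?F \<Otimes>\<^sub>M borel" by (rule measurable_Pair[OF idF]) simp
        have 1: "Measurable.pred M (\<lambda>\<omega>. 0 \<le> q \<and> cont_survival D (\<lambda>s. X s \<omega>) q)"
          using measurable_compose[OF slice pc] unfolding fst_conv snd_conv .
        have 2: "Measurable.pred M (\<lambda>\<omega>. grid_survival h D (\<lambda>s. X s \<omega>) q)"
          using measurable_compose[OF slice ph[OF h(1)]] unfolding fst_conv snd_conv .
        have "{\<omega>\<in>space M. grid_survival h D (\<lambda>s. X s \<omega>) q} - {\<omega>\<in>space M. 0 \<le> q \<and> cont_survival D (\<lambda>s. X s \<omega>) q} \<in> sets M"
          by (rule sets.Diff[OF predE[OF 2] predE[OF 1]])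
        also have "{\<omega>\<in>space M. grid_survival h D (\<lambda>s. X s \<omega>) q} - {\<omega>\<in>space M. 0 \<le> q \<and> cont_survival D (\<lambda>s. X s \<omega>) q} = Sq"
          using q by (auto simp: Sq_def grid_survival_def cont_survival_def)
        finally have [measurable]: "Sq \<in> sets M" .
        have [measurable]: "X q \<in> borel_measurable M"
          by (rule measurable_from_subalg[OF subF XF[OF q(2)]])
        have [measurable]: "(\<lambda>\<omega>. infdist (X q \<omega>) (- D)) \<in> borel_measurable M"
          by (rule measurable_compose[of "X q"]) (auto intro!: borel_measurable_continuous_onI continuous_on_infdist)
        have "(\<integral>\<^sup>+\<omega>. ?H (\<omega>, l) \<partial>M) \<le> (\<integral>\<^sup>+\<omega>. ennreal A * (indicator Sq \<omega> * ennreal (infdist (X q \<omega>) (- D))) \<partial>M)"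
        proof (intro nn_integral_mono)
          fix \<omega> assume \<omega>: "\<omega> \<in> space M"
          show "?H (\<omega>, l) \<le> ennreal A * (indicator Sq \<omega> * ennreal (infdist (X q \<omega>) (- D)))"
          proof (cases "\<omega> \<in> Sq")
            case True
            then have "\<bar>Kh h \<omega> l - Kc \<omega> l\<bar> = \<bar>restrict_zero D f (X q \<omega>)\<bar>"
              using q by (auto simp: Sq_def Kh_def Kc_def killed_at_def grid_survival_def cont_survival_def)
            then have "?H (\<omega>, l) \<le> ennreal (A * infdist (X q \<omega>) (- D))"
              using f_dist[of "X q \<omega>"] by (simp add: ennreal_leI)
            then show ?thesis using True A by (simp add: ennreal_mult infdist_nonneg)
          next
            case False
            then have "grid_survival h D (\<lambda>s. X s \<omega>) q \<longleftrightarrow> cont_survival D (\<lambda>s. X s \<omega>) q"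
              using \<omega> cont_survival_imp_grid_survival[OF h(1), of D "\<lambda>s. X s \<omega>" q]
              by (auto simp: Sq_def grid_survival_def cont_survival_def)
            then have "Kh h \<omega> l = Kc \<omega> l" using q by (simp add: Kh_def Kc_def killed_at_def)
            then show ?thesis by simp
          qed
        qed
        also have "\<dots> = ennreal A * (\<integral>\<^sup>+\<omega>. indicator Sq \<omega> * ennreal (infdist (X q \<omega>) (- D)) \<partial>M)"
          by (rule nn_integral_cmult) measurable
        also have "\<dots> \<le> ennreal A * ennreal (C * h powr \<gamma>)"
          using bias[OF h q(2), of x] by (intro mult_left_mono) (simp_all add: X_def Sq_def)
        also have "\<dots> \<le> ennreal ((A + 1) * C * h powr \<gamma>)"
          using A C by (auto simp: ennreal_mult[symmetric] algebra_simps intro!: ennreal_leI)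
        finally show ?thesis .
      qed
    qed
    also have "\<dots> = ennreal ((A + 1) * C * h powr \<gamma>)"
    proof -
      interpret l: prob_space "distr M borel L" by (rule prob_space_distr) simp
      show ?thesis using l.emeasure_space_1 by simp
    qed
    finally show "(\<integral>\<^sup>+\<omega>. ennreal \<bar>Zh h \<omega> - Z \<omega>\<bar> \<partial>M) \<le> ennreal ((A + 1) * C * h powr \<gamma>)" .
  qed
qed

section \<open>The payoff near the boundary\<close>

text \<open>Where f is not 0, the distance to the complement is at least 2 \<epsilon>, since it is
  no smaller than the distance to some frontier point; there B is at most B / (2 \<epsilon>) times
  the distance.\<close>

lemma restrict_zero_supported_away:
  fixes D :: "'a::euclidean_space set"
  assumes D: "open D" "bounded D"
    and bd: "bounded (f ` D)" and m: "f \<in> borel_measurable (restrict_space borel D)"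
    and \<epsilon>: "\<epsilon> > 0" and supp: "supp_in D f = {} \<or> 2 * \<epsilon> \<le> setdist (supp_in D f) (frontier D)"
  shows "restrict_zero D f \<in> borel_measurable borel"
    and "\<exists>B A. A \<ge> 0 \<and> (\<forall>y. \<bar>restrict_zero D f y\<bar> \<le> B) \<and> (\<forall>y. \<bar>restrict_zero D f y\<bar> \<le> A * infdist y (- D))"
proof -
  have "(\<lambda>x. f x * indicator D x) \<in> borel_measurable borel"
    using m D by (subst (asm) borel_measurable_restrict_space_iff) (auto simp: mult.commute)
  moreover have "(\<lambda>x. f x * indicator D x) = restrict_zero D f"
    by (auto simp: fun_eq_iff restrict_zero_def)
  ultimately show "restrict_zero D f \<in> borel_measurable borel" by simp
  obtain B where B: "B > 0" "\<And>y. y \<in> D \<Longrightarrow> \<bar>f y\<bar> \<le> B"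
    using bd unfolding bounded_pos by auto
  have "\<bar>restrict_zero D f y\<bar> \<le> B / (2 * \<epsilon>) * infdist y (- D)" for y
  proof (cases "y \<in> D \<and> f y \<noteq> 0")
    case True
    obtain q where q: "q \<in> frontier D" "dist y q \<le> infdist y (- D)"
      using frontier_point_within_infdist[OF D] True by blast
    have y: "y \<in> supp_in D f" unfolding supp_in_def using True by (intro closure_subset[THEN subsetD]) auto
    then have "2 * \<epsilon> \<le> setdist (supp_in D f) (frontier D)" using supp by blast
    also have "\<dots> \<le> dist y q" by (rule setdist_le_dist[OF y q(1)])
    finally have "2 * \<epsilon> \<le> infdist y (- D)" using q by simp
    then have "B / (2 * \<epsilon>) * (2 * \<epsilon>) \<le> B / (2 * \<epsilon>) * infdist y (- D)"
      using B \<epsilon> by (intro mult_left_mono) auto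
    then show ?thesis using B(2)[of y] True \<epsilon> by (simp add: restrict_zero_def)
  next
    case False
    then have "restrict_zero D f y = 0" by (auto simp: restrict_zero_def)
    then show ?thesis using B \<epsilon> infdist_nonneg[of y "- D"] by simp
  qed
  moreover have "\<bar>restrict_zero D f y\<bar> \<le> B" for y using B by (auto simp: restrict_zero_def)
  moreover have "B / (2 * \<epsilon>) \<ge> 0" using B \<epsilon> by simp
  ultimately show "\<exists>B A. A \<ge> 0 \<and> (\<forall>y. \<bar>restrict_zero D f y\<bar> \<le> B) \<and> (\<forall>y. \<bar>restrict_zero D f y\<bar> \<le> A * infdist y (- D))"
    by blast
qed

text \<open>At points of D the limit defining \<open>closure_partial\<close> is the partial
  derivative itself, by its continuity, so boundedness on the closure passes to the gradient in
  D.\<close>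

lemma C_k_alpha_closure_grad_bounded:
  fixes f :: "real^'d::finite \<Rightarrow> real"
  assumes D: "open D" and f: "C_k_alpha_closure k \<alpha> D f" and k: "k \<ge> 1"
  obtains G where "G \<ge> 0" "\<And>z. z \<in> D \<Longrightarrow> norm (grad f z) \<le> G"
proof -
  have "\<exists>B. \<forall>z\<in>D. \<bar>partial_deriv i f z\<bar> \<le> B" for i
  proof -
    have "\<forall>\<beta>. length \<beta> \<le> k \<longrightarrow> continuous_on (closure D) (closure_partial D \<beta> f) \<and>
                         bounded (closure_partial D \<beta> f ` closure D)"
      using f unfolding C_k_alpha_closure_def by blast
    from this[rule_format, of "[i]"] obtain B where B: "\<And>z. z \<in> closure D \<Longrightarrow> \<bar>closure_partial D [i] f z\<bar> \<le> B"
      using k unfolding bounded_iff by auto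
    have "\<forall>\<beta>. length \<beta> \<le> k \<longrightarrow> continuous_on D (iter_partial \<beta> f)"
      using f unfolding C_k_alpha_closure_def C_k_on_def by blast
    from this[rule_format, of "[i]"] have c: "continuous_on D (partial_deriv i f)" using k by simp
    have "closure_partial D [i] f z = partial_deriv i f z" if z: "z \<in> D" for z
    proof -
      have "(partial_deriv i f \<longlongrightarrow> partial_deriv i f z) (at z within D)"
        using c z by (simp add: continuous_on_def)
      moreover have "at z within D \<noteq> bot" unfolding at_within_open[OF z D] by (rule at_neq_bot)
      ultimately show ?thesis unfolding closure_partial_def by (simp add: tendsto_Lim)
    qed
    then show ?thesis using B closure_subset[of D] by (intro exI[of _ B]) (metis subsetD)
  qed
  then obtain B where B: "\<And>i z. z \<in> D \<Longrightarrow> \<bar>partial_deriv i f z\<bar> \<le> B i" by metis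
  show thesis
  proof (rule that[of "\<bar>\<Sum>i\<in>UNIV. B i\<bar>"])
    fix z assume "z \<in> D"
    have "norm (grad f z) \<le> (\<Sum>i\<in>UNIV. \<bar>grad f z $ i\<bar>)" by (rule norm_le_l1_cart)
    also have "\<dots> \<le> (\<Sum>i\<in>UNIV. B i)" using B[OF \<open>z \<in> D\<close>] by (intro sum_mono) (simp add: grad_def)
    finally show "norm (grad f z) \<le> \<bar>\<Sum>i\<in>UNIV. B i\<bar>" by linarith
  qed simp
qed

text \<open>D need not be convex, but the segment from y to a nearest frontier point stays in D up
  to its end, because its inner points are closer to y than the complement is. Along it the mean
  value theorem with the bounded gradient gives the linear bound.\<close>

lemma restrict_zero_vanishing_boundary:
  fixes f :: "real^'d::finite \<Rightarrow> real"
  assumes D: "open D" "bounded D" and f: "C_k_alpha_closure k \<alpha> D f" and k: "k \<ge> 1"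
    and zero: "\<And>z. z \<in> frontier D \<Longrightarrow> f z = 0"
  shows "restrict_zero D f \<in> borel_measurable borel"
    and "\<exists>B A. A \<ge> 0 \<and> (\<forall>y. \<bar>restrict_zero D f y\<bar> \<le> B) \<and> (\<forall>y. \<bar>restrict_zero D f y\<bar> \<le> A * infdist y (- D))"
proof -
  have cont: "continuous_on (closure D) f" using f by (simp add: C_k_alpha_closure_def)
  have contD: "continuous_on D f" by (rule continuous_on_subset[OF cont closure_subset])
  have diff: "f differentiable (at z)" if "z \<in> D" for z
  proof -
    have "\<forall>\<beta>. length \<beta> < k \<longrightarrow> (\<forall>z\<in>D. iter_partial \<beta> f differentiable (at z))"
      using f unfolding C_k_alpha_closure_def C_k_on_def by blast
    from this[rule_format, of "[]" z] show ?thesis using that k by simp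
  qed
  have "(\<lambda>y. indicator D y *\<^sub>R f y) \<in> borel_measurable borel"
    by (rule borel_measurable_continuous_on_indicator) (use D contD in auto)
  moreover have "(\<lambda>y. indicator D y *\<^sub>R f y) = restrict_zero D f"
    by (auto simp: fun_eq_iff restrict_zero_def)
  ultimately show "restrict_zero D f \<in> borel_measurable borel" by simp
  have "compact (closure D)" using D by simp
  then have "bounded (f ` closure D)" using cont by (intro compact_imp_bounded compact_continuous_image)
  then obtain B where B: "B > 0" "\<And>y. y \<in> closure D \<Longrightarrow> \<bar>f y\<bar> \<le> B"
    unfolding bounded_pos by auto
  have Bb: "\<bar>restrict_zero D f y\<bar> \<le> B" for y
    using B closure_subset[of D] by (auto simp: restrict_zero_def)
  obtain G where G: "G \<ge> 0" "\<And>z. z \<in> D \<Longrightarrow> norm (grad f z) \<le> G"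
    using C_k_alpha_closure_grad_bounded[OF D(1) f k] by blast
  have "\<bar>restrict_zero D f y\<bar> \<le> G * infdist y (- D)" for y
  proof (cases "y \<in> D")
    case False
    then show ?thesis by (simp add: restrict_zero_def)
  next
    case y: True
    obtain q where q: "q \<in> frontier D" "dist y q \<le> infdist y (- D)"
      using frontier_point_within_infdist[OF D y] by blast
    have qD: "q \<notin> D" using q D by (simp add: frontier_def interior_open)
    then have d0: "dist y q > 0" using y by auto
    define g where "g t = y + t *\<^sub>R (q - y)" for t :: real
    have inD: "g t \<in> D" if "0 \<le> t" "t < 1" for t
    proof (rule ccontr)
      assume "g t \<notin> D"
      then have "infdist y (- D) \<le> dist y (g t)" by (intro infdist_le) simp
      also have "\<dots> = t * dist y q" using that by (simp add: g_def dist_norm norm_minus_commute)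
      also have "\<dots> < dist y q" using that d0 by simp
      finally show False using q by simp
    qed
    \<comment> \<open>At the endpoint t = 1 on the frontier only continuity is available, which is
      all the mean value theorem asks there.\<close>
    have "continuous_on {0..1} (\<lambda>t. f (g t))"
    proof (rule continuous_on_compose2[OF cont])
      show "continuous_on {0..1} g" unfolding g_def by (intro continuous_intros)
      show "g ` {0..1} \<subseteq> closure D"
      proof (rule image_subsetI)
        fix t :: real assume t: "t \<in> {0..1}"
        show "g t \<in> closure D"
        proof (cases "t = 1")
          case True then show ?thesis using q by (simp add: g_def frontier_def)
        next
          case False then show ?thesis using inD[of t] t closure_subset by auto
        qed
      qed
    qed
    moreover have der: "((\<lambda>t. f (g t)) has_derivative (\<lambda>w. grad f (g t) \<bullet> (w *\<^sub>R (q - y)))) (at t)" if "0 < t" "t < 1" for t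
    proof -
      have "(f has_derivative (\<lambda>w. grad f (g t) \<bullet> w)) (at (g t))"
        using that by (intro has_derivative_grad diff inD) auto
      then show ?thesis
        by (rule has_derivative_compose[rotated]) (auto simp: g_def intro!: derivative_eq_intros)
    qed
    ultimately obtain t where t: "0 < t" "t < 1" "f (g 1) - f (g 0) = grad f (g t) \<bullet> ((1 - 0) *\<^sub>R (q - y))"
      using mvt[of 0 1 "\<lambda>t. f (g t)" "\<lambda>t w. grad f (g t) \<bullet> (w *\<^sub>R (q - y))"] by auto
    have "\<bar>f y\<bar> = \<bar>grad f (g t) \<bullet> (q - y)\<bar>"
      using t(3) zero[OF q(1)] by (simp add: g_def)
    also have "\<dots> \<le> norm (grad f (g t)) * norm (q - y)" by (rule Cauchy_Schwarz_ineq2)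
    also have "\<dots> \<le> G * dist y q"
      using G(2)[OF inD[of t]] t by (simp add: dist_norm norm_minus_commute mult_right_mono)
    also have "\<dots> \<le> G * infdist y (- D)" using q G by (intro mult_left_mono) auto
    finally show ?thesis using y by (simp add: restrict_zero_def)
  qed
  with Bb G(1) show "\<exists>B A. A \<ge> 0 \<and> (\<forall>y. \<bar>restrict_zero D f y\<bar> \<le> B) \<and> (\<forall>y. \<bar>restrict_zero D f y\<bar> \<le> A * infdist y (- D))"
    by blast
qed

text \<open>m is the minimum of the quadratic form on the compact unit sphere; homogeneity extends
  the bound to all vectors.\<close>

lemma pos_def_matrix_lower_bound:
  fixes A :: "real^'d^'d::finite"
  assumes "pos_def_matrix A"
  obtains m where "m > 0" "\<And>v. m * (v \<bullet> v) \<le> v \<bullet> (A *v v)"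
proof -
  let ?q = "\<lambda>v. v \<bullet> (A *v v)"
  have cont: "continuous_on (sphere 0 1) ?q"
    by (intro continuous_intros linear_continuous_on matrix_vector_mul_bounded_linear)
  have ne: "sphere (0::real^'d) 1 \<noteq> {}" by simp
  obtain v0 where v0: "v0 \<in> sphere 0 1" "\<And>v. v \<in> sphere 0 1 \<Longrightarrow> ?q v0 \<le> ?q v"
    using continuous_attains_inf[OF compact_sphere ne cont] by blast
  show thesis
  proof (rule that[of "?q v0"])
    have "v0 \<noteq> 0" using v0(1) by auto
    then show "?q v0 > 0" using assms by (simp add: pos_def_matrix_def)
    fix v :: "real^'d"
    show "?q v0 * (v \<bullet> v) \<le> ?q v"
    proof (cases "v = 0")
      case False
      then have "(1 / norm v) *\<^sub>R v \<in> sphere 0 1" by simp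
      from v0(2)[OF this] have "?q v0 \<le> (1 / norm v)\<^sup>2 * ?q v"
        by (simp add: matrix_vector_mult_scaleR power2_eq_square)
      then have "?q v0 * (norm v)\<^sup>2 \<le> ?q v" using False by (simp add: power_divide field_simps)
      then show ?thesis by (simp add: power2_norm_eq_inner)
    qed simp
  qed
qed

section \<open>Convergence of the estimator\<close>

text \<open>For values bounded by B one has |y^2 - z^2| <= 2 B |y - z|, so a single L1 bound
  controls the mean, hence the bias, and the second moment, hence the variance.\<close>

lemma (in prob_space) diff_second_moments_le:
  fixes Y Z :: "'a \<Rightarrow> real"
  assumes [measurable]: "Y \<in> borel_measurable M" "Z \<in> borel_measurable M"
    and Y: "\<And>\<omega>. \<omega> \<in> space M \<Longrightarrow> \<bar>Y \<omega>\<bar> \<le> B" and Z: "\<And>\<omega>. \<omega> \<in> space M \<Longrightarrow> \<bar>Z \<omega>\<bar> \<le> B"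
    and close: "(\<integral>\<^sup>+\<omega>. ennreal \<bar>Y \<omega> - Z \<omega>\<bar> \<partial>M) \<le> ennreal e" and e: "e \<ge> 0"
  shows "\<bar>expectation Y - expectation Z\<bar> \<le> e"
    and "\<bar>expectation (\<lambda>\<omega>. (Y \<omega>)\<^sup>2) - expectation (\<lambda>\<omega>. (Z \<omega>)\<^sup>2)\<bar> \<le> 2 * B * e"
proof -
  have bdd: "integrable M g" if "g \<in> borel_measurable M" "\<And>\<omega>. \<omega> \<in> space M \<Longrightarrow> \<bar>g \<omega>\<bar> \<le> c" for g :: "'a \<Rightarrow> real" and c
    by (rule integrable_const_bound[OF AE_I2]) (use that in auto)
  have iY: "integrable M Y" and iZ: "integrable M Z"
    using bdd[of Y B] bdd[of Z B] Y Z by auto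
  have sq: "y\<^sup>2 \<le> B\<^sup>2" if "\<bar>y\<bar> \<le> B" for y
    using power_mono[OF that, of 2] by simp
  have iY2: "integrable M (\<lambda>\<omega>. (Y \<omega>)\<^sup>2)" and iZ2: "integrable M (\<lambda>\<omega>. (Z \<omega>)\<^sup>2)"
    using bdd[of "\<lambda>\<omega>. (Y \<omega>)\<^sup>2" "B\<^sup>2"] bdd[of "\<lambda>\<omega>. (Z \<omega>)\<^sup>2" "B\<^sup>2"] sq Y Z by auto
  have iD: "integrable M (\<lambda>\<omega>. \<bar>Y \<omega> - Z \<omega>\<bar>)" using iY iZ by simp
  have "ennreal (expectation (\<lambda>\<omega>. \<bar>Y \<omega> - Z \<omega>\<bar>)) \<le> ennreal e"
    using close nn_integral_eq_integral[OF iD] by simp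
  then have D: "expectation (\<lambda>\<omega>. \<bar>Y \<omega> - Z \<omega>\<bar>) \<le> e" using e by simp
  have "\<bar>expectation Y - expectation Z\<bar> = \<bar>expectation (\<lambda>\<omega>. Y \<omega> - Z \<omega>)\<bar>" using iY iZ by simp
  also have "\<dots> \<le> expectation (\<lambda>\<omega>. \<bar>Y \<omega> - Z \<omega>\<bar>)" by (rule integral_abs_bound)
  finally show "\<bar>expectation Y - expectation Z\<bar> \<le> e" using D by simp
  have "\<bar>expectation (\<lambda>\<omega>. (Y \<omega>)\<^sup>2) - expectation (\<lambda>\<omega>. (Z \<omega>)\<^sup>2)\<bar> = \<bar>expectation (\<lambda>\<omega>. (Y \<omega>)\<^sup>2 - (Z \<omega>)\<^sup>2)\<bar>"
    using iY2 iZ2 by simp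
  also have "\<dots> \<le> expectation (\<lambda>\<omega>. \<bar>(Y \<omega>)\<^sup>2 - (Z \<omega>)\<^sup>2\<bar>)" by (rule integral_abs_bound)
  also have "\<dots> \<le> expectation (\<lambda>\<omega>. 2 * B * \<bar>Y \<omega> - Z \<omega>\<bar>)"
  proof (rule integral_mono)
    show "integrable M (\<lambda>\<omega>. \<bar>(Y \<omega>)\<^sup>2 - (Z \<omega>)\<^sup>2\<bar>)" using iY2 iZ2 by simp
    show "integrable M (\<lambda>\<omega>. 2 * B * \<bar>Y \<omega> - Z \<omega>\<bar>)" using iD by simp
    fix \<omega> assume \<omega>: "\<omega> \<in> space M"
    have "(Y \<omega>)\<^sup>2 - (Z \<omega>)\<^sup>2 = (Y \<omega> + Z \<omega>) * (Y \<omega> - Z \<omega>)" by (simp add: power2_eq_square algebra_simps)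
    then have "\<bar>(Y \<omega>)\<^sup>2 - (Z \<omega>)\<^sup>2\<bar> = \<bar>Y \<omega> + Z \<omega>\<bar> * \<bar>Y \<omega> - Z \<omega>\<bar>" by (simp add: abs_mult)
    also have "\<dots> \<le> (2 * B) * \<bar>Y \<omega> - Z \<omega>\<bar>"
      using Y[OF \<omega>] Z[OF \<omega>] by (intro mult_right_mono) auto
    finally show "\<bar>(Y \<omega>)\<^sup>2 - (Z \<omega>)\<^sup>2\<bar> \<le> 2 * B * \<bar>Y \<omega> - Z \<omega>\<bar>" .
  qed
  also have "\<dots> = 2 * B * expectation (\<lambda>\<omega>. \<bar>Y \<omega> - Z \<omega>\<bar>)" by simp
  also have "\<dots> \<le> 2 * B * e"
  proof -
    obtain \<omega> where "\<omega> \<in> space M" using not_empty by blast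
    then have "B \<ge> 0" using Y by fastforce
    then show ?thesis using D by (simp add: mult_left_mono)
  qed
  finally show "\<bar>expectation (\<lambda>\<omega>. (Y \<omega>)\<^sup>2) - expectation (\<lambda>\<omega>. (Z \<omega>)\<^sup>2)\<bar> \<le> 2 * B * e" .
qed

theorem theorem3p6:
  fixes M :: "'a measure" and P :: "'b measure"
    and W :: "real \<Rightarrow> 'a \<Rightarrow> real^'d::finite" and S :: "real \<Rightarrow> 'a \<Rightarrow> real"
    and b :: real and \<nu> :: "real measure"
    and \<mu> :: "real^'d" and \<sigma> Sig :: "real^'d^'d"
    and D :: "(real^'d) set" and f :: "real^'d \<Rightarrow> real"
    and \<alpha> t \<delta> :: real and x :: "real^'d"
    and Z :: "'a \<Rightarrow> real" and Zh :: "real \<Rightarrow> 'a \<Rightarrow> real"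
    and V :: "real \<Rightarrow> nat \<Rightarrow> 'b \<Rightarrow> real"
    and h :: "nat \<Rightarrow> real" and u sd :: real
    and \<psi> :: "real \<Rightarrow> real"
  assumes "standard_brownian_motion M W"
    and "subordinator M S b \<nu>"
    and "b > 0 \<or> emeasure \<nu> {0<..} = \<infinity>"
    and "indep_processes M W S"
    and "pos_def_matrix Sig"
    and "Sig = \<sigma> ** transpose \<sigma>"
    and "0 < \<alpha>" and "\<alpha> < 1"
    and "C_k_alpha_bounded_domain 3 \<alpha> D"
    and "(bounded (f ` D) \<and> f \<in> borel_measurable (restrict_space borel D) \<and>
            (\<exists>\<epsilon>>0. supp_in D f = {} \<or> 2 * \<epsilon> \<le> setdist (supp_in D f) (frontier D)))
         \<or> (C_k_alpha_closure 2 \<alpha> D f \<and>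
            (\<forall>z\<in>frontier D. f z = 0 \<and> generator_on_closure \<mu> Sig D f z = 0))"
    and "t > 0" and "x \<in> D" and "\<delta> < -1"
    and h_def: "\<And>N. h N = real N powr \<delta>"
    and Z_def: "\<And>\<omega>. Z \<omega> = killed_value \<mu> \<sigma> D f t x (\<lambda>s. W s \<omega>) (\<lambda>s. S s \<omega>)"
    and Zh_def: "\<And>\<eta> \<omega>. Zh \<eta> \<omega> = euler_killed_value \<mu> \<sigma> D f t x \<eta> (\<lambda>s. W s \<omega>) (\<lambda>s. S s \<omega>)"
    and u_def: "u = prob_space.expectation M Z"
    and "prob_space.variance M Z > 0"
    and sd_def: "sd = sqrt (prob_space.variance M Z)"
    and "prob_space P"
    and "\<And>N. N \<ge> 1 \<Longrightarrow> iid_copies P (V (h N)) {1..N} M (Zh (h N))"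
    and "continuous_on UNIV \<psi>" and "bounded (range \<psi>)"
  shows "(\<lambda>N. prob_space.expectation P
            (\<lambda>\<omega>. \<psi> (sqrt (real N) * (monte_carlo_mean (V (h N)) N \<omega> - u) / sd)))
         \<longlonglongrightarrow> (LINT w|lborel. \<psi> w * (exp (- w\<^sup>2 / 2) / sqrt (2 * pi)))"
proof -
  note bm = assms(1) and sub = assms(2) and ind = assms(4) and pd = assms(5) and Sig = assms(6)
    and dom = assms(9) and fcond = assms(10) and x = assms(12) and \<delta> = assms(13) and var_pos = assms(18)
    and P = assms(20) and iid = assms(21) and \<psi>_cont = assms(22) and \<psi>_bdd = assms(23)
  interpret M: prob_space M using bm by (simp add: standard_brownian_motion_def)
  interpret P: prob_space P by (rule P)
  have D: "open D" "bounded D" using dom by (auto simp: C_k_alpha_bounded_domain_def)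
  obtain R where R: "R > 0" and exterior: "\<forall>z\<in>frontier D. \<exists>c. dist z c = R \<and> ball c R \<inter> D = {}"
    by (rule C_k_alpha_bounded_domain_exterior_ball[OF dom]) (simp, blast)
  obtain m where m: "m > 0" "\<And>v. m * (v \<bullet> v) \<le> v \<bullet> ((\<sigma> ** transpose \<sigma>) *v v)"
    using pos_def_matrix_lower_bound[OF pd] unfolding Sig by blast
  \<comment> \<open>Both alternatives for f enter through the same consequence: a bounded measurable
    extension by 0 that is at most A times the distance to the complement.\<close>
  have "restrict_zero D f \<in> borel_measurable borel \<and>
    (\<exists>B A. A \<ge> 0 \<and> (\<forall>y. \<bar>restrict_zero D f y\<bar> \<le> B) \<and> (\<forall>y. \<bar>restrict_zero D f y\<bar> \<le> A * infdist y (- D)))"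
    using fcond
  proof (rule disjE)
    assume *: "bounded (f ` D) \<and> f \<in> borel_measurable (restrict_space borel D) \<and>
      (\<exists>\<epsilon>>0. supp_in D f = {} \<or> 2 * \<epsilon> \<le> setdist (supp_in D f) (frontier D))"
    then obtain \<epsilon> where "\<epsilon> > 0" "supp_in D f = {} \<or> 2 * \<epsilon> \<le> setdist (supp_in D f) (frontier D)"
      by blast
    with * show ?thesis
      using restrict_zero_supported_away[OF D, of f \<epsilon>] by blast
  next
    assume *: "C_k_alpha_closure 2 \<alpha> D f \<and> (\<forall>z\<in>frontier D. f z = 0 \<and> generator_on_closure \<mu> Sig D f z = 0)"
    show ?thesis
      using restrict_zero_vanishing_boundary[OF D conjunct1[OF *]] * by simp
  qed
  then obtain B A where fm: "restrict_zero D f \<in> borel_measurable borel" and A: "A \<ge> 0"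
    and f_bd: "\<And>y. \<bar>restrict_zero D f y\<bar> \<le> B" and f_dist: "\<And>y. \<bar>restrict_zero D f y\<bar> \<le> A * infdist y (- D)"
    by blast
  \<comment> \<open>The midpoint between 1 / (-2 \<delta>), above which the bias is of smaller order
    than 1 / sqrt N, and the limit 1/2 of admissible rates. The gap between the two is open because
    \<delta> < -1.\<close>
  define \<gamma> where "\<gamma> = (1 / 2 + 1 / (- 2 * \<delta>)) / 2"
  have inv\<delta>: "0 < 1 / (- 2 * \<delta>)" "1 / (- 2 * \<delta>) < 1 / 2" using \<delta> by (auto simp: field_simps)
  have \<gamma>: "0 < \<gamma>" "\<gamma> < 1 / 2" using inv\<delta> by (auto simp: \<gamma>_def)
  have \<delta>\<gamma>: "1 / 2 + \<delta> * \<gamma> < 0"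
  proof -
    \<comment> \<open>So 1/2 + \<delta> \<gamma> = (\<delta> + 1) / 4, which is negative for
      \<delta> < -1.\<close>
    have "\<delta> * \<gamma> = \<delta> / 4 - 1 / 4" using \<delta> by (simp add: \<gamma>_def field_simps)
    then show ?thesis using \<delta> by simp
  qed
  note err = killed_euler_weak_error[OF bm sub ind m D x R exterior fm f_bd f_dist A \<gamma> Z_def Zh_def]
  from err(5) obtain C h0 where C: "C > 0" "h0 > 0"
    and weak': "\<forall>\<eta>. 0 < \<eta> \<longrightarrow> \<eta> \<le> h0 \<longrightarrow> (\<integral>\<^sup>+\<omega>. ennreal \<bar>Zh \<eta> \<omega> - Z \<omega>\<bar> \<partial>M) \<le> ennreal (C * \<eta> powr \<gamma>)"
    by (elim exE conjE) (rule that)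
  note weak = weak'[rule_format]
  \<comment> \<open>\<open>h 0\<close> is 0, while the laws \<open>Q n\<close> of the array must be
    probability measures for every n; the step size is therefore altered at n = 0 only.\<close>
  define H where "H n = h (max 1 n)" for n
  have H: "H n > 0" for n by (simp add: H_def h_def)
  have Hn: "H n = real n powr \<delta>" if "n \<ge> 1" for n using that by (simp add: H_def h_def max_def)
  define Q where "Q n = distr M borel (Zh (H n))" for n
  have Zhm[measurable]: "Zh (H n) \<in> borel_measurable M" for n by (rule err(3)[OF H])
  have Zm[measurable]: "Z \<in> borel_measurable M" by (rule err(1))
  define e where "e n = C * H n powr \<gamma>" for n
  have e0: "e n \<ge> 0" for n using C by (simp add: e_def)
  have H0: "H \<longlonglongrightarrow> 0"
  proof -
    have "(\<lambda>n. real n powr \<delta>) \<longlonglongrightarrow> 0"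
      using \<delta> by (intro tendsto_neg_powr filterlim_real_sequentially) simp
    then show ?thesis
      by (rule Lim_transform_eventually) (use Hn in \<open>auto simp: eventually_sequentially intro!: exI[of _ 1]\<close>)
  qed
  have ev: "\<forall>\<^sub>F n in sequentially. H n \<le> h0"
    using order_tendstoD(2)[OF H0 C(2)] by eventually_elim simp
  define mean where "mean n = M.expectation (Zh (H n))" for n
  define sec where "sec n = M.expectation (\<lambda>\<omega>. (Zh (H n) \<omega>)\<^sup>2)" for n
  have moments: "\<bar>mean n - u\<bar> \<le> e n \<and> \<bar>sec n - M.expectation (\<lambda>\<omega>. (Z \<omega>)\<^sup>2)\<bar> \<le> 2 * B * e n" if "H n \<le> h0" for n
    unfolding mean_def sec_def u_def e_def
    using M.diff_second_moments_le[OF Zhm Zm err(4)[OF H] err(2) weak[OF H that]] e0[of n] by (simp add: e_def)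
  have elim: "e \<longlonglongrightarrow> 0"
  proof -
    have "(\<lambda>n. C * H n powr \<gamma>) \<longlonglongrightarrow> C * 0"
      using \<gamma> H by (intro tendsto_mult tendsto_const tendsto_zero_powrI[OF H0 tendsto_const]) (auto simp: less_imp_le)
    then show ?thesis by (simp add: e_def[abs_def])
  qed
  have mean_lim: "mean \<longlonglongrightarrow> u"
  proof (rule Lim_transform[OF tendsto_const])
    show "(\<lambda>n. mean n - u) \<longlonglongrightarrow> 0"
      by (rule Lim_null_comparison[OF _ elim]) (use ev moments in \<open>auto elim!: eventually_mono\<close>)
  qed
  have sec_lim: "sec \<longlonglongrightarrow> M.expectation (\<lambda>\<omega>. (Z \<omega>)\<^sup>2)"
  proof (rule Lim_transform[OF tendsto_const])
    have "(\<lambda>n. 2 * B * e n) \<longlonglongrightarrow> 2 * B * 0" by (intro tendsto_intros elim)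
    then have "(\<lambda>n. 2 * B * e n) \<longlonglongrightarrow> 0" by simp
    then show "(\<lambda>n. sec n - M.expectation (\<lambda>\<omega>. (Z \<omega>)\<^sup>2)) \<longlonglongrightarrow> 0"
      by (rule Lim_null_comparison[rotated]) (use ev moments in \<open>auto elim!: eventually_mono\<close>)
  qed
  have bounded_integrable: "integrable M g" if "g \<in> borel_measurable M" "\<And>\<omega>. \<omega> \<in> space M \<Longrightarrow> \<bar>g \<omega>\<bar> \<le> c"
    for g :: "'a \<Rightarrow> real" and c
    by (rule M.integrable_const_bound[OF AE_I2]) (use that in auto)
  have sqB: "y\<^sup>2 \<le> B\<^sup>2" if "\<bar>y\<bar> \<le> B" for y using power_mono[OF that, of 2] by simp
  have variance: "M.variance Y = M.expectation (\<lambda>\<omega>. (Y \<omega>)\<^sup>2) - (M.expectation Y)\<^sup>2"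
    if "Y \<in> borel_measurable M" "\<And>\<omega>. \<omega> \<in> space M \<Longrightarrow> \<bar>Y \<omega>\<bar> \<le> B" for Y
    by (rule M.variance_eq) (use bounded_integrable[of Y B] bounded_integrable[of "\<lambda>\<omega>. (Y \<omega>)\<^sup>2" "B\<^sup>2"] that sqB in auto)
  have Qm: "integral\<^sup>L (Q n) (\<lambda>x. x) = mean n" for n
    unfolding Q_def mean_def by (subst integral_distr) auto
  have Qv: "integral\<^sup>L (Q n) (\<lambda>y. (y - integral\<^sup>L (Q n) (\<lambda>x. x))\<^sup>2) = sec n - (mean n)\<^sup>2" for n
  proof -
    have "integral\<^sup>L (Q n) (\<lambda>y. (y - mean n)\<^sup>2) = M.variance (Zh (H n))"
      unfolding Q_def by (subst integral_distr) (auto simp: mean_def)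
    then show ?thesis using variance[OF Zhm err(4)[OF H], of n] by (simp add: Qm sec_def mean_def)
  qed
  have sd0: "sd > 0" and sd2: "sd\<^sup>2 = M.variance Z" using var_pos by (auto simp: sd_def)
  have var_Z: "M.variance Z = M.expectation (\<lambda>\<omega>. (Z \<omega>)\<^sup>2) - u\<^sup>2"
    using variance[OF Zm err(2)] by (simp only: u_def)
  have weak_conv: "weak_conv_m
    (\<lambda>n. distr P borel (\<lambda>\<omega>. sqrt (real n) * (1 / real n * (\<Sum>k=1..n. V (h n) k \<omega>) - u) / sd))
    std_normal_distribution"
  proof (rule P.clt_bounded_triangular_array)
    show "P.indep_vars (\<lambda>_. borel) (V (h n)) {1..n}" if "n \<ge> 1" for n
      using iid[OF that] by (simp add: iid_copies_def)
    show "distr P borel (V (h n) k) = Q n" if "n \<ge> 1" "k \<in> {1..n}" for n k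
      using iid[OF that(1)] that by (simp add: iid_copies_def Q_def H_def max_def)
    show "real_distribution (Q n)" for n
      unfolding Q_def by (rule M.real_distribution_distr) simp
    show "AE y in Q n. \<bar>y\<bar> \<le> B" for n
      unfolding Q_def by (subst AE_distr_iff) (use err(4)[OF H] in auto)
    show "sd > 0" by (rule sd0)
    \<comment> \<open>The variance is the second moment minus the squared mean, and both converge by
      the L1 estimate.\<close>
    show "(\<lambda>n. integral\<^sup>L (Q n) (\<lambda>y. (y - integral\<^sup>L (Q n) (\<lambda>x. x))\<^sup>2)) \<longlonglongrightarrow> sd\<^sup>2"
      unfolding Qv sd2 var_Z by (intro tendsto_intros sec_lim mean_lim)
    show "(\<lambda>n. sqrt (real n) * (integral\<^sup>L (Q n) (\<lambda>x. x) - u)) \<longlonglongrightarrow> 0"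
      unfolding Qm
    proof (rule Lim_null_comparison)
      \<comment> \<open>The L1 error at step size n^\<delta>, multiplied by sqrt n; its exponent is
        the negative number found above.\<close>
      show "\<forall>\<^sub>F n in sequentially. norm (sqrt (real n) * (mean n - u)) \<le> C * real n powr (1 / 2 + \<delta> * \<gamma>)"
        using ev eventually_ge_at_top[of 1]
      proof eventually_elim
        fix n :: nat assume n: "H n \<le> h0" "1 \<le> n"
        have "norm (sqrt (real n) * (mean n - u)) \<le> sqrt (real n) * e n"
          using moments[OF n(1)] by (simp add: abs_mult mult_left_mono)
        also have "\<dots> = C * real n powr (1 / 2 + \<delta> * \<gamma>)"
          using n by (simp add: e_def Hn powr_powr powr_add powr_half_sqrt)
        finally show "norm (sqrt (real n) * (mean n - u)) \<le> C * real n powr (1 / 2 + \<delta> * \<gamma>)" .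
      qed
      have "(\<lambda>n. C * real n powr (1 / 2 + \<delta> * \<gamma>)) \<longlonglongrightarrow> C * 0"
        using \<delta>\<gamma> by (intro tendsto_mult tendsto_const tendsto_neg_powr filterlim_real_sequentially)
      then show "(\<lambda>n. C * real n powr (1 / 2 + \<delta> * \<gamma>)) \<longlonglongrightarrow> 0" by simp
    qed
  qed
  obtain K where K: "\<And>y. norm (\<psi> y) \<le> K" using \<psi>_bdd unfolding bounded_iff by auto
  have cont: "isCont \<psi> y" for y using \<psi>_cont by (simp add: continuous_on_eq_continuous_at)
  have \<psi>m[measurable]: "\<psi> \<in> borel_measurable borel"
    by (rule borel_measurable_continuous_onI[OF \<psi>_cont])
  let ?T = "\<lambda>n \<omega>. sqrt (real n) * (1 / real n * (\<Sum>k=1..n. V (h n) k \<omega>) - u) / sd"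
  have Vm[measurable]: "V (h n) k \<in> borel_measurable P" if "k \<in> {1..n}" for n k
    using iid[of n] that by (auto simp: iid_copies_def P.indep_vars_def2)
  have Tm[measurable]: "?T n \<in> borel_measurable P" for n by measurable
  have "(\<lambda>n. integral\<^sup>L (distr P borel (?T n)) \<psi>) \<longlonglongrightarrow> integral\<^sup>L std_normal_distribution \<psi>"
  proof (rule weak_conv_imp_integral_bdd_continuous_conv[OF _ _ weak_conv cont K])
    show "real_distribution (distr P borel (?T n))" for n by (rule P.real_distribution_distr) simp
    show "real_distribution std_normal_distribution" by (rule real_dist_normal_dist)
  qed
  moreover have "integral\<^sup>L (distr P borel (?T n)) \<psi> =
      P.expectation (\<lambda>\<omega>. \<psi> (sqrt (real n) * (monte_carlo_mean (V (h n)) n \<omega> - u) / sd))" for n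
    unfolding monte_carlo_mean_def by (rule integral_distr) simp_all
  moreover have "integral\<^sup>L std_normal_distribution \<psi> = (LINT w|lborel. \<psi> w * (exp (- w\<^sup>2 / 2) / sqrt (2 * pi)))"
    by (subst integral_density) (auto simp: std_normal_density_def mult.commute intro!: Bochner_Integration.integral_cong)
  ultimately show ?thesis by simp
qed

end
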